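(* For every integer $k\ge 2$ there exist finitely many rational numbers $\omega^{(C_3)}_{k,i}$, indexed by integers $i\le 3k-2$, such that $$\widehat W_{k,C_3}(z)=\frac{b_k}{(1-T(z))^{3k}}-\frac{c'_k}{(1-T(z))^{3k-1}}+\sum_{i\le 3k-2}\frac{\omega^{(C_3)}_{k,i}}{(1-T(z))^{i}},$$ where the sum is finite, and the numbers $c'_k$ are defined for all $k\ge1$ by $c'_1=\frac{25}{24}$ and $c'_{k+1}=c_{k+1}+\frac32 k b_k$.
   Context: $T(z)=\sum_{n\ge1}n^{n-1}z^n/n!$ is the EGF of rooted labelled trees. $\widehat W_{k,C_3}(z)=\sum_{n}g_{n,k}z^n/n!$, where $g_{n,k}$ is the number of connected simple graphs on vertex set $\{1,\dots,n\}$ with $n+k$ edges containing no triangle (as a not necessarily induced subgraph). Wright's constants: $b_1=\frac5{24}$, $2(k+1)b_{k+1}=3k(k+1)b_k+3\sum_{t=1}^{k-1}t(k-t)b_tb_{k-t}$ for $k\ge1$; $c_1=\frac{19}{24}$, $2(3k+2)c_{k+1}=8(k+1)b_{k+1}+3kb_k+(3k+2)(3k-1)c_k+6\sum_{t=1}^{k-1}t(3k-3t-1)b_tc_{k-t}$ for $k\ge1$. Terms with negative index $i$ in the sum are polynomials in $T$. *)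

theory Defs
  imports "HOL-Computational_Algebra.Formal_Power_Series"
begin

text \<open>A simple graph on the vertex set \<open>V\<close> is given by its set \<open>E\<close> of two-element edges.\<close>

definition simple_graph :: "'a set \<Rightarrow> 'a set set \<Rightarrow> bool" where
  "simple_graph V E \<longleftrightarrow> (\<forall>e\<in>E. e \<subseteq> V \<and> card e = 2)"

definition connected_graph :: "'a set \<Rightarrow> 'a set set \<Rightarrow> bool" where
  "connected_graph V E \<longleftrightarrow> V \<noteq> {} \<and> (\<forall>u\<in>V. \<forall>v\<in>V. (u, v) \<in> {(x, y). {x, y} \<in> E}\<^sup>*)"

definition triangle_free :: "'a set set \<Rightarrow> bool" where
  "triangle_free E \<longleftrightarrow> \<not> (\<exists>x y z. x \<noteq> y \<and> y \<noteq> z \<and> x \<noteq> z \<and>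
     {x, y} \<in> E \<and> {y, z} \<in> E \<and> {x, z} \<in> E)"

definition triangle_free_count :: "nat \<Rightarrow> nat \<Rightarrow> nat" where
  "triangle_free_count n k = card {E. simple_graph {1..n} E \<and> connected_graph {1..n} E \<and>
     triangle_free E \<and> card E = n + k}"

definition triangle_free_egf :: "nat \<Rightarrow> rat fps" where
  "triangle_free_egf k = Abs_fps (\<lambda>n. of_nat (triangle_free_count n k) / fact n)"

definition rooted_tree_egf :: "rat fps" where
  "rooted_tree_egf = Abs_fps (\<lambda>n. if n = 0 then 0 else of_nat (n ^ (n - 1)) / fact n)"

text \<open>
  The constants below are indexed from 1; the value at 0 is a dummy that does not enter
  any value at a positive index. The recurrences are solved for the leading term; their usual
  form is recovered in the lemmas that follow.
\<close>

fun wright_b :: "nat \<Rightarrow> rat" where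
  "wright_b 0 = 0"
| "wright_b (Suc 0) = 5 / 24"
| "wright_b (Suc (Suc m)) =
     (let k = Suc m in
       (3 * of_nat k * (of_nat k + 1) * wright_b k
        + 3 * (\<Sum>t=1..m. of_nat t * of_nat (k - t) * wright_b t * wright_b (k - t)))
       / (2 * (of_nat k + 1)))"

fun wright_c :: "nat \<Rightarrow> rat" where
  "wright_c 0 = 0"
| "wright_c (Suc 0) = 19 / 24"
| "wright_c (Suc (Suc m)) =
     (let k = Suc m in
       (8 * (of_nat k + 1) * wright_b (k + 1) + 3 * of_nat k * wright_b k
        + (3 * of_nat k + 2) * (3 * of_nat k - 1) * wright_c k
        + 6 * (\<Sum>t=1..m. of_nat t * (3 * of_nat k - 3 * of_nat t - 1)
                            * wright_b t * wright_c (k - t)))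
       / (2 * (3 * of_nat k + 2)))"

fun wright_c' :: "nat \<Rightarrow> rat" where
  "wright_c' 0 = 0"
| "wright_c' (Suc 0) = 25 / 24"
| "wright_c' (Suc (Suc m)) = wright_c (Suc (Suc m)) + 3 / 2 * of_nat (Suc m) * wright_b (Suc m)"

lemma wright_b_rec:
  assumes "k \<ge> 1"
  shows "2 * (of_nat k + 1) * wright_b (k + 1) =
    3 * of_nat k * (of_nat k + 1) * wright_b k
    + 3 * (\<Sum>t=1..k-1. of_nat t * of_nat (k - t) * wright_b t * wright_b (k - t))"
proof -
  obtain m where k: "k = Suc m"
    using assms by (cases k) auto
  have "0 < 2 * (of_nat k + (1::rat))"
    by (intro mult_pos_pos add_nonneg_pos) simp_all
  hence nz: "2 * (of_nat k + 1) \<noteq> (0::rat)"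
    by simp
  show ?thesis
    unfolding k by (simp only: wright_b.simps Let_def add_Suc_right add_0_right One_nat_def
      diff_Suc_Suc diff_zero
      nonzero_mult_div_cancel_left[OF nz[unfolded k]] times_divide_eq_right)
qed

lemma wright_c_rec:
  assumes "k \<ge> 1"
  shows "2 * (3 * of_nat k + 2) * wright_c (k + 1) =
    8 * (of_nat k + 1) * wright_b (k + 1) + 3 * of_nat k * wright_b k
    + (3 * of_nat k + 2) * (3 * of_nat k - 1) * wright_c k
    + 6 * (\<Sum>t=1..k-1. of_nat t * (3 * of_nat k - 3 * of_nat t - 1)
                          * wright_b t * wright_c (k - t))"
proof -
  obtain m where k: "k = Suc m"
    using assms by (cases k) auto
  have "0 < 2 * (3 * of_nat k + (2::rat))"
    by (intro mult_pos_pos add_nonneg_pos) simp_all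
  hence nz: "2 * (3 * of_nat k + 2) \<noteq> (0::rat)"
    by simp
  show ?thesis
    unfolding k by (simp only: wright_c.simps(3) Let_def add_Suc_right add_0_right One_nat_def
      diff_Suc_Suc diff_zero
      nonzero_mult_div_cancel_left[OF nz[unfolded k]] times_divide_eq_right)
qed

lemma wright_c'_rec:
  assumes "k \<ge> 1"
  shows "wright_c' (k + 1) = wright_c (k + 1) + 3 / 2 * of_nat k * wright_b k"
  using assms by (cases k) (auto simp del: wright_b.simps wright_c.simps)

end

theory Submission
  imports Defs "HOL-Library.Ramsey" "HOL-Computational_Algebra.Polynomial_FPS"
begin

text \<open>
  Let \<open>F(z, w)\<close> enumerate the triangle-free graphs by vertices and edges, so that \<open>log F\<close>
  enumerates the connected ones. Inclusion-exclusion over sets of triangles writes \<open>F\<close> as the image of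
  an exponential \<open>exp Phi\<close> under \<open>z ^ n \<mapsto> (1 + w) ^ (n choose 2) z ^ n\<close>, where \<open>Phi\<close> is
  the sum over connected sets of triples. A connected set of triples on \<open>m\<close> points covers at least
  \<open>3 (m - 1) / 2\<close> pairs, so that only finitely many of them matter for a given excess.

  Two equations follow for the series \<open>W\<^sub>k\<close> of excess \<open>k\<close>. Marking a vertex expresses
  \<open>\<theta> W\<^sub>k\<close>, with \<open>\<theta> = z d/dz\<close>, by the quotients \<open>F((1 + w) ^ m z) / F(z)\<close>; inductively \<open>\<theta> W\<^sub>k\<close> is a
  polynomial in \<open>T\<close> over \<open>(1 - T) ^ (3 k + 2)\<close>. Marking an edge gives a differential equation of Wright's
  type for \<open>\<theta> W\<^sub>k + k W\<^sub>k\<close>. Together they determine \<open>W\<^sub>k\<close> without an integration, so no logarithm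
  can appear, and the two leading coefficients in the second equation are the recurrences for the
  constants.
\<close>


text \<open>Exponentials of two-variable series are never formed: A = exp B is encoded as
  \<open>theta A = A * theta B\<close> with fixed constant terms. The quotients F((1 + w)^m z) /
  F(z) come from N choose 2 = (m choose 2) + m (N - m) + (N - m choose 2), which separates the pairs
  touching m marked points from the rest. After rescaling z to z / w, the powers of w count excess
  plus one. Excess 0 contains a true logarithm, -1/2 log(1 - T), but in the edge equation for excess
  1 its series has the factor 0, and otherwise it occurs only under \<open>theta\<close>. Triangles
  leave one trace in the two leading coefficients: the single triangle contributes -T^3 / 2, which
  changes the second coefficient of \<open>theta (W 1)\<close> from -3/2 to -2. This turns 19/24
  into 25/24 and adds 3 k b_k to the right-hand side of the recurrence for c. That the new
  recurrence is solved by c_{k+1} + (3/2) k b_k is a separate identity, obtained from the recurrence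
  for b by symmetrising a convolution.\<close>

unbundle fps_syntax

section \<open>Connected set systems and the exponential formula\<close>

text \<open>One notion serves two-element edges and triples, so that the exponential formula is
  proved once for both. Triples that share a single vertex are already linked.\<close>

definition hyper_connected :: "'a set \<Rightarrow> 'a set set \<Rightarrow> bool" where
  "hyper_connected V E \<longleftrightarrow>
     V \<noteq> {} \<and> (\<forall>u\<in>V. \<forall>v\<in>V. (u, v) \<in> {(x, y). \<exists>e\<in>E. x \<in> e \<and> y \<in> e}\<^sup>*)"

lemma hyper_connected_crossing:
  assumes "hyper_connected V E" "U \<subseteq> V" "U \<noteq> {}" "U \<noteq> V"
  shows "\<exists>e\<in>E. e \<inter> U \<noteq> {} \<and> \<not> e \<subseteq> U"
proof (rule ccontr)
  assume no: "\<not> ?thesis"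
  obtain u where u: "u \<in> U" using assms by blast
  obtain v where v: "v \<in> V" "v \<notin> U" using assms by blast
  have "(u, v) \<in> {(x, y). \<exists>e\<in>E. x \<in> e \<and> y \<in> e}\<^sup>*"
    using assms u v unfolding hyper_connected_def by blast
  hence "v \<in> U"
    by (induction rule: rtrancl_induct) (use u no in blast)+
  with v show False by blast
qed

lemma hyper_connected_image:
  assumes "hyper_connected V E"
  shows "hyper_connected (g ` V) ((`) g ` E)"
proof -
  have "(g u, g v) \<in> {(x, y). \<exists>e\<in>(`) g ` E. x \<in> e \<and> y \<in> e}\<^sup>*"
    if "(u, v) \<in> {(x, y). \<exists>e\<in>E. x \<in> e \<and> y \<in> e}\<^sup>*" for u v
    using that
  proof (induction rule: rtrancl_induct)
    case (step y z)
    have "(g y, g z) \<in> {(x, y). \<exists>e\<in>(`) g ` E. x \<in> e \<and> y \<in> e}"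
      using step by blast
    with step.IH show ?case by (rule rtrancl_into_rtrancl)
  qed simp
  with assms show ?thesis unfolding hyper_connected_def by blast
qed

definition hyper_component :: "'a set set \<Rightarrow> 'a \<Rightarrow> 'a set" where
  "hyper_component E v = {u. (v, u) \<in> {(x, y). \<exists>e\<in>E. x \<in> e \<and> y \<in> e}\<^sup>*}"

lemma hyper_component_self: "v \<in> hyper_component E v"
  by (simp add: hyper_component_def)

lemma hyper_component_closed:
  assumes "e \<in> E" "x \<in> e" "x \<in> hyper_component E v"
  shows "e \<subseteq> hyper_component E v"
proof
  fix y assume "y \<in> e"
  hence "(x, y) \<in> {(x, y). \<exists>e\<in>E. x \<in> e \<and> y \<in> e}" using assms by blast
  with assms(3) show "y \<in> hyper_component E v"
    unfolding hyper_component_def by (auto intro: rtrancl_into_rtrancl)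
qed

lemma hyper_component_subset:
  assumes "\<And>e. e \<in> E \<Longrightarrow> e \<subseteq> V" "v \<in> V"
  shows "hyper_component E v \<subseteq> V"
proof
  fix u assume "u \<in> hyper_component E v"
  hence "(v, u) \<in> {(x, y). \<exists>e\<in>E. x \<in> e \<and> y \<in> e}\<^sup>*" by (simp add: hyper_component_def)
  thus "u \<in> V" by (induction rule: rtrancl_induct) (use assms in blast)+
qed

lemma hyper_connected_component:
  "hyper_connected (hyper_component E v) (E \<inter> Pow (hyper_component E v))"
proof -
  let ?U = "hyper_component E v"
  let ?R = "{(x, y). \<exists>e\<in>E \<inter> Pow ?U. x \<in> e \<and> y \<in> e}"
  have to: "(v, u) \<in> ?R\<^sup>*" if "u \<in> ?U" for u
  proof -
    have "(v, u) \<in> {(x, y). \<exists>e\<in>E. x \<in> e \<and> y \<in> e}\<^sup>*" using that by (simp add: hyper_component_def)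
    thus ?thesis
    proof (induction rule: rtrancl_induct)
      case (step y z)
      then obtain e where e: "e \<in> E" "y \<in> e" "z \<in> e" by blast
      have "y \<in> ?U" using step.hyps by (simp add: hyper_component_def)
      hence "e \<subseteq> ?U" using e hyper_component_closed by metis
      hence "(y, z) \<in> ?R" using e by blast
      with step.IH show ?case by (rule rtrancl_into_rtrancl)
    qed simp
  qed
  have "sym ?R" by (auto simp: sym_def)
  hence "sym (?R\<^sup>*)" by (rule sym_rtrancl)
  hence conn: "(u, w) \<in> ?R\<^sup>*" if "u \<in> ?U" "w \<in> ?U" for u w
    using to[OF that(1)] to[OF that(2)] by (meson rtrancl_trans symD)
  have "?U \<noteq> {}" using hyper_component_self[of v E] by auto
  thus ?thesis
    unfolding hyper_connected_def by (intro conjI ballI conn)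
qed

lemma hyper_component_eqI:
  assumes "hyper_connected U E1" "v \<in> U" "\<And>e. e \<in> E1 \<Longrightarrow> e \<subseteq> U" "\<And>e. e \<in> E2 \<Longrightarrow> e \<inter> U = {}"
  shows "hyper_component (E1 \<union> E2) v = U"
proof
  show "hyper_component (E1 \<union> E2) v \<subseteq> U"
  proof
    fix u assume "u \<in> hyper_component (E1 \<union> E2) v"
    hence "(v, u) \<in> {(x, y). \<exists>e\<in>E1 \<union> E2. x \<in> e \<and> y \<in> e}\<^sup>*" by (simp add: hyper_component_def)
    thus "u \<in> U"
    proof (induction rule: rtrancl_induct)
      case (step y z)
      then obtain e where e: "e \<in> E1 \<union> E2" "y \<in> e" "z \<in> e" by blast
      hence "e \<in> E1" using step.IH assms(4)[of e] by blast
      thus ?case using assms(3) e by blast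
    qed (rule assms(2))
  qed
next
  have "{(x, y). \<exists>e\<in>E1. x \<in> e \<and> y \<in> e}\<^sup>* \<subseteq> {(x, y). \<exists>e\<in>E1 \<union> E2. x \<in> e \<and> y \<in> e}\<^sup>*"
    by (rule rtrancl_mono) blast
  thus "U \<subseteq> hyper_component (E1 \<union> E2) v"
    using assms(1,2) unfolding hyper_connected_def hyper_component_def by blast
qed

text \<open>The exponential formula rests on weights that multiply over disjoint vertex sets and
  depend only on the isomorphism type. \<open>r_pos\<close> excludes the empty edge, which would lie
  in every vertex set and spoil the uniqueness of the splitting into components.\<close>

locale hypergraph_weight =
  fixes r :: nat and wt :: "nat set set \<Rightarrow> 'b :: comm_ring_1"
  assumes r_pos: "0 < r"
    and wt_union: "\<And>A B E D. \<lbrakk>finite A; finite B; A \<inter> B = {}; E \<subseteq> nsets A r; D \<subseteq> nsets B r\<rbrakk>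
      \<Longrightarrow> wt (E \<union> D) = wt E * wt D"
    and wt_image: "\<And>g A E. \<lbrakk>finite A; inj_on g A; E \<subseteq> nsets A r\<rbrakk> \<Longrightarrow> wt ((`) g ` E) = wt E"
begin

definition total :: "nat set \<Rightarrow> 'b" where
  "total V = (\<Sum>E\<in>Pow (nsets V r). wt E)"

definition conn :: "nat set \<Rightarrow> 'b" where
  "conn V = (\<Sum>E | E \<subseteq> nsets V r \<and> hyper_connected V E. wt E)"

lemma edge_nonempty: "e \<in> nsets V r \<Longrightarrow> e \<noteq> {}"
  using r_pos by (auto simp: nsets_def)

lemma image_image_inverse:
  assumes "inj_on g A" "E \<subseteq> nsets A r"
  shows "(`) (inv_into A g) ` (`) g ` E = E"
proof -
  have "(inv_into A g) ` g ` e = e" if "e \<in> E" for e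
    using that assms by (intro inv_into_image_cancel) (auto simp: nsets_def)
  thus ?thesis by (force simp: image_image)
qed

lemma image_nsets:
  assumes "inj_on g A" "E \<subseteq> nsets A r"
  shows "(`) g ` E \<subseteq> nsets (g ` A) r"
proof -
  have "card (g ` e) = card e" if "e \<in> E" for e
    using that assms by (intro card_image) (auto simp: nsets_def elim: inj_on_subset)
  moreover have "g ` e \<subseteq> g ` A \<and> finite (g ` e) \<and> card e = r" if "e \<in> E" for e
    using that assms(2) by (auto simp: nsets_def)
  ultimately show ?thesis unfolding nsets_def by (simp add: image_subset_iff)
qed

lemma total_conn_image:
  assumes "finite A" "inj_on g A"
  shows "total (g ` A) = total A" "conn (g ` A) = conn A"
proof -
  let ?h = "inv_into A g"
  have inj: "inj_on ?h (g ` A)" by (rule inj_on_inv_into) simp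
  have im: "?h ` g ` A = A" using assms by (simp add: inv_into_image_cancel)
  have pull: "(`) ?h ` E \<subseteq> nsets A r" if "E \<subseteq> nsets (g ` A) r" for E
    using image_nsets[OF inj that] im by simp
  have gh: "(`) g ` (`) ?h ` E = E" if E: "E \<subseteq> nsets (g ` A) r" for E
  proof -
    have "g ` ?h ` e = e" if "e \<in> E" for e
      using that E by (intro image_inv_into_cancel[OF refl]) (auto simp: nsets_def)
    thus ?thesis by (force simp: image_image)
  qed
  have hg: "(`) ?h ` (`) g ` E = E" if "E \<subseteq> nsets A r" for E
    using image_image_inverse[OF assms(2) that] .
  have wt_h: "wt ((`) ?h ` E) = wt E" if "E \<subseteq> nsets (g ` A) r" for E
    using wt_image[OF finite_imageI[OF assms(1)] inj that] .
  have conn_h: "hyper_connected A ((`) ?h ` E)" if "hyper_connected (g ` A) E" for E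
    using hyper_connected_image[OF that, of ?h] im by simp
  show "total (g ` A) = total A"
    unfolding total_def
    by (rule sum.reindex_bij_witness[where i = "\<lambda>E. (`) g ` E" and j = "\<lambda>E. (`) ?h ` E"])
      (simp_all only: Pow_iff pull gh hg image_nsets[OF assms(2)] wt_h)
  show "conn (g ` A) = conn A"
    unfolding conn_def
    by (rule sum.reindex_bij_witness[where i = "\<lambda>E. (`) g ` E" and j = "\<lambda>E. (`) ?h ` E"])
      (simp_all only: mem_Collect_eq pull gh hg image_nsets[OF assms(2)] wt_h conn_h
        hyper_connected_image[of A _ g] simp_thms)
qed

lemma total_conn_card:
  assumes "finite A"
  shows "total A = total {1..card A}" "conn A = conn {1..card A}"
proof -
  obtain g where "bij_betw g {1..card A} A"
    using ex_bij_betw_finite_nat[OF assms] finite_same_card_bij[of "{1..card A}" A] assms by auto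
  thus "total A = total {1..card A}" "conn A = conn {1..card A}"
    using total_conn_image[of "{1..card A}" g] by (auto simp: bij_betw_def)
qed

text \<open>A hypergraph is the same as the component U of v, a connected hypergraph on U, and an
  arbitrary hypergraph on V - U; the weight factors accordingly.\<close>

lemma total_split:
  assumes "finite V" "v \<in> V"
  shows "total V = (\<Sum>U | v \<in> U \<and> U \<subseteq> V. conn U * total (V - U))"
proof -
  let ?S = "{U. v \<in> U \<and> U \<subseteq> V}"
  have fin: "finite U" if "U \<in> ?S" for U
    using that finite_subset assms by auto
  have "(\<Sum>U\<in>?S. conn U * total (V - U)) =
      (\<Sum>U\<in>?S. \<Sum>E1 | E1 \<subseteq> nsets U r \<and> hyper_connected U E1. \<Sum>E2\<in>Pow (nsets (V - U) r). wt E1 * wt E2)"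
    by (simp add: conn_def total_def sum_product)
  also have "\<dots> = (\<Sum>(U, E1, E2)\<in>Sigma ?S (\<lambda>U. {E1. E1 \<subseteq> nsets U r \<and> hyper_connected U E1} \<times> Pow (nsets (V - U) r)). wt E1 * wt E2)"
  proof -
    have f1: "finite {E1. E1 \<subseteq> nsets U r \<and> hyper_connected U E1}" if "U \<in> ?S" for U
      using finite_imp_finite_nsets[OF fin[OF that]] by (auto intro: finite_subset[of _ "Pow (nsets U r)"])
    have f2: "finite (Pow (nsets (V - U) r))" for U
      using finite_imp_finite_nsets assms by auto
    have "finite ?S" using assms by (auto intro: finite_subset[of _ "Pow V"])
    thus ?thesis
      using f1 f2 by (subst sum.Sigma[symmetric]) (auto simp: sum.cartesian_product intro!: sum.cong)
  qed
  also have "\<dots> = total V"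
    unfolding total_def
  proof (rule sum.reindex_bij_witness[where j = "\<lambda>(U, E1, E2). E1 \<union> E2" and
        i = "\<lambda>E. (hyper_component E v, E \<inter> Pow (hyper_component E v), E \<inter> Pow (V - hyper_component E v))"],
      goal_cases)
    case (1 a)
    then obtain U E1 E2 where a: "a = (U, E1, E2)" "v \<in> U" "U \<subseteq> V" "E1 \<subseteq> nsets U r"
      "hyper_connected U E1" "E2 \<subseteq> nsets (V - U) r" by auto
    have s1: "e \<subseteq> U" "e \<noteq> {}" if "e \<in> E1" for e
      using that a(4) edge_nonempty[of e U] by (auto simp: nsets_def)
    have s2: "e \<subseteq> V - U" "e \<noteq> {}" if "e \<in> E2" for e
      using that a(6) edge_nonempty[of e "V - U"] by (auto simp: nsets_def)
    have c: "hyper_component (E1 \<union> E2) v = U"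
      by (rule hyper_component_eqI[OF a(5,2) s1(1)]) (use s2(1) in auto)
    have "e \<notin> Pow (V - U)" if "e \<in> E1" for e using s1[OF that] by auto
    moreover have "e \<notin> Pow U" if "e \<in> E2" for e using s2[OF that] by auto
    moreover have "E1 \<subseteq> Pow U" "E2 \<subseteq> Pow (V - U)" using s1(1) s2(1) by blast+
    ultimately have "(E1 \<union> E2) \<inter> Pow U = E1" "(E1 \<union> E2) \<inter> Pow (V - U) = E2"
      by blast+
    thus ?case by (simp add: a c)
  next
    case (2 a)
    then obtain U E1 E2 where a: "a = (U, E1, E2)" "U \<subseteq> V" "E1 \<subseteq> nsets U r"
      "E2 \<subseteq> nsets (V - U) r" by auto
    have "nsets U r \<subseteq> nsets V r" "nsets (V - U) r \<subseteq> nsets V r"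
      using a by (auto intro!: nsets_mono)
    thus ?case using a by auto
  next
    case (3 E)
    have sub: "hyper_component E v \<subseteq> V"
      using 3 assms by (intro hyper_component_subset) (auto simp: nsets_def)
    have "e \<subseteq> hyper_component E v \<or> e \<subseteq> V - hyper_component E v" if "e \<in> E" for e
    proof (cases "e \<inter> hyper_component E v = {}")
      case True
      moreover have "e \<subseteq> V" using that 3 by (auto simp: nsets_def)
      ultimately show ?thesis by blast
    next
      case False
      thus ?thesis using hyper_component_closed[OF that] by blast
    qed
    thus ?case by auto
  next
    case (4 E)
    have sub: "hyper_component E v \<subseteq> V"
      using 4 assms by (intro hyper_component_subset) (auto simp: nsets_def)
    show ?case
      using sub hyper_connected_component[of E v] hyper_component_self[of v E] 4
      by (auto simp: nsets_def)
  next
    case (5 a)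
    then obtain U E1 E2 where a: "a = (U, E1, E2)" "v \<in> U" "U \<subseteq> V" "E1 \<subseteq> nsets U r"
      "hyper_connected U E1" "E2 \<subseteq> nsets (V - U) r" by auto
    have "wt (E1 \<union> E2) = wt E1 * wt E2"
      using a fin[of U] assms by (intro wt_union[of U "V - U"]) auto
    thus ?case by (simp add: a)
  qed
  finally show ?thesis ..
qed

lemma card_subsets_containing:
  assumes "finite V" "v \<in> V" "j > 0"
  shows "card {U. v \<in> U \<and> U \<subseteq> V \<and> card U = j} = (card V - 1) choose (j - 1)"
proof -
  have "card {U. v \<in> U \<and> U \<subseteq> V \<and> card U = j} = card {W. W \<subseteq> V - {v} \<and> card W = j - 1}"
  proof (rule bij_betw_same_card[where f = "\<lambda>U. U - {v}"], rule bij_betw_byWitness[where f' = "insert v"])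
    show "(\<lambda>U. U - {v}) ` {U. v \<in> U \<and> U \<subseteq> V \<and> card U = j} \<subseteq> {W. W \<subseteq> V - {v} \<and> card W = j - 1}"
      by auto
    show "insert v ` {W. W \<subseteq> V - {v} \<and> card W = j - 1} \<subseteq> {U. v \<in> U \<and> U \<subseteq> V \<and> card U = j}"
      using assms
    proof clarsimp
      fix W assume W: "W \<subseteq> V - {v}" "card W = j - Suc 0"
      hence "finite W" "v \<notin> W" using assms finite_subset by auto
      thus "W \<subseteq> V \<and> card (insert v W) = j" using W assms by auto
    qed
  qed auto
  also have "\<dots> = (card V - 1) choose (j - 1)"
    using assms by (subst n_subsets) auto
  finally show ?thesis .
qed

text \<open>Coefficient form of the exponential formula: j is the size of the component of n, and
  the binomial counts the possible vertex sets of that component.\<close>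

theorem total_recurrence:
  assumes "n > 0"
  shows "total {1..n} = (\<Sum>j=1..n. of_nat ((n - 1) choose (j - 1)) * conn {1..j} * total {1..n - j})"
proof -
  let ?V = "{1..n}"
  let ?S = "{U. n \<in> U \<and> U \<subseteq> ?V}"
  have finS: "finite ?S" by (rule finite_subset[of _ "Pow ?V"]) auto
  have fin: "finite U" if "U \<in> ?S" for U using that finite_subset by auto
  have "total ?V = (\<Sum>U\<in>?S. conn U * total (?V - U))"
    using assms by (intro total_split) auto
  also have "\<dots> = (\<Sum>U\<in>?S. conn {1..card U} * total {1..n - card U})"
  proof (rule sum.cong[OF refl])
    fix U assume U: "U \<in> ?S"
    have "card (?V - U) = n - card U" using U fin[OF U] by (subst card_Diff_subset) auto
    thus "conn U * total (?V - U) = conn {1..card U} * total {1..n - card U}"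
      using total_conn_card(2)[OF fin[OF U]] total_conn_card(1)[of "?V - U"] by simp
  qed
  also have "\<dots> = (\<Sum>j=1..n. \<Sum>U | U \<in> ?S \<and> card U = j. conn {1..card U} * total {1..n - card U})"
  proof (rule sum.group[symmetric, OF finS])
    show "card ` ?S \<subseteq> {1..n}"
    proof clarify
      fix U assume U: "n \<in> U" "U \<subseteq> ?V"
      hence "card U \<le> card ?V" by (intro card_mono) auto
      moreover have "card U > 0" using U fin[of U] by (auto simp: card_gt_0_iff)
      ultimately show "card U \<in> {1..n}" by auto
    qed
  qed simp
  also have "\<dots> = (\<Sum>j=1..n. of_nat ((n - 1) choose (j - 1)) * conn {1..j} * total {1..n - j})"
  proof (rule sum.cong[OF refl])
    fix j assume j: "j \<in> {1..n}"
    have "(\<Sum>U | U \<in> ?S \<and> card U = j. conn {1..card U} * total {1..n - card U})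
        = (\<Sum>U | U \<in> ?S \<and> card U = j. conn {1..j} * total {1..n - j})"
      by (rule sum.cong) auto
    also have "\<dots> = of_nat (card {U. n \<in> U \<and> U \<subseteq> ?V \<and> card U = j}) * (conn {1..j} * total {1..n - j})"
      by (simp add: conj_assoc)
    also have "card {U. n \<in> U \<and> U \<subseteq> ?V \<and> card U = j} = (n - 1) choose (j - 1)"
      using card_subsets_containing[of ?V n j] j assms by simp
    finally show "(\<Sum>U | U \<in> ?S \<and> card U = j. conn {1..card U} * total {1..n - card U})
        = of_nat ((n - 1) choose (j - 1)) * conn {1..j} * total {1..n - j}" by (simp add: mult.assoc)
  qed
  finally show ?thesis .
qed

end

section \<open>Graphs and sets of triples\<close>

definition graph_wt :: "nat set set \<Rightarrow> rat fps" where
  "graph_wt E = (if triangle_free E then fps_X ^ card E else 0)"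

definition covered_pairs :: "'a set set \<Rightarrow> 'a set set" where
  "covered_pairs S = (\<Union>t\<in>S. nsets t 2)"

text \<open>When a present pair has weight w and an absent one weight 1, a pair is present with
  "probability" w / (1 + w): prescribing c pairs multiplies the total weight by the c-th power of
  this.\<close>

definition edge_prob :: "rat fps" where
  "edge_prob = fps_X * inverse (1 + fps_X)"

text \<open>The sign comes from inclusion-exclusion. A pair shared by several triples is prescribed
  only once, hence the number of covered pairs instead of three times the number of triples.\<close>

definition triple_wt :: "nat set set \<Rightarrow> rat fps" where
  "triple_wt S = (-1) ^ card S * edge_prob ^ card (covered_pairs S)"

lemma nsets_disjoint:
  assumes "A \<inter> B = {}" "E \<subseteq> nsets A r" "D \<subseteq> nsets B r" "r > 0"
  shows "E \<inter> D = {}"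
proof (rule equals0I)
  fix e assume "e \<in> E \<inter> D"
  hence "e \<subseteq> A" "e \<subseteq> B" "card e = r" using assms by (auto simp: nsets_def)
  hence "e = {}" using assms(1) by blast
  with \<open>card e = r\<close> assms(4) show False by simp
qed

lemma triangle_free_mono: "triangle_free E \<Longrightarrow> D \<subseteq> E \<Longrightarrow> triangle_free D"
  unfolding triangle_free_def by blast

lemma triangle_free_union:
  assumes "A \<inter> B = {}" "E \<subseteq> Pow A" "D \<subseteq> Pow B" "triangle_free E" "triangle_free D"
  shows "triangle_free (E \<union> D)"
  unfolding triangle_free_def
proof
  assume "\<exists>x y z. x \<noteq> y \<and> y \<noteq> z \<and> x \<noteq> z \<and> {x, y} \<in> E \<union> D \<and> {y, z} \<in> E \<union> D \<and> {x, z} \<in> E \<union> D"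
  then obtain x y z where xyz: "x \<noteq> y" "y \<noteq> z" "x \<noteq> z"
    and e: "{x, y} \<in> E \<union> D" "{y, z} \<in> E \<union> D" "{x, z} \<in> E \<union> D" by blast
  have *: "p \<in> A \<and> q \<in> A \<and> {p, q} \<in> E \<or> p \<in> B \<and> q \<in> B \<and> {p, q} \<in> D"
    if "{p, q} \<in> E \<union> D" for p q
    using that assms(2,3) by blast
  have "{x, y} \<in> E \<and> {y, z} \<in> E \<and> {x, z} \<in> E \<or> {x, y} \<in> D \<and> {y, z} \<in> D \<and> {x, z} \<in> D"
    using *[OF e(1)] *[OF e(2)] *[OF e(3)] assms(1) by (metis disjoint_iff)
  with xyz assms(4,5) show False unfolding triangle_free_def by blast
qed

lemma triangle_free_image:
  assumes "inj_on g A" "E \<subseteq> Pow A" "triangle_free E"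
  shows "triangle_free ((`) g ` E)"
  unfolding triangle_free_def
proof
  assume "\<exists>x y z. x \<noteq> y \<and> y \<noteq> z \<and> x \<noteq> z \<and> {x, y} \<in> (`) g ` E \<and> {y, z} \<in> (`) g ` E \<and> {x, z} \<in> (`) g ` E"
  then obtain x y z where xyz: "x \<noteq> y" "y \<noteq> z" "x \<noteq> z"
    and e: "{x, y} \<in> (`) g ` E" "{y, z} \<in> (`) g ` E" "{x, z} \<in> (`) g ` E" by blast
  let ?h = "inv_into A g"
  have *: "{?h p, ?h q} \<in> E \<and> p \<in> g ` A \<and> q \<in> g ` A" if pq: "{p, q} \<in> (`) g ` E" for p q
  proof -
    obtain d where d: "d \<in> E" "g ` d = {p, q}" using pq by auto
    have "?h ` {p, q} = d" using d assms by (metis PowD inv_into_image_cancel subsetD)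
    moreover have "{p, q} \<subseteq> g ` A" using d assms(2) by blast
    ultimately show ?thesis using d by auto
  qed
  have "?h x \<noteq> ?h y" "?h y \<noteq> ?h z" "?h x \<noteq> ?h z"
    using xyz *[OF e(1)] *[OF e(2)] by (metis f_inv_into_f)+
  with *[OF e(1)] *[OF e(2)] *[OF e(3)] assms(3) show False
    unfolding triangle_free_def by blast
qed

lemma nsets_subset_Pow: "nsets A r \<subseteq> Pow A"
  by (auto simp: nsets_def)

lemma inj_on_image_nsets:
  assumes "inj_on g A" "E \<subseteq> Pow A"
  shows "inj_on ((`) g) E"
  by (rule inj_on_subset[OF inj_on_image_Pow[OF assms(1)] assms(2)])

lemma triangle_free_image_iff:
  assumes "inj_on g A" "E \<subseteq> Pow A"
  shows "triangle_free ((`) g ` E) \<longleftrightarrow> triangle_free E"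
proof
  assume *: "triangle_free ((`) g ` E)"
  have "(`) (inv_into A g) ` (`) g ` E = E"
  proof -
    have "inv_into A g ` g ` e = e" if "e \<in> E" for e
      using that assms by (intro inv_into_image_cancel) auto
    thus ?thesis by (force simp: image_image)
  qed
  moreover have "triangle_free ((`) (inv_into A g) ` (`) g ` E)"
    using assms(2) * by (intro triangle_free_image[of _ "g ` A"] inj_on_inv_into) auto
  ultimately show "triangle_free E" by simp
qed (rule triangle_free_image[OF assms])

lemma nsets_image_eq:
  assumes "inj_on g t"
  shows "nsets (g ` t) r = (`) g ` nsets t r"
proof
  show "nsets (g ` t) r \<subseteq> (`) g ` nsets t r"
  proof
    fix e assume e: "e \<in> nsets (g ` t) r"
    let ?d = "inv_into t g ` e"
    have ge: "g ` ?d = e" using e by (intro image_inv_into_cancel[OF refl]) (auto simp: nsets_def)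
    have d: "?d \<subseteq> t" using e by (auto simp: nsets_def intro!: inv_into_into)
    have "card (g ` ?d) = card ?d" using inj_on_subset[OF assms d] by (rule card_image)
    hence "?d \<in> nsets t r" using e d ge by (auto simp: nsets_def)
    thus "e \<in> (`) g ` nsets t r" using ge by (metis imageI)
  qed
  show "(`) g ` nsets t r \<subseteq> nsets (g ` t) r"
  proof
    fix e assume "e \<in> (`) g ` nsets t r"
    then obtain d where d: "e = g ` d" "d \<subseteq> t" "finite d" "card d = r" by (auto simp: nsets_def)
    have "card (g ` d) = card d" using inj_on_subset[OF assms d(2)] by (rule card_image)
    thus "e \<in> nsets (g ` t) r" using d by (auto simp: nsets_def)
  qed
qed

lemma covered_pairs_image:
  assumes "inj_on g A" "S \<subseteq> Pow A"
  shows "covered_pairs ((`) g ` S) = (`) g ` covered_pairs S"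
proof -
  have "nsets (g ` t) 2 = (`) g ` nsets t 2" if "t \<in> S" for t
    using that assms by (intro nsets_image_eq inj_on_subset[OF assms(1)]) auto
  thus ?thesis unfolding covered_pairs_def by auto
qed

lemma covered_pairs_subset:
  assumes "S \<subseteq> nsets A r" shows "covered_pairs S \<subseteq> nsets A 2"
  using assms by (force simp: covered_pairs_def nsets_def)

lemma covered_pairs_union: "covered_pairs (S \<union> S') = covered_pairs S \<union> covered_pairs S'"
  by (auto simp: covered_pairs_def)

interpretation graphs: hypergraph_weight 2 graph_wt
proof
  fix A B :: "nat set" and E D
  assume fin: "finite A" "finite B" and dis: "A \<inter> B = {}"
    and E: "E \<subseteq> nsets A 2" and D: "D \<subseteq> nsets B 2"
  have "finite E" "finite D"
    using fin E D by (meson finite_imp_finite_nsets finite_subset)+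
  hence "card (E \<union> D) = card E + card D"
    using nsets_disjoint[OF dis E D] by (simp add: card_Un_disjoint)
  moreover have "triangle_free (E \<union> D) \<longleftrightarrow> triangle_free E \<and> triangle_free D"
    using triangle_free_union[OF dis, of E D] E D nsets_subset_Pow triangle_free_mono
    by (metis dual_order.trans sup.cobounded1 sup.cobounded2)
  ultimately show "graph_wt (E \<union> D) = graph_wt E * graph_wt D"
    by (simp add: graph_wt_def power_add)
next
  fix g A and E :: "nat set set"
  assume "finite A" and g: "inj_on (g :: nat \<Rightarrow> nat) A" and E: "E \<subseteq> nsets A 2"
  have EP: "E \<subseteq> Pow A" using E nsets_subset_Pow by blast
  have "card ((`) g ` E) = card E" using inj_on_image_nsets[OF g EP] by (rule card_image)
  thus "graph_wt ((`) g ` E) = graph_wt E"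
    by (simp add: graph_wt_def triangle_free_image_iff[OF g EP])
qed simp

interpretation triples: hypergraph_weight 3 triple_wt
proof
  fix A B :: "nat set" and E D
  assume fin: "finite A" "finite B" and dis: "A \<inter> B = {}"
    and E: "E \<subseteq> nsets A 3" and D: "D \<subseteq> nsets B 3"
  have "finite E" "finite D"
    using fin E D by (meson finite_imp_finite_nsets finite_subset)+
  hence 1: "card (E \<union> D) = card E + card D"
    using nsets_disjoint[OF dis E D] by (simp add: card_Un_disjoint)
  have pE: "covered_pairs E \<subseteq> nsets A 2" and pD: "covered_pairs D \<subseteq> nsets B 2"
    using covered_pairs_subset E D by blast+
  hence "finite (covered_pairs E)" "finite (covered_pairs D)"
    using fin by (meson finite_imp_finite_nsets finite_subset)+
  hence "card (covered_pairs (E \<union> D)) = card (covered_pairs E) + card (covered_pairs D)"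
    using nsets_disjoint[OF dis pE pD] by (simp add: card_Un_disjoint covered_pairs_union)
  with 1 show "triple_wt (E \<union> D) = triple_wt E * triple_wt D"
    by (simp add: triple_wt_def power_add mult_ac)
next
  fix g A and E :: "nat set set"
  assume "finite A" and g: "inj_on (g :: nat \<Rightarrow> nat) A" and E: "E \<subseteq> nsets A 3"
  have EP: "E \<subseteq> Pow A" using E nsets_subset_Pow by blast
  have pP: "covered_pairs E \<subseteq> Pow A" using covered_pairs_subset[OF E] nsets_subset_Pow by blast
  have "card ((`) g ` E) = card E" using inj_on_image_nsets[OF g EP] by (rule card_image)
  moreover have "card (covered_pairs ((`) g ` E)) = card (covered_pairs E)"
    unfolding covered_pairs_image[OF g EP] using inj_on_image_nsets[OF g pP] by (rule card_image)
  ultimately show "triple_wt ((`) g ` E) = triple_wt E"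
    by (simp add: triple_wt_def)
qed simp

lemma sum_Pow_power_card:
  fixes x :: "'a :: comm_ring_1"
  assumes "finite A"
  shows "(\<Sum>E\<in>Pow A. x ^ card E) = (1 + x) ^ card A"
  using prod_add[OF assms, of "\<lambda>_. x" "\<lambda>_. 1"] by (simp add: add.commute)

lemma triangle_free_iff_covered:
  assumes "E \<subseteq> nsets V 2"
  shows "triangle_free E \<longleftrightarrow> {t \<in> nsets V 3. nsets t 2 \<subseteq> E} = {}"
proof
  assume tf: "triangle_free E"
  show "{t \<in> nsets V 3. nsets t 2 \<subseteq> E} = {}"
  proof (rule equals0I)
    fix t assume "t \<in> {t \<in> nsets V 3. nsets t 2 \<subseteq> E}"
    hence t: "card t = 3" "nsets t 2 \<subseteq> E" by (auto simp: nsets_def)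
    then obtain x y z where "t = {x, y, z}" "x \<noteq> y" "y \<noteq> z" "x \<noteq> z" by (auto simp: card_3_iff)
    moreover from this have "{x, y} \<in> nsets t 2" "{y, z} \<in> nsets t 2" "{x, z} \<in> nsets t 2"
      by (auto simp: nsets_def)
    ultimately show False using tf t(2) unfolding triangle_free_def by blast
  qed
next
  assume none: "{t \<in> nsets V 3. nsets t 2 \<subseteq> E} = {}"
  show "triangle_free E" unfolding triangle_free_def
  proof
    assume "\<exists>x y z. x \<noteq> y \<and> y \<noteq> z \<and> x \<noteq> z \<and> {x, y} \<in> E \<and> {y, z} \<in> E \<and> {x, z} \<in> E"
    then obtain x y z where xyz: "x \<noteq> y" "y \<noteq> z" "x \<noteq> z" "{x, y} \<in> E" "{y, z} \<in> E" "{x, z} \<in> E" by blast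
    have "{x, y, z} \<in> nsets V 3" using xyz assms by (auto simp: nsets_def)
    moreover have "nsets {x, y, z} 2 \<subseteq> E"
    proof
      fix e assume "e \<in> nsets {x, y, z} 2"
      hence "e \<subseteq> {x, y, z}" "card e = 2" by (auto simp: nsets_def)
      then obtain p q where "e = {p, q}" "p \<noteq> q" "p \<in> {x, y, z}" "q \<in> {x, y, z}"
        by (auto simp: card_2_iff)
      thus "e \<in> E" using xyz by (auto simp: insert_commute)
    qed
    ultimately show False using none by blast
  qed
qed

text \<open>The indicator of being triangle-free is replaced by a signed sum over sets S of
  triangles of E; after exchanging the sums, E ranges over all graphs that contain the pairs covered
  by S.\<close>

lemma total_graphs_eq:
  assumes "finite V"
  shows "graphs.total V = (1 + fps_X) ^ (card V choose 2) * triples.total V"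
proof -
  let ?K = "nsets V 2" and ?T = "nsets V 3"
  have finK: "finite ?K" and finT: "finite ?T" using assms finite_imp_finite_nsets by blast+
  \<comment> \<open>S ranges over the sets of triangles of E, so the sum is (1 - 1) to the power of
    their number.\<close>
  have inner: "(\<Sum>S | S \<subseteq> ?T \<and> covered_pairs S \<subseteq> E. (-1) ^ card S) = (if triangle_free E then 1 else 0 :: rat fps)"
    if E: "E \<subseteq> ?K" for E
  proof -
    let ?TE = "{t \<in> ?T. nsets t 2 \<subseteq> E}"
    have eq: "{S. S \<subseteq> ?T \<and> covered_pairs S \<subseteq> E} = Pow ?TE" by (auto simp: covered_pairs_def)
    have finTE: "finite ?TE" using finT by auto
    have "(\<Sum>S\<in>Pow ?TE. (-1) ^ card S) = (1 + (-1 :: rat fps)) ^ card ?TE"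
      using sum_Pow_power_card[OF finTE] .
    also have "\<dots> = (if ?TE = {} then 1 else 0)"
    proof (cases "?TE = {}")
      case False
      hence "card ?TE \<noteq> 0" using finTE by (simp only: card_eq_0_iff) blast
      with False show ?thesis by (simp only: if_False) simp
    qed (simp only: card.empty power_0 if_True refl)
    finally show ?thesis unfolding eq triangle_free_iff_covered[OF E] .
  qed
  \<comment> \<open>The pairs outside P are free, and each contributes the factor 1 + w.\<close>
  have outer: "(\<Sum>E | E \<subseteq> ?K \<and> P \<subseteq> E. fps_X ^ card E) = (1 + fps_X) ^ card ?K * edge_prob ^ card P"
    if P: "P \<subseteq> ?K" for P
  proof -
    have finP: "finite P" using P finK finite_subset by blast
    have "(\<Sum>E | E \<subseteq> ?K \<and> P \<subseteq> E. fps_X ^ card E) = (\<Sum>D\<in>Pow (?K - P). fps_X ^ card P * fps_X ^ card D :: rat fps)"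
    proof (rule sum.reindex_bij_witness[where i = "\<lambda>D. P \<union> D" and j = "\<lambda>E. E - P"])
      fix E assume E: "E \<in> {E. E \<subseteq> ?K \<and> P \<subseteq> E}"
      hence "finite E" using finK finite_subset by blast
      hence "card E = card P + card (E - P)"
        using E finP by (simp add: card_Diff_subset card_mono)
      thus "fps_X ^ card P * fps_X ^ card (E - P) = (fps_X ^ card E :: rat fps)" by (simp add: power_add)
    qed (use P in auto)
    also have "\<dots> = fps_X ^ card P * (1 + fps_X) ^ card (?K - P)"
      using finK by (simp add: sum_distrib_left[symmetric] sum_Pow_power_card)
    also have "(1 + fps_X) ^ card ?K * edge_prob ^ card P = \<dots>"
    proof -
      have c: "card ?K = card P + card (?K - P)"
        using card_Diff_subset[OF finP P] card_mono[OF finK P] by linarith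
      have "(1 + fps_X) * edge_prob = fps_X"
        unfolding edge_prob_def by (simp add: mult.left_commute inverse_mult_eq_1')
      hence "(1 + fps_X) ^ card P * edge_prob ^ card P = fps_X ^ card P"
        by (metis power_mult_distrib)
      thus ?thesis unfolding c by (simp add: power_add mult_ac)
    qed
    finally show ?thesis by simp
  qed
  have "graphs.total V = (\<Sum>E\<in>Pow ?K. \<Sum>S | S \<in> Pow ?T \<and> covered_pairs S \<subseteq> E. (-1) ^ card S * fps_X ^ card E)"
    unfolding graphs.total_def graph_wt_def
    by (rule sum.cong[OF refl]) (simp add: sum_distrib_right[symmetric] inner)
  also have "\<dots> = (\<Sum>S\<in>Pow ?T. \<Sum>E | E \<in> Pow ?K \<and> covered_pairs S \<subseteq> E. (-1) ^ card S * fps_X ^ card E)"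
    by (rule sum.swap_restrict) (use finK finT in auto)
  also have "\<dots> = (\<Sum>S\<in>Pow ?T. (1 + fps_X) ^ card ?K * triple_wt S)"
  proof (rule sum.cong[OF refl])
    fix S assume "S \<in> Pow ?T"
    hence cp: "covered_pairs S \<subseteq> ?K" using covered_pairs_subset by blast
    have "(\<Sum>E | E \<in> Pow ?K \<and> covered_pairs S \<subseteq> E. (-1) ^ card S * fps_X ^ card E)
      = (-1) ^ card S * (\<Sum>E | E \<subseteq> ?K \<and> covered_pairs S \<subseteq> E. fps_X ^ card E :: rat fps)"
      by (simp add: sum_distrib_left)
    thus "(\<Sum>E | E \<in> Pow ?K \<and> covered_pairs S \<subseteq> E. (-1) ^ card S * fps_X ^ card E)
      = (1 + fps_X) ^ card ?K * triple_wt S"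
      unfolding outer[OF cp] by (simp add: triple_wt_def mult_ac)
  qed
  finally show ?thesis
    by (simp add: triples.total_def sum_distrib_left card_nsets)
qed

section \<open>Edge bounds for connected set systems\<close>

text \<open>A singleton satisfies the bound trivially. A largest nonempty U that satisfies it must
  be V, because otherwise some edge leaves U, and \<open>step\<close> extends the bound to the
  larger set U together with that edge.\<close>

lemma hyper_connected_growth:
  fixes c :: "'a set \<Rightarrow> nat"
  assumes "finite V" "hyper_connected V E" "\<And>e. e \<in> E \<Longrightarrow> e \<subseteq> V"
    and step: "\<And>U e. \<lbrakk>U \<subseteq> V; e \<in> E; e \<inter> U \<noteq> {}; \<not> e \<subseteq> U\<rbrakk>
      \<Longrightarrow> a * c U + b * card (e - U) \<le> a * c (U \<union> e)"
  shows "b * card V \<le> a * c V + b"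
proof -
  let ?P = "\<lambda>U. U \<subseteq> V \<and> U \<noteq> {} \<and> b * card U \<le> a * c U + b"
  obtain v where v: "v \<in> V" using assms(2) unfolding hyper_connected_def by blast
  have "?P {v}" using v by simp
  moreover have "\<forall>U. ?P U \<longrightarrow> card U < Suc (card V)"
    using assms(1) card_mono less_Suc_eq_le by blast
  ultimately have "\<exists>U. ?P U \<and> (\<forall>W. ?P W \<longrightarrow> card W \<le> card U)"
    by (rule ex_has_greatest_nat[of ?P])
  then obtain U where U: "?P U" and max: "\<And>W. ?P W \<Longrightarrow> card W \<le> card U"
    by (elim exE conjE) blast
  have "U = V"
  proof (rule ccontr)
    assume "U \<noteq> V"
    then obtain e where e: "e \<in> E" "e \<inter> U \<noteq> {}" "\<not> e \<subseteq> U"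
      using hyper_connected_crossing[OF assms(2), of U] U by metis
    have fin: "finite U" "finite e"
      using U assms(1) finite_subset[OF assms(3)[OF e(1)]] by (auto intro: finite_subset)
    have card: "card (U \<union> e) = card U + card (e - U)"
      using card_Un_disjoint[of U "e - U"] fin by simp
    have "?P (U \<union> e)"
    proof -
      have "b * card (U \<union> e) = b * card U + b * card (e - U)" unfolding card by (rule distrib_left)
      also have "\<dots> \<le> (a * c U + b) + b * card (e - U)" using U by simp
      also have "\<dots> \<le> a * c (U \<union> e) + b" using step[OF _ e] U by simp
      finally show ?thesis using U assms(3)[OF e(1)] by simp
    qed
    hence "card (U \<union> e) \<le> card U" by (rule max)
    hence "e - U = {}" using card fin by simp
    with e(3) show False by blast
  qed
  with U show ?thesis by simp
qed

lemma card_connected_graph: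
  assumes "finite V" "hyper_connected V E" "E \<subseteq> nsets V 2"
  shows "card V \<le> card E + 1"
proof -
  have finE: "finite E" using assms finite_imp_finite_nsets finite_subset by blast
  let ?c = "\<lambda>U. card {e \<in> E. e \<subseteq> U}"
  have "1 * card V \<le> 1 * ?c V + 1"
  proof (rule hyper_connected_growth[OF assms(1,2)])
    fix U e assume e: "U \<subseteq> V" "e \<in> E" "e \<inter> U \<noteq> {}" "\<not> e \<subseteq> U"
    have "insert e {e \<in> E. e \<subseteq> U} \<subseteq> {d \<in> E. d \<subseteq> U \<union> e}" using e by auto
    hence "card (insert e {e \<in> E. e \<subseteq> U}) \<le> ?c (U \<union> e)" using finE by (intro card_mono) auto
    moreover have "card (insert e {e \<in> E. e \<subseteq> U}) = Suc (?c U)"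
      using e finE by (subst card_insert_disjoint) auto
    moreover have "card (e - U) \<le> 1"
    proof -
      have "card e = 2" "finite e" using e assms(3) by (auto simp: nsets_def)
      moreover have "card (e \<inter> U) > 0" using e \<open>finite e\<close> by (simp add: card_gt_0_iff)
      ultimately show ?thesis by (simp add: card_Diff_subset_Int)
    qed
    ultimately show "1 * ?c U + 1 * card (e - U) \<le> 1 * ?c (U \<union> e)" by simp
  qed (use assms in \<open>auto simp: nsets_def\<close>)
  moreover have "{e \<in> E. e \<subseteq> V} = E" using assms(3) by (auto simp: nsets_def)
  ultimately show ?thesis by simp
qed

text \<open>Adding to a vertex set a triangle that meets it in one vertex costs three edges for two
  vertices; meeting it in two vertices costs two edges for one vertex.\<close>

lemma card_connected_triples:
  assumes "finite V" "hyper_connected V S" "S \<subseteq> nsets V 3"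
  shows "3 * card V \<le> 2 * card (covered_pairs S) + 3"
proof -
  have cp: "covered_pairs S \<subseteq> nsets V 2" using covered_pairs_subset[OF assms(3)] .
  hence finP: "finite (covered_pairs S)" using assms(1) finite_imp_finite_nsets finite_subset by blast
  let ?c = "\<lambda>U. card {p \<in> covered_pairs S. p \<subseteq> U}"
  have "3 * card V \<le> 2 * ?c V + 3"
  proof (rule hyper_connected_growth[OF assms(1,2)])
    fix U t assume t: "U \<subseteq> V" "t \<in> S" "t \<inter> U \<noteq> {}" "\<not> t \<subseteq> U"
    have t3: "card t = 3" "finite t" using t assms(3) by (auto simp: nsets_def)
    let ?N = "nsets t 2 - nsets (t \<inter> U) 2"
    have fN: "finite (nsets t 2)" "finite (nsets (t \<inter> U) 2)"
      using t3 finite_imp_finite_nsets by auto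
    have "{p \<in> covered_pairs S. p \<subseteq> U} \<union> ?N \<subseteq> {p \<in> covered_pairs S. p \<subseteq> U \<union> t}"
      using t by (auto simp: covered_pairs_def nsets_def)
    hence "card ({p \<in> covered_pairs S. p \<subseteq> U} \<union> ?N) \<le> ?c (U \<union> t)"
      using finP by (intro card_mono) auto
    moreover have "card ({p \<in> covered_pairs S. p \<subseteq> U} \<union> ?N) = ?c U + card ?N"
      using finP fN by (intro card_Un_disjoint) (auto simp: nsets_def)
    moreover have "card ?N = 3 - (card (t \<inter> U) choose 2)"
    proof -
      have "nsets (t \<inter> U) 2 \<subseteq> nsets t 2" by (rule nsets_mono) auto
      hence "card ?N = card (nsets t 2) - card (nsets (t \<inter> U) 2)"
        using fN by (intro card_Diff_subset) auto
      thus ?thesis using t3 by (simp add: card_nsets choose_two)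
    qed
    moreover have "card (t - U) = 3 - card (t \<inter> U)" using t3 by (simp add: card_Diff_subset_Int)
    moreover have "card (t \<inter> U) = 1 \<or> card (t \<inter> U) = 2"
    proof -
      have "card (t \<inter> U) > 0" using t t3 by (simp add: card_gt_0_iff)
      moreover have "card (t \<inter> U) < card t" using t t3 by (intro psubset_card_mono) auto
      ultimately show ?thesis using t3 by linarith
    qed
    ultimately show "2 * ?c U + 3 * card (t - U) \<le> 2 * ?c (U \<union> t)"
      by (auto simp: choose_two)
  qed (use assms in \<open>auto simp: nsets_def\<close>)
  moreover have "{p \<in> covered_pairs S. p \<subseteq> V} = covered_pairs S" using cp by (auto simp: nsets_def)
  ultimately show ?thesis by simp
qed

section \<open>Exponential generating functions\<close>

lemma graphs_conn_nth: "graphs.conn {1..n} $ (n + k) = of_nat (triangle_free_count n k)"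
proof -
  have simple: "E \<subseteq> nsets {1..n} 2 \<longleftrightarrow> simple_graph {1..n} E" for E :: "nat set set"
    by (auto simp: nsets_def simple_graph_def finite_subset)
  have conn: "hyper_connected {1..n} E \<longleftrightarrow> connected_graph {1..n} E" if "simple_graph {1..n} E" for E :: "nat set set"
  proof -
    have eq: "{(x, y). \<exists>e\<in>E. x \<in> e \<and> y \<in> e} \<union> Id = {(x, y). {x, y} \<in> E} \<union> Id"
      (is "?A \<union> Id = ?B \<union> Id")
    proof -
      have "{x, y} \<in> E" if "e \<in> E" "x \<in> e" "y \<in> e" "x \<noteq> y" for x y e
      proof -
        have "card e = 2" using \<open>simple_graph {1..n} E\<close> that by (auto simp: simple_graph_def)
        hence "e = {x, y}" using that by (auto simp: card_2_iff)
        thus ?thesis using that by simp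
      qed
      thus ?thesis by blast
    qed
    have "?A\<^sup>* = (?A \<union> Id)\<^sup>*" by (rule rtrancl_reflcl[symmetric])
    also have "\<dots> = ?B\<^sup>*" unfolding eq by (rule rtrancl_reflcl)
    finally have "?A\<^sup>* = ?B\<^sup>*" .
    thus ?thesis by (simp add: hyper_connected_def connected_graph_def)
  qed
  have fin: "finite {E. E \<subseteq> nsets {1..n} 2 \<and> hyper_connected {1..n} E}"
    by (rule finite_subset[of _ "Pow (nsets {1..n} 2)"]) (auto simp: finite_imp_finite_nsets)
  have "graphs.conn {1..n} $ (n + k)
      = (\<Sum>E | E \<subseteq> nsets {1..n} 2 \<and> hyper_connected {1..n} E. graph_wt E $ (n + k))"
    unfolding graphs.conn_def by (simp add: fps_sum_nth)
  also have "\<dots> = (\<Sum>E | E \<subseteq> nsets {1..n} 2 \<and> hyper_connected {1..n} E.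
      if triangle_free E \<and> card E = n + k then 1 else 0)"
    by (rule sum.cong) (auto simp: graph_wt_def)
  also have "\<dots> = of_nat (card {E \<in> {E. E \<subseteq> nsets {1..n} 2 \<and> hyper_connected {1..n} E}.
      triangle_free E \<and> card E = n + k})"
    using fin by (simp add: sum.If_cases Int_def)
  also have "{E \<in> {E. E \<subseteq> nsets {1..n} 2 \<and> hyper_connected {1..n} E}. triangle_free E \<and> card E = n + k}
      = {E. simple_graph {1..n} E \<and> connected_graph {1..n} E \<and> triangle_free E \<and> card E = n + k}"
    using simple conn by auto
  finally show ?thesis by (simp add: triangle_free_count_def)
qed

lemma graphs_conn_nth_eq_0:
  assumes "i + 1 < n" shows "graphs.conn {1..n} $ i = 0"
proof -
  have "graph_wt E $ i = 0" if "E \<subseteq> nsets {1..n} 2" "hyper_connected {1..n} E" for E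
    using card_connected_graph[of "{1..n}" E] that assms by (auto simp: graph_wt_def)
  thus ?thesis unfolding graphs.conn_def by (simp add: fps_sum_nth)
qed

lemma edge_prob_power: "edge_prob ^ c = fps_X ^ c * inverse (1 + fps_X) ^ c"
  by (simp add: edge_prob_def power_mult_distrib)

lemma triples_conn_nth_eq_0:
  assumes "2 * i + 3 < 3 * n" shows "triples.conn {1..n} $ i = 0"
proof -
  have "triple_wt S $ i = 0" if "S \<subseteq> nsets {1..n} 3" "hyper_connected {1..n} S" for S
  proof -
    let ?c = "card (covered_pairs S)"
    have "i < ?c" using card_connected_triples[of "{1..n}" S] that assms by auto
    moreover have "triple_wt S = fps_X ^ ?c * ((-1) ^ card S * inverse (1 + fps_X) ^ ?c)"
      by (simp add: triple_wt_def edge_prob_power mult_ac)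
    ultimately show ?thesis by (simp add: fps_X_power_mult_nth)
  qed
  thus ?thesis unfolding triples.conn_def by (simp add: fps_sum_nth)
qed

lemma hyper_connected_no_edges: "hyper_connected V {} \<longleftrightarrow> (\<exists>v. V = {v})"
proof -
  have "{(x, y). \<exists>e\<in>{}. x \<in> e \<and> y \<in> e} = {}" by simp
  hence "hyper_connected V {} \<longleftrightarrow> V \<noteq> {} \<and> (\<forall>u\<in>V. \<forall>v\<in>V. u = v)"
    unfolding hyper_connected_def by simp
  also have "\<dots> \<longleftrightarrow> (\<exists>v. V = {v})"
  proof
    assume V: "V \<noteq> {} \<and> (\<forall>u\<in>V. \<forall>v\<in>V. u = v)"
    then obtain v where "v \<in> V" by auto
    with V have "V = {v}" by auto
    thus "\<exists>v. V = {v}" ..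
  qed auto
  finally show ?thesis .
qed

lemma nsets_eq_empty_of_card:
  assumes "finite V" "card V < r" shows "nsets V r = {}"
proof -
  have "card (nsets V r) = 0" using assms by (simp add: binomial_eq_0)
  thus ?thesis using finite_imp_finite_nsets[OF assms(1)] by (simp only: card_0_eq)
qed

lemma triples_conn_1: "triples.conn {1..1} = 1"
proof -
  have "nsets {1..1::nat} 3 = {}" by (rule nsets_eq_empty_of_card) auto
  hence "{S. S \<subseteq> nsets {1..1::nat} 3 \<and> hyper_connected {1..1::nat} S} = {{}}"
    by (auto simp: hyper_connected_no_edges)
  thus ?thesis unfolding triples.conn_def by (simp add: triple_wt_def covered_pairs_def)
qed

lemma triples_conn_2: "triples.conn {1..2} = 0"
proof -
  have "nsets {1..2::nat} 3 = {}" by (rule nsets_eq_empty_of_card) auto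
  moreover have "{1..2::nat} = {1, 2}" by auto
  ultimately have "{S. S \<subseteq> nsets {1..2::nat} 3 \<and> hyper_connected {1..2::nat} S} = {}"
    by (auto simp: hyper_connected_no_edges)
  thus ?thesis unfolding triples.conn_def by (simp only: sum.empty)
qed

text \<open>The only connected set of triples on three points is the single triangle, of weight
  minus \<open>edge_prob ^ 3\<close>, whose lowest term is -w^3. Through this value triangles affect
  the leading coefficients of the theorem.\<close>

lemma triples_conn_3: "triples.conn {1..3} $ 3 = -1"
proof -
  have n: "nsets {1..3::nat} 3 = {{1..3}}"
  proof -
    have "e = {1..3}" if "e \<subseteq> {1..3::nat}" "card e = 3" for e
      using card_subset_eq[of "{1..3::nat}" e] that by simp
    thus ?thesis by (auto simp: nsets_def)
  qed
  have "hyper_connected {1..3::nat} {{1..3}}" unfolding hyper_connected_def by auto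
  moreover have "\<not> hyper_connected {1..3::nat} {}"
  proof -
    have "card {1..3::nat} = 3" by simp
    thus ?thesis by (metis hyper_connected_no_edges card_1_singleton_iff One_nat_def numeral_eq_one_iff semiring_norm(84))
  qed
  ultimately have "{S. S \<subseteq> nsets {1..3::nat} 3 \<and> hyper_connected {1..3::nat} S} = {{{1..3}}}"
    unfolding n by (auto simp: subset_singleton_iff)
  hence "triples.conn {1..3} = triple_wt {{1..3}}" unfolding triples.conn_def by simp
  also have "\<dots> = - (edge_prob ^ 3)"
    by (simp add: triple_wt_def covered_pairs_def choose_two)
  finally show ?thesis by (simp add: edge_prob_power fps_X_power_mult_nth fps_power_zeroth)
qed

lemma triples_conn_0: "triples.conn {} = 0" "graphs.conn {} = 0"
  unfolding triples.conn_def graphs.conn_def by (simp_all add: hyper_connected_def)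

lemma nsets_empty_pos: "r > 0 \<Longrightarrow> nsets {} r = {}"
  by (auto simp: nsets_def)

lemma total_empty: "triples.total {} = 1" "graphs.total {} = 1"
  by (simp_all add: triples.total_def graphs.total_def nsets_empty_pos triple_wt_def graph_wt_def
      covered_pairs_def triangle_free_def)

section \<open>Operators on series in two variables\<close>

definition theta :: "'a :: comm_ring_1 fps \<Rightarrow> 'a fps" where
  "theta f = Abs_fps (\<lambda>n. of_nat n * f $ n)"

text \<open>The substitution of u z for z. As u may be a series in w, both F((1 + w) z) and the
  rescaling of z by w are instances.\<close>

definition twist :: "'a :: comm_ring_1 \<Rightarrow> 'a fps \<Rightarrow> 'a fps" where
  "twist u f = Abs_fps (\<lambda>n. u ^ n * f $ n)"

definition wdiff :: "'a :: comm_ring_1 fps fps \<Rightarrow> 'a fps fps" where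
  "wdiff A = Abs_fps (\<lambda>n. fps_deriv (A $ n))"

lemma theta_nth [simp]: "theta f $ n = of_nat n * f $ n" by (simp add: theta_def)
lemma twist_nth [simp]: "twist u f $ n = u ^ n * f $ n" by (simp add: twist_def)
lemma wdiff_nth [simp]: "wdiff A $ n = fps_deriv (A $ n)" by (simp add: wdiff_def)

lemma theta_altdef: "theta f = fps_X * fps_deriv f"
  by (simp add: fps_eq_iff fps_mult_fps_X_deriv_shift)

lemma theta_mult: "theta (f * g) = theta f * g + f * theta g"
  by (simp add: theta_altdef algebra_simps)

lemma theta_add: "theta (f + g) = theta f + theta g"
  and theta_diff: "theta (f - g) = theta f - theta g"
  and theta_const_mult: "theta (fps_const c * f) = fps_const c * theta f"
  by (simp_all add: fps_eq_iff algebra_simps)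

lemma twist_mult: "twist u (f * g) = twist u f * twist u g"
proof (rule fps_ext)
  fix n
  have "u ^ n * (\<Sum>i=0..n. f $ i * g $ (n - i)) = (\<Sum>i=0..n. (u ^ i * f $ i) * (u ^ (n - i) * g $ (n - i)))"
    unfolding sum_distrib_left
  proof (rule sum.cong[OF refl])
    fix i assume "i \<in> {0..n}"
    hence "u ^ n = u ^ i * u ^ (n - i)" by (simp flip: power_add)
    thus "u ^ n * (f $ i * g $ (n - i)) = (u ^ i * f $ i) * (u ^ (n - i) * g $ (n - i))"
      by (simp add: mult_ac)
  qed
  thus "twist u (f * g) $ n = (twist u f * twist u g) $ n" by (simp add: fps_mult_nth)
qed

lemma twist_add: "twist u (f + g) = twist u f + twist u g"
  and twist_diff: "twist u (f - g) = twist u f - twist u g"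
  and twist_const: "twist u (fps_const c) = fps_const c"
  and twist_1: "twist u 1 = 1"
  and twist_theta: "twist u (theta f) = theta (twist u f)"
  and twist_commute: "twist u (twist v f) = twist v (twist u f)"
  by (simp_all add: fps_eq_iff algebra_simps fps_const_def power_0_left)

lemma twist_X: "twist u fps_X = fps_const u * fps_X"
  by (simp add: fps_eq_iff fps_X_def)

lemma twist_const_mult: "twist u (fps_const c * f) = fps_const c * twist u f"
  by (simp add: twist_mult twist_const)

lemma twist_power: "twist u (f ^ n) = twist u f ^ n"
  by (induction n) (simp_all add: twist_1 twist_mult)

lemma twist_inj:
  fixes u :: "'a :: idom"
  assumes "u \<noteq> 0" "twist u f = twist u g" shows "f = g"
proof (rule fps_ext)
  fix n
  have "twist u f $ n = twist u g $ n" using assms(2) by simp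
  thus "f $ n = g $ n" using assms(1) by simp
qed

lemma wdiff_mult: "wdiff (A * B) = wdiff A * B + A * wdiff B"
proof (rule fps_ext)
  fix n
  show "wdiff (A * B) $ n = (wdiff A * B + A * wdiff B) $ n"
    by (simp add: fps_mult_nth fps_deriv_sum sum.distrib add.commute)
qed

lemma wdiff_theta: "wdiff (theta A) = theta (wdiff A)"
  by (rule fps_ext) (simp add: fps_of_nat[symmetric])

text \<open>\<open>theta B\<close> has no constant term, so the coefficient of index n on the right
  involves only earlier coefficients of R, and these vanish by induction.\<close>

lemma theta_ode_unique:
  fixes R B :: "'a :: {idom, semiring_char_0} fps"
  assumes "theta R = R * theta B" "R $ 0 = 0"
  shows "R = 0"
proof (rule fps_ext)
  fix n show "R $ n = 0 $ n"
  proof (induction n rule: less_induct)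
    case (less n)
    show ?case
    proof (cases "n = 0")
      case False
      have "of_nat n * R $ n = (\<Sum>i=0..n. R $ i * (of_nat (n - i) * B $ (n - i)))"
        using arg_cong[OF assms(1), of "\<lambda>f. f $ n"] by (simp add: fps_mult_nth)
      also have "\<dots> = 0"
      proof (rule sum.neutral, rule ballI)
        fix i assume "i \<in> {0..n}"
        thus "R $ i * (of_nat (n - i) * B $ (n - i)) = 0"
          using less.IH[of i] by (cases "i = n") auto
      qed
      finally show ?thesis using False by simp
    qed (use assms in simp)
  qed
qed

text \<open>The hypotheses say A = exp B. The difference of the two sides satisfies the same
  equation as A but has constant term 0.\<close>

lemma wdiff_of_theta:
  fixes A B :: "'a :: {idom, semiring_char_0} fps fps"
  assumes "theta A = A * theta B" "A $ 0 = 1" "B $ 0 = 0"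
  shows "wdiff A = A * wdiff B"
proof -
  let ?R = "wdiff A - A * wdiff B"
  have "theta ?R = wdiff (theta A) - theta A * wdiff B - A * theta (wdiff B)"
    by (simp add: theta_diff theta_mult wdiff_theta algebra_simps)
  also have "\<dots> = ?R * theta B"
    unfolding assms(1) by (simp add: wdiff_mult wdiff_theta algebra_simps)
  finally have "?R = 0"
    by (rule theta_ode_unique) (use assms in simp)
  thus ?thesis by simp
qed

definition series_of :: "(nat set \<Rightarrow> rat fps) \<Rightarrow> rat fps fps" where
  "series_of a = Abs_fps (\<lambda>n. fps_const (1 / fact n) * a {1..n})"

lemma series_of_nth: "series_of a $ n = fps_const (1 / fact n) * a {1..n}"
  by (simp add: series_of_def)

text \<open>The exponential formula in differentiated form, that is \<open>total\<close> = exp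
  \<open>conn\<close> on the level of generating functions.\<close>

lemma theta_series_of:
  assumes "hypergraph_weight r wt"
  shows "theta (series_of (hypergraph_weight.total r wt)) =
    series_of (hypergraph_weight.total r wt) * theta (series_of (hypergraph_weight.conn r wt))"
proof (rule fps_ext)
  interpret hypergraph_weight r wt by fact
  fix n
  show "theta (series_of total) $ n = (series_of total * theta (series_of conn)) $ n"
  proof (cases "n = 0")
    case False
    have "theta (series_of total) $ n = fps_const (of_nat n / fact n) *
        (\<Sum>j=1..n. of_nat ((n - 1) choose (j - 1)) * conn {1..j} * total {1..n - j})"
    proof -
      have "theta (series_of total) $ n = fps_const (of_nat n / fact n) * total {1..n}"
        by (simp add: series_of_nth fps_of_nat[symmetric] mult.assoc[symmetric])
      thus ?thesis using total_recurrence[of n] False by (simp only: neq0_conv simp_thms)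
    qed
    also have "\<dots> = (\<Sum>j=1..n. (of_nat j * (fps_const (1 / fact j) * conn {1..j})) *
        (fps_const (1 / fact (n - j)) * total {1..n - j}))"
      unfolding sum_distrib_left
    proof (rule sum.cong[OF refl])
      fix j assume j: "j \<in> {1..n}"
      have "of_nat n / fact n * of_nat ((n - 1) choose (j - 1)) = (of_nat j / fact j / fact (n - j) :: rat)"
      proof -
        have "(of_nat ((n - 1) choose (j - 1)) :: rat) = fact (n - 1) / (fact (j - 1) * fact (n - 1 - (j - 1)))"
          using j by (intro binomial_fact) auto
        moreover have "n - 1 - (j - 1) = n - j" using j by auto
        moreover have "(fact n :: rat) = of_nat n * fact (n - 1)" "(fact j :: rat) = of_nat j * fact (j - 1)"
          by (rule fact_reduce, use j in simp)+
        ultimately show ?thesis using j by (simp add: field_simps)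
      qed
      hence "fps_const (of_nat n / fact n) * of_nat ((n - 1) choose (j - 1))
          = fps_const (of_nat j / fact j / fact (n - j) :: rat)"
        by (simp add: fps_of_nat[symmetric])
      hence "fps_const (of_nat n / fact n) * (of_nat ((n - 1) choose (j - 1)) * conn {1..j} * total {1..n - j})
          = fps_const (of_nat j / fact j / fact (n - j) :: rat) * (conn {1..j} * total {1..n - j})"
        by (metis mult.assoc)
      also have "\<dots> = (of_nat j * (fps_const (1 / fact j) * conn {1..j})) *
        (fps_const (1 / fact (n - j)) * total {1..n - j})"
      proof -
        have "fps_const (of_nat j / fact j / fact (n - j) :: rat)
            = fps_const (of_nat j) * fps_const (1 / fact j) * fps_const (1 / fact (n - j))" by simp
        thus ?thesis by (simp only: fps_of_nat[symmetric] mult_ac)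
      qed
      finally show "fps_const (of_nat n / fact n) * (of_nat ((n - 1) choose (j - 1)) * conn {1..j} * total {1..n - j})
          = (of_nat j * (fps_const (1 / fact j) * conn {1..j})) *
        (fps_const (1 / fact (n - j)) * total {1..n - j})" .
    qed
    also have "\<dots> = (theta (series_of conn) * series_of total) $ n"
      by (simp add: fps_mult_nth series_of_nth sum.atLeast_Suc_atMost[of 0 n])
    finally show ?thesis by (simp add: mult.commute)
  qed (simp add: fps_mult_nth)
qed

section \<open>Free edges up to a perturbation\<close>

lemma one_plus_X_power_nth: "((1 + fps_X) ^ n :: 'a :: comm_ring_1 fps) $ i = of_nat (n choose i)"
proof (induction n arbitrary: i)
  case (Suc n)
  have "((1 + fps_X) ^ Suc n :: 'a fps) = (1 + fps_X) ^ n + fps_X * (1 + fps_X) ^ n"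
    by (simp only: power_Suc distrib_right mult_1_left)
  hence "((1 + fps_X) ^ Suc n :: 'a fps) $ i = ((1 + fps_X) ^ n + fps_X * (1 + fps_X) ^ n :: 'a fps) $ i"
    by (rule arg_cong)
  also have "\<dots> = of_nat (Suc n choose i)" by (cases i) (simp_all add: Suc)
  finally show ?case .
next
  case 0
  show ?case by (cases i) simp_all
qed

lemma deriv_one_plus_X_power:
  "(1 + fps_X) * fps_deriv ((1 + fps_X) ^ c) = of_nat c * ((1 + fps_X) ^ c :: 'a :: comm_ring_1 fps)"
  by (induction c) (simp_all add: algebra_simps)

definition choose_twist :: "rat fps fps \<Rightarrow> rat fps fps" where
  "choose_twist A = Abs_fps (\<lambda>n. (1 + fps_X) ^ (n choose 2) * A $ n)"

lemma choose_twist_nth [simp]: "choose_twist A $ n = (1 + fps_X) ^ (n choose 2) * A $ n"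
  by (simp add: choose_twist_def)

text \<open>Puts \<open>Y m\<close> in place of z^m. Cutting off at m \<le> n loses nothing for the
  family used below, where \<open>Y m\<close> has no terms before z^m.\<close>

definition substitute :: "(nat \<Rightarrow> rat fps fps) \<Rightarrow> rat fps fps \<Rightarrow> rat fps fps" where
  "substitute Y A = Abs_fps (\<lambda>n. \<Sum>m\<le>n. A $ m * Y m $ n)"

lemma substitute_nth: "substitute Y A $ n = (\<Sum>m\<le>n. A $ m * Y m $ n)"
  by (simp add: substitute_def)

lemma substitute_const_mult: "substitute Y (fps_const c * A) = fps_const c * substitute Y A"
  by (simp add: fps_eq_iff substitute_nth sum_distrib_left mult.assoc)

text \<open>The series w A(z / w, w): a term z^n w^i becomes z^n w^(i - n + 1), so that i edges on n
  vertices are recorded by excess plus one. The coefficient at 0 would need a negative shift and is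
  set to 0, which agrees with A when A has no constant term.\<close>

definition scale_down :: "rat fps fps \<Rightarrow> rat fps fps" where
  "scale_down A = Abs_fps (\<lambda>n. if n = 0 then 0 else fps_shift (n - 1) (A $ n))"

lemma scale_down:
  assumes "A $ 0 = 0" "\<And>n i. i + 1 < n \<Longrightarrow> A $ n $ i = 0"
  shows "fps_const fps_X * A = twist fps_X (scale_down A)"
proof (rule fps_ext, rule fps_ext)
  fix n i
  show "(fps_const fps_X * A) $ n $ i = twist fps_X (scale_down A) $ n $ i"
    using assms by (cases i) (auto simp: scale_down_def fps_X_power_mult_nth)
qed

lemma choose_two_add: "(m + n) choose 2 = (m choose 2) + m * n + (n choose 2)"
proof (induction m)
  case (Suc m)
  have "Suc k choose 2 = k + (k choose 2)" for k
    using binomial_Suc_Suc[of k 1] by (simp add: numeral_2_eq_2)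
  with Suc show ?case by simp
qed simp

lemma two_choose_two: "of_nat 2 * of_nat (n choose 2) = (of_nat n * of_nat n - of_nat n :: 'a :: comm_ring_1)"
proof -
  have "2 * (n choose 2) = n * (n - 1)"
    unfolding choose_two by (rule dvd_mult_div_cancel) (cases n; simp)
  hence "of_nat (2 * (n choose 2)) = (of_nat (n * (n - 1)) :: 'a)" by (rule arg_cong)
  thus ?thesis by (cases n) (simp_all add: algebra_simps)
qed

text \<open>The outer variable \<open>z\<close> marks vertices and the inner variable \<open>w\<close> edges. \<open>F\<close> enumerates
  the graphs of interest and \<open>L\<close> the connected ones among them; the assumption \<open>F_eq\<close> says that, up to
  a perturbation encoded by the exponential \<open>H\<close> of \<open>Phi\<close>, every edge is present freely.\<close>

locale perturbed_graphs =
  fixes F L H Phi :: "rat fps fps"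
  assumes F0: "F $ 0 = 1" and L0: "L $ 0 = 0" and H0: "H $ 0 = 1" and Phi0: "Phi $ 0 = 0"
    and theta_F: "theta F = F * theta L"
    and theta_H: "theta H = H * theta Phi"
    and F_eq: "F = choose_twist H"
    and L_nth: "\<And>n i. i + 1 < n \<Longrightarrow> L $ n $ i = 0"
    and Phi_nth: "\<And>n i. 2 * i + 3 < 3 * n \<Longrightarrow> Phi $ n $ i = 0"
    and Phi1: "Phi $ 1 = 1" and Phi2: "Phi $ 2 $ 2 = 0" and Phi3: "Phi $ 3 $ 3 = - 1 / 6"
begin

abbreviation M :: "rat fps fps \<Rightarrow> rat fps fps" where "M \<equiv> twist (1 + fps_X)"

definition L' :: "rat fps fps" where "L' = scale_down L"
definition Phi' :: "rat fps fps" where "Phi' = scale_down Phi"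

lemma L'_eq: "fps_const fps_X * L = twist fps_X L'"
  unfolding L'_def using L0 L_nth by (rule scale_down)

lemma Phi'_eq: "fps_const fps_X * Phi = twist fps_X Phi'"
  unfolding Phi'_def using Phi0 by (rule scale_down) (simp add: Phi_nth)

text \<open>This is (L'((1 + w) z) - L'(z)) / w. Spelling out ((1 + w)^n - 1) / w makes the
  divisibility by w explicit.\<close>

definition E' :: "rat fps fps" where
  "E' = Abs_fps (\<lambda>n. Abs_fps (\<lambda>i. of_nat (n choose Suc i)) * L' $ n)"

lemma E'_eq: "fps_const fps_X * E' = M L' - L'"
proof (rule fps_ext)
  fix n
  have "fps_X * Abs_fps (\<lambda>i. of_nat (n choose Suc i)) = (1 + fps_X) ^ n - (1 :: rat fps)"
  proof (rule fps_ext)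
    fix i
    show "(fps_X * Abs_fps (\<lambda>i. of_nat (n choose Suc i))) $ i = ((1 + fps_X) ^ n - (1 :: rat fps)) $ i"
      by (cases i) (simp_all add: one_plus_X_power_nth)
  qed
  thus "(fps_const fps_X * E') $ n = (M L' - L') $ n"
    by (simp add: E'_def mult.assoc[symmetric] left_diff_distrib)
qed

lemma const_X_neq_0: "fps_const (fps_X :: rat fps) \<noteq> 0"
  by (simp add: fps_const_eq_0_iff)

lemma L'_0: "L' $ 0 = 0" by (simp add: L'_def scale_down_def)
lemma E'_0: "E' $ 0 = 0" by (simp add: E'_def L'_0)

lemma M_L: "M L - L = twist fps_X E'"
proof -
  have "fps_const fps_X * (M L - L) = M (twist fps_X L') - twist fps_X L'"
    by (simp add: right_diff_distrib L'_eq[symmetric] twist_const_mult)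
  also have "\<dots> = twist fps_X (M L' - L')" by (simp add: twist_diff twist_commute)
  also have "\<dots> = fps_const fps_X * twist fps_X E'" by (simp add: E'_eq[symmetric] twist_const_mult)
  finally show ?thesis using const_X_neq_0 by simp
qed

lemma F_neq_0: "F \<noteq> 0" using F0 by auto

text \<open>F((1 + w) z) / F(z) is the exponential of L((1 + w) z) - L(z) = E'(w z), so
  \<open>Q'\<close> has to be exp E'. The quotient Q itself exists because F has constant term 1;
  what remains is that the rescaling can be undone.\<close>

lemma Q_exists: "\<exists>Q'. Q' $ 0 = 1 \<and> F * twist fps_X Q' = M F \<and> theta Q' = Q' * theta E'"
proof -
  obtain G where G: "F * G = 1"
    using fps_right_inverse[of F 1] F0 by auto
  define Q where "Q = G * M F"
  have FQ: "F * Q = M F" using G by (simp add: Q_def mult.assoc[symmetric])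
  have Q0: "Q $ 0 = 1" using arg_cong[OF FQ, of "\<lambda>f. f $ 0"] F0 by simp
  have "F * theta Q = F * (Q * theta (M L - L))"
  proof -
    have "theta F * Q + F * theta Q = theta (M F)" using arg_cong[OF FQ, of theta] by (simp add: theta_mult)
    also have "theta (M F) = M (theta F)" by (simp add: twist_theta)
    also have "\<dots> = M F * theta (M L)" unfolding theta_F by (simp add: twist_mult twist_theta)
    finally show ?thesis unfolding FQ[symmetric] theta_F by (simp add: theta_diff algebra_simps)
  qed
  hence thQ: "theta Q = Q * theta (twist fps_X E')" using F_neq_0 unfolding M_L by simp
  \<comment> \<open>In the recursion for \<open>Q $ n\<close> every summand is a product of a
    multiple of w^i and a multiple of w^(n - i).\<close>
  have dvd: "fps_X ^ n dvd Q $ n" for n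
  proof (induction n rule: less_induct)
    case (less n)
    show ?case
    proof (cases "n = 0")
      case False
      have "of_nat n * Q $ n = (\<Sum>i=0..n. Q $ i * (of_nat (n - i) * (fps_X ^ (n - i) * E' $ (n - i))))"
        using arg_cong[OF thQ, of "\<lambda>f. f $ n"] by (simp add: fps_mult_nth)
      moreover have "fps_X ^ n dvd \<dots>"
      proof (rule dvd_sum)
        fix i assume i: "i \<in> {0..n}"
        show "fps_X ^ n dvd Q $ i * (of_nat (n - i) * (fps_X ^ (n - i) * E' $ (n - i)))"
        proof (cases "i = n")
          case False
          hence "fps_X ^ i * fps_X ^ (n - i) dvd Q $ i * (of_nat (n - i) * (fps_X ^ (n - i) * E' $ (n - i)))"
            using less.IH[of i] i by (intro mult_dvd_mono) auto
          thus ?thesis using i by (simp flip: power_add)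
        qed simp
      qed
      ultimately have "fps_X ^ n dvd of_nat n * Q $ n" by simp
      hence "fps_X ^ n dvd fps_const (1 / of_nat n) * (of_nat n * Q $ n)" by (rule dvd_mult)
      also have "fps_const (1 / of_nat n) * (of_nat n * Q $ n) = Q $ n"
        using False by (simp add: fps_of_nat[symmetric] mult.assoc[symmetric])
      finally show ?thesis .
    qed simp
  qed
  then obtain q where q: "\<And>n. Q $ n = fps_X ^ n * q n" unfolding dvd_def by metis
  define Q' where "Q' = Abs_fps q"
  have Q: "Q = twist fps_X Q'" by (simp add: fps_eq_iff q Q'_def)
  have "twist fps_X (theta Q') = twist fps_X (Q' * theta E')"
    using thQ unfolding Q by (simp add: twist_mult twist_theta)
  hence "theta Q' = Q' * theta E'" by (rule twist_inj[rotated]) simp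
  moreover have "Q' $ 0 = 1" using q[of 0] Q0 by (simp add: Q'_def)
  ultimately show ?thesis using FQ Q by blast
qed

definition Q' :: "rat fps fps" where
  "Q' = (SOME Q'. Q' $ 0 = 1 \<and> F * twist fps_X Q' = M F \<and> theta Q' = Q' * theta E')"

lemma Q'_0: "Q' $ 0 = 1" and F_Q': "F * twist fps_X Q' = M F" and theta_Q': "theta Q' = Q' * theta E'"
  using someI_ex[OF Q_exists] by (simp_all add: Q'_def)

fun Y' :: "nat \<Rightarrow> rat fps fps" where
  "Y' 0 = 1"
| "Y' (Suc m) = fps_X * Q' * M (Y' m)"

text \<open>Unrolled, \<open>Y m\<close> is (1 + w)^(m choose 2) z^m F((1 + w)^m z) / F(z), and
  \<open>Y'\<close> is its rescaled form. Building it one factor at a time keeps the dependence on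
  \<open>Q'\<close> explicit, which later gives recurrences in the excess.\<close>

fun Y :: "nat \<Rightarrow> rat fps fps" where
  "Y 0 = 1"
| "Y (Suc m) = fps_X * twist fps_X Q' * M (Y m)"

lemma Y_Y': "fps_const (fps_X ^ m) * Y m = twist fps_X (Y' m)"
proof (induction m)
  case (Suc m)
  have "fps_const (fps_X ^ Suc m) * Y (Suc m)
      = (fps_const fps_X * fps_X) * twist fps_X Q' * M (fps_const (fps_X ^ m) * Y m)"
    by (simp add: twist_mult twist_const mult_ac flip: fps_const_mult)
  also have "\<dots> = twist fps_X (Y' (Suc m))"
    unfolding Suc by (simp add: twist_mult twist_X twist_commute)
  finally show ?case .
qed (simp add: twist_1)

lemma F_Y: "F * Y m = fps_const ((1 + fps_X) ^ (m choose 2)) * fps_X ^ m * twist ((1 + fps_X) ^ m) F"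
proof (induction m)
  case 0
  have "twist 1 F = F" by (rule fps_ext) simp
  thus ?case by (simp add: binomial_eq_0)
next
  case (Suc m)
  have tw: "M (twist ((1 + fps_X) ^ m) F) = twist ((1 + fps_X) ^ Suc m) F"
    by (simp add: fps_eq_iff power_mult_distrib mult_ac)
  have ch: "Suc m choose 2 = m + (m choose 2)"
    using binomial_Suc_Suc[of m 1] by (simp add: numeral_2_eq_2)
  have "F * Y (Suc m) = fps_X * (F * twist fps_X Q') * M (Y m)" by (simp add: mult_ac)
  also have "\<dots> = fps_X * M (F * Y m)" by (simp add: F_Q' twist_mult mult_ac)
  also have "\<dots> = fps_X * (fps_const ((1 + fps_X) ^ (m choose 2)) * (fps_const (1 + fps_X) * fps_X) ^ m
      * twist ((1 + fps_X) ^ Suc m) F)"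
    by (simp only: Suc twist_mult twist_const twist_power twist_X tw)
  also have "\<dots> = fps_const ((1 + fps_X) ^ (Suc m choose 2)) * fps_X ^ Suc m * twist ((1 + fps_X) ^ Suc m) F"
    unfolding ch by (simp add: power_add power_mult_distrib mult_ac fps_const_power del: fps_const_mult
       flip: fps_const_mult)
  finally show ?case .
qed

lemma F_Y_nth: "(F * Y m) $ N =
  (if N < m then 0 else (1 + fps_X) ^ ((m choose 2) + m * (N - m)) * F $ (N - m))"
  unfolding F_Y by (simp add: mult.assoc fps_X_power_mult_nth power_add power_mult)

lemma Y'_nth_eq_0: "n < m \<Longrightarrow> Y' m $ n = 0"
proof (induction m arbitrary: n)
  case (Suc m)
  show ?case
  proof (cases n)
    case (Suc n')
    hence "Y' (Suc m) $ n = (\<Sum>i=0..n'. Q' $ i * ((1 + fps_X) ^ (n' - i) * Y' m $ (n' - i)))"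
      by (simp only: Y'.simps mult.assoc fps_X_mult_nth) (simp add: fps_mult_nth)
    also have "\<dots> = 0" using Suc Suc.prems Suc.IH by (intro sum.neutral) auto
    finally show ?thesis .
  qed (simp add: mult.assoc)
qed simp

lemma Y_nth_eq_0: assumes "n < m" shows "Y m $ n = 0"
proof -
  have "(fps_const (fps_X ^ m) * Y m) $ n = 0" unfolding Y_Y' by (simp add: Y'_nth_eq_0 assms)
  thus ?thesis by simp
qed

text \<open>Of the N choose 2 pairs, those inside the N - m points carrying H are absorbed by the
  coefficient of F; those inside the m points carrying A, and those between the two sets, by
  \<open>Y m\<close>.\<close>

lemma F_substitute: "F * substitute Y A = choose_twist (H * A)"
proof (rule fps_ext)
  fix N
  have flip: "(F * B) $ N = (\<Sum>i=0..N. B $ i * F $ (N - i))" for B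
    unfolding mult.commute[of F B] by (rule fps_mult_nth)
  have "(F * substitute Y A) $ N = (\<Sum>i=0..N. \<Sum>m\<le>N. A $ m * (Y m $ i * F $ (N - i)))"
    unfolding flip
  proof (rule sum.cong[OF refl])
    fix i assume i: "i \<in> {0..N}"
    have "(\<Sum>m\<le>i. A $ m * Y m $ i) = (\<Sum>m\<le>N. A $ m * Y m $ i)"
      by (rule sum.mono_neutral_left) (use i Y_nth_eq_0 in auto)
    thus "substitute Y A $ i * F $ (N - i) = (\<Sum>m\<le>N. A $ m * (Y m $ i * F $ (N - i)))"
      by (simp only: substitute_nth sum_distrib_right mult.assoc)
  qed
  also have "\<dots> = (\<Sum>m\<le>N. A $ m * (F * Y m) $ N)"
    unfolding flip sum_distrib_left by (rule sum.swap)
  also have "\<dots> = (\<Sum>m\<le>N. (1 + fps_X) ^ (N choose 2) * (A $ m * H $ (N - m)))"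
  proof (rule sum.cong[OF refl])
    fix m assume "m \<in> {..N}"
    hence N: "N = m + (N - m)" by simp
    have "N choose 2 = (m choose 2) + m * (N - m) + ((N - m) choose 2)"
      using choose_two_add[of m "N - m"] N by simp
    thus "A $ m * (F * Y m) $ N = (1 + fps_X) ^ (N choose 2) * (A $ m * H $ (N - m))"
      using \<open>m \<in> {..N}\<close> arg_cong[OF F_eq, of "\<lambda>f. f $ (N - m)"]
      by (simp add: F_Y_nth power_add mult_ac)
  qed
  also have "\<dots> = choose_twist (H * A) $ N"
    unfolding mult.commute[of H A] choose_twist_nth fps_mult_nth sum_distrib_left atMost_atLeast0 ..
  finally show "(F * substitute Y A) $ N = choose_twist (H * A) $ N" .
qed

text \<open>Vertex marking: the connected set of triples at the marked vertex is singled out by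
  \<open>theta Phi\<close>; everything else reassembles to F and cancels.\<close>

lemma theta_L: "theta L = substitute Y (theta Phi)"
proof -
  have "F * theta L = choose_twist (theta H)"
    unfolding theta_F[symmetric] by (simp add: F_eq fps_eq_iff mult_ac)
  also have "\<dots> = F * substitute Y (theta Phi)" unfolding theta_H F_substitute ..
  finally show ?thesis using F_neq_0 by simp
qed

text \<open>Edge marking: 2 (1 + w) d/dw brings down n (n - 1) from (1 + w)^(n choose 2), which is
  \<open>theta\<close> applied twice minus \<open>theta\<close>. The derivative of H supplies the
  correction by \<open>Phi\<close>.\<close>

lemma wdiff_L: "2 * fps_const (1 + fps_X) * wdiff L =
   theta (theta L) + theta L * theta L - theta L + 2 * fps_const (1 + fps_X) * substitute Y (wdiff Phi)"
proof -
  have "2 * fps_const (1 + fps_X) * wdiff F =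
      theta (theta F) - theta F + 2 * fps_const (1 + fps_X) * choose_twist (wdiff H)"
  proof (rule fps_ext)
    fix n
    let ?G = "(1 + fps_X) :: rat fps"
    have "2 * ?G * fps_deriv (?G ^ (n choose 2) * H $ n)
        = 2 * (?G * fps_deriv (?G ^ (n choose 2))) * H $ n + 2 * ?G * ?G ^ (n choose 2) * fps_deriv (H $ n)"
      by (simp add: algebra_simps)
    also have "2 * (?G * fps_deriv (?G ^ (n choose 2))) = (of_nat 2 * of_nat (n choose 2)) * ?G ^ (n choose 2)"
      by (simp only: deriv_one_plus_X_power of_nat_numeral mult.assoc)
    also have "\<dots> = (of_nat n * of_nat n - of_nat n) * ?G ^ (n choose 2)"
      by (simp only: two_choose_two)
    finally have "2 * ?G * fps_deriv (?G ^ (n choose 2) * H $ n) =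
      (of_nat n * of_nat n - of_nat n) * ?G ^ (n choose 2) * H $ n
        + 2 * ?G * ?G ^ (n choose 2) * fps_deriv (H $ n)" .
    moreover have "(2 * fps_const c * A) $ n = 2 * c * A $ n" for c and A :: "rat fps fps"
      by (metis fps_const_mult fps_mult_left_const_nth numeral_fps_const)
    ultimately show "(2 * fps_const ?G * wdiff F) $ n =
      (theta (theta F) - theta F + 2 * fps_const ?G * choose_twist (wdiff H)) $ n"
      by (simp only: F_eq fps_add_nth fps_sub_nth theta_nth wdiff_nth choose_twist_nth)
        (simp only: algebra_simps)
  qed
  moreover have "wdiff F = F * wdiff L" using theta_F F0 L0 by (rule wdiff_of_theta)
  moreover have "wdiff H = H * wdiff Phi" using theta_H H0 Phi0 by (rule wdiff_of_theta)
  moreover have "theta (theta F) = F * (theta (theta L) + theta L * theta L)"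
    by (simp add: theta_F theta_mult algebra_simps)
  ultimately have "F * (2 * fps_const (1 + fps_X) * wdiff L) =
     F * (theta (theta L) + theta L * theta L - theta L + 2 * fps_const (1 + fps_X) * substitute Y (wdiff Phi))"
    by (simp add: F_substitute[symmetric] theta_F algebra_simps)
  thus ?thesis using F_neq_0 by (simp only: mult_cancel_left simp_thms)
qed

lemma twist_substitute: "twist fps_X (substitute Y' A) = substitute Y (twist fps_X A)"
proof (rule fps_ext)
  fix n
  have "fps_X ^ n * Y' m $ n = fps_X ^ m * Y m $ n" for m
    using arg_cong[OF Y_Y', of "\<lambda>f. f $ n" m] by simp
  hence "fps_X ^ n * (A $ m * Y' m $ n) = fps_X ^ m * A $ m * Y m $ n" for m
    by (metis mult.left_commute mult.assoc)
  thus "twist fps_X (substitute Y' A) $ n = substitute Y (twist fps_X A) $ n"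
    by (simp only: substitute_nth twist_nth sum_distrib_left)
qed

lemma theta_L': "theta L' = substitute Y' (theta Phi')"
proof -
  have "twist fps_X (theta L') = fps_const fps_X * theta L"
    by (simp add: twist_theta L'_eq[symmetric] theta_const_mult)
  also have "\<dots> = substitute Y (theta (twist fps_X Phi'))"
    by (simp add: theta_L Phi'_eq[symmetric] theta_const_mult substitute_const_mult)
  also have "\<dots> = twist fps_X (substitute Y' (theta Phi'))"
    by (simp add: twist_substitute twist_theta)
  finally show ?thesis by (rule twist_inj[rotated]) simp
qed

text \<open>The operator \<open>w d/dw\<close>, conjugated by the scaling \<open>A \<mapsto> A(zw, w) / w\<close>.\<close>

definition wop :: "rat fps fps \<Rightarrow> rat fps fps" where
  "wop A = fps_const fps_X * wdiff A + theta A - A"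

lemma wop_scaled:
  assumes "fps_const fps_X * A = twist fps_X A'"
  shows "fps_const (fps_X ^ 2) * wdiff A = twist fps_X (wop A')"
proof -
  have "fps_const fps_X * wdiff (fps_const fps_X * A) = twist fps_X (fps_const fps_X * wdiff A' + theta A')"
    unfolding assms
  proof (rule fps_ext)
    fix n
    have "fps_X * fps_deriv (fps_X ^ n * A' $ n) = fps_X ^ n * (fps_X * fps_deriv (A' $ n) + of_nat n * A' $ n)"
    proof (cases n)
      case (Suc m)
      have "fps_X * fps_deriv (fps_X ^ n) = of_nat n * (fps_X ^ n :: rat fps)"
        unfolding Suc fps_deriv_power' by (simp add: mult_ac)
      thus ?thesis by (simp add: algebra_simps)
    qed simp
    thus "(fps_const fps_X * wdiff (twist fps_X A')) $ n = twist fps_X (fps_const fps_X * wdiff A' + theta A') $ n"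
      by simp
  qed
  moreover have "wdiff (fps_const fps_X * A) = A + fps_const fps_X * wdiff A"
    by (simp add: fps_eq_iff)
  ultimately have "fps_const fps_X * A + fps_const (fps_X ^ 2) * wdiff A
      = twist fps_X (fps_const fps_X * wdiff A' + theta A')"
    by (simp add: algebra_simps power2_eq_square flip: fps_const_mult)
  thus ?thesis unfolding assms wop_def twist_diff by (simp add: algebra_simps)
qed

lemma wop_L': "2 * fps_const (1 + fps_X) * wop L' =
   fps_const fps_X * theta (theta L') + theta L' * theta L' - fps_const fps_X * theta L'
   + 2 * fps_const (1 + fps_X) * substitute Y' (wop Phi')"
proof -
  let ?w = "fps_const (fps_X :: rat fps)" and ?G = "2 * fps_const (1 + fps_X :: rat fps)"
  have G: "twist fps_X (?G * A) = ?G * twist fps_X A" for A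
    by (metis fps_const_mult numeral_fps_const twist_const_mult)
  have "?w ^ 2 * (?G * wdiff L) = ?w * theta (theta (?w * L)) + theta (?w * L) * theta (?w * L) - ?w * theta (?w * L)
      + ?G * substitute Y (?w ^ 2 * wdiff Phi)"
    unfolding wdiff_L theta_const_mult
    by (simp only: fps_const_power substitute_const_mult) (simp add: algebra_simps power2_eq_square flip: fps_const_mult)
  also have "?w ^ 2 * (?G * wdiff L) = twist fps_X (?G * wop L')"
    unfolding G wop_scaled[OF L'_eq, symmetric] by (simp add: mult_ac fps_const_power)
  also have "?w ^ 2 * wdiff Phi = twist fps_X (wop Phi')"
    unfolding wop_scaled[OF Phi'_eq, symmetric] by (simp add: fps_const_power)
  also have "?w * theta (theta (?w * L)) + theta (?w * L) * theta (?w * L) - ?w * theta (?w * L)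
      + ?G * substitute Y (twist fps_X (wop Phi'))
    = twist fps_X (?w * theta (theta L') + theta L' * theta L' - ?w * theta L' + ?G * substitute Y' (wop Phi'))"
    by (simp only: L'_eq twist_add twist_diff twist_mult[of _ "theta L'"] twist_const_mult twist_theta G
        twist_substitute)
  finally show ?thesis by (rule twist_inj[rotated]) simp
qed

end

section \<open>Coefficients of the excess variable\<close>

definition wcoeff :: "nat \<Rightarrow> rat fps fps \<Rightarrow> rat fps" where
  "wcoeff p A = Abs_fps (\<lambda>n. A $ n $ p)"

text \<open>The operator binomial(theta, r). It enters because the substitution of (1 + w) z for z
  multiplies the coefficient of z^n by (1 + w)^n.\<close>

definition choose_op :: "nat \<Rightarrow> rat fps \<Rightarrow> rat fps" where
  "choose_op r f = Abs_fps (\<lambda>n. of_nat (n choose r) * f $ n)"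

lemma wcoeff_nth [simp]: "wcoeff p A $ n = A $ n $ p" by (simp add: wcoeff_def)
lemma choose_op_nth [simp]: "choose_op r f $ n = of_nat (n choose r) * f $ n" by (simp add: choose_op_def)

lemma wcoeff_add: "wcoeff p (A + B) = wcoeff p A + wcoeff p B"
  and wcoeff_diff: "wcoeff p (A - B) = wcoeff p A - wcoeff p B"
  and wcoeff_wdiff: "wcoeff p (wdiff A) = of_nat (Suc p) * wcoeff (Suc p) A"
  and wcoeff_1: "wcoeff p 1 = (if p = 0 then 1 else 0)"
  by (simp_all add: fps_eq_iff fps_of_nat[symmetric] del: of_nat_Suc)

lemma wcoeff_theta: "wcoeff p (theta A) = theta (wcoeff p A)"
  by (simp add: fps_eq_iff fps_of_nat[symmetric])

lemma wcoeff_X_mult: "wcoeff p (fps_X * A) = fps_X * wcoeff p A"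
  by (simp add: fps_eq_iff)

lemma wcoeff_w_mult: "wcoeff p (fps_const fps_X * A) = (if p = 0 then 0 else wcoeff (p - 1) A)"
  by (simp add: fps_eq_iff)

lemma wcoeff_mult: "wcoeff p (A * B) = (\<Sum>i\<le>p. wcoeff i A * wcoeff (p - i) B)"
proof (rule fps_ext)
  fix n
  have "wcoeff p (A * B) $ n = (\<Sum>j=0..n. \<Sum>i\<le>p. A $ j $ i * B $ (n - j) $ (p - i))"
    by (simp add: fps_mult_nth fps_sum_nth atMost_atLeast0)
  also have "\<dots> = (\<Sum>i\<le>p. wcoeff i A * wcoeff (p - i) B) $ n"
    by (subst sum.swap) (simp add: fps_mult_nth fps_sum_nth)
  finally show "wcoeff p (A * B) $ n = (\<Sum>i\<le>p. wcoeff i A * wcoeff (p - i) B) $ n" .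
qed

lemma wcoeff_twist: "wcoeff p (twist (1 + fps_X) A) = (\<Sum>r\<le>p. choose_op r (wcoeff (p - r) A))"
  by (rule fps_ext) (simp add: fps_mult_nth[of _ "A $ _"] one_plus_X_power_nth fps_sum_nth atMost_atLeast0)

lemma choose_op_0: "choose_op 0 f = f"
  and choose_op_1: "choose_op (Suc 0) f = theta f"
  by (simp_all add: fps_eq_iff)

lemma choose_op_Suc: "of_nat (Suc r) * choose_op (Suc r) f = theta (choose_op r f) - of_nat r * choose_op r f"
proof (rule fps_ext)
  fix n
  have "Suc r * (n choose Suc r) + r * (n choose r) = n * (n choose r)"
  proof (cases "r \<le> n")
    case True
    have "Suc r * (n choose Suc r) = (n - r) * (n choose r)"
      using binomial_absorb_comp[of n r] binomial_absorption[of r n] by simp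
    thus ?thesis using True by (metis add_mult_distrib le_add_diff_inverse2)
  qed (simp add: binomial_eq_0)
  hence "of_nat (Suc r * (n choose Suc r) + r * (n choose r)) = (of_nat (n * (n choose r)) :: rat)"
    by (rule arg_cong)
  hence "of_nat (Suc r) * of_nat (n choose Suc r)
      = (of_nat n * of_nat (n choose r) - of_nat r * of_nat (n choose r) :: rat)"
    by (simp only: of_nat_add of_nat_mult eq_diff_eq)
  hence "of_nat (Suc r) * (of_nat (n choose Suc r) * f $ n)
      = of_nat n * (of_nat (n choose r) * f $ n) - of_nat r * (of_nat (n choose r) * f $ n)"
    by (simp only: mult.assoc[symmetric]) (simp only: left_diff_distrib)
  thus "(of_nat (Suc r) * choose_op (Suc r) f) $ n = (theta (choose_op r f) - of_nat r * choose_op r f) $ n"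
    by (simp only: fps_of_nat[symmetric] fps_mult_left_const_nth choose_op_nth theta_nth fps_sub_nth)
qed

section \<open>The tree function by Lagrange inversion\<close>

lemma theta_compose:
  fixes f t :: "'a :: idom fps"
  assumes "t $ 0 = 0"
  shows "theta (f oo t) = (fps_deriv f oo t) * theta t"
  using assms by (simp add: theta_altdef fps_compose_deriv mult_ac)

text \<open>Lagrange inversion: the coefficient of \<open>z ^ n\<close> in \<open>exp (x t) / (1 - t)\<close> is a polynomial in \<open>x\<close>
  which vanishes at \<open>- n\<close> and whose derivative is the coefficient of \<open>z ^ (n - 1)\<close> shifted by one;
  hence it is \<open>(x + n) ^ n / n!\<close>.\<close>

lemma rooted_tree_egf_unique:
  fixes t :: "rat fps"
  assumes t: "t = fps_X * (fps_exp 1 oo t)"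
  shows "t = rooted_tree_egf"
proof -
  have t0: "t $ 0 = 0" by (subst t) simp
  define ex where "ex x = fps_exp x oo t" for x :: rat
  have ex_add: "ex (x + y) = ex x * ex y" for x y
    using t0 by (simp add: ex_def fps_exp_add_mult fps_compose_mult_distrib)
  have theta_ex: "theta (ex x) = fps_const x * ex x * theta t" for x
    using t0 by (simp add: ex_def theta_compose fps_compose_mult_distrib)
  \<comment> \<open>From t = z exp t follows theta t = t / (1 - t), so D is 1 / (1 - t) written
    without division.\<close>
  define D where "D = 1 + theta t"
  define P where "P n = (\<Sum>i\<le>n. monom ((t ^ i * D) $ n / fact i) i)" for n
  have expand: "(ex x * B) $ n = (\<Sum>i\<le>n. x ^ i / fact i * (t ^ i * B) $ n)" for B n x
  proof -
    have "ex x $ m = (\<Sum>i\<le>n. x ^ i / fact i * (t ^ i $ m))" if "m \<le> n" for m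
    proof -
      have "ex x $ m = (\<Sum>i=0..m. x ^ i / fact i * (t ^ i $ m))"
        by (simp add: ex_def fps_compose_nth)
      also have "\<dots> = (\<Sum>i\<le>n. x ^ i / fact i * (t ^ i $ m))"
        using that t0 by (intro sum.mono_neutral_left) (auto simp: startsby_zero_power_prefix)
      finally show ?thesis .
    qed
    hence "(ex x * B) $ n = (\<Sum>m=0..n. \<Sum>i\<le>n. x ^ i / fact i * (t ^ i $ m * B $ (n - m)))"
      by (simp add: fps_mult_nth sum_distrib_right mult.assoc)
    also have "\<dots> = (\<Sum>i\<le>n. x ^ i / fact i * (t ^ i * B) $ n)"
      by (subst sum.swap) (simp add: fps_mult_nth sum_distrib_left)
    finally show ?thesis .
  qed
  have P: "poly (P n) x = (ex x * D) $ n" for n x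
    by (simp add: P_def expand poly_sum poly_monom mult.commute[of "x ^ _"])
  have dP: "pderiv (P (Suc n)) = pcompose (P n) [:1, 1:]" for n
  proof -
    have "poly (pderiv (P (Suc n))) x = poly (pcompose (P n) [:1, 1:]) x" for x
    proof -
      \<comment> \<open>One factor t is replaced by z exp t: the z lowers the coefficient index, the
        exp t moves x to x + 1.\<close>
      have "(t ^ Suc i * D) $ Suc n = (t ^ i * (ex 1 * D)) $ n" for i
      proof -
        have "t ^ Suc i * D = fps_X * (t ^ i * (ex 1 * D))"
          using arg_cong[OF t, of "\<lambda>s. s * (t ^ i * D)"] by (simp only: ex_def power_Suc mult_ac)
        thus ?thesis by (simp only: fps_X_mult_nth) simp
      qed
      moreover have "pderiv (P (Suc n)) = (\<Sum>i\<le>n. monom ((t ^ Suc i * D) $ Suc n / fact i) i)"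
        unfolding P_def
        by (rule poly_eqI) (simp add: coeff_pderiv coeff_sum del: power_Suc of_nat_Suc)
      ultimately have "pderiv (P (Suc n)) = (\<Sum>i\<le>n. monom ((t ^ i * (ex 1 * D)) $ n / fact i) i)"
        by (simp only:)
      hence "poly (pderiv (P (Suc n))) x = (\<Sum>i\<le>n. x ^ i / fact i * (t ^ i * (ex 1 * D)) $ n)"
        by (simp add: poly_sum poly_monom mult.commute[of "x ^ _"])
      also have "\<dots> = (ex x * (ex 1 * D)) $ n"
        by (rule expand[symmetric])
      also have "\<dots> = poly (pcompose (P n) [:1, 1:]) x"
        by (simp add: poly_pcompose P ex_add mult_ac)
      finally show ?thesis .
    qed
    thus ?thesis by (simp add: poly_eq_poly_eq_iff[symmetric] fun_eq_iff)
  qed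
  have P_eq: "P n = smult (1 / fact n) ([:of_nat n, 1:] ^ n)" for n
  proof (induction n)
    case 0
    show ?case by (simp add: P_def D_def)
  next
    case (Suc n)
    let ?p = "[:of_nat (Suc n), 1:] :: rat poly"
    let ?d = "P (Suc n) - smult (1 / fact (Suc n)) (?p ^ Suc n)"
    have "pderiv ?d = 0"
    proof -
      have "pcompose (P n) [:1, 1:] = smult (1 / fact n) (?p ^ n)"
        unfolding Suc by (simp add: poly_eq_poly_eq_iff[symmetric] fun_eq_iff poly_pcompose add_ac)
      moreover have "pderiv (smult (1 / fact (Suc n)) (?p ^ Suc n)) = smult (1 / fact n) (?p ^ n)"
        by (simp add: pderiv_smult pderiv_power_Suc pderiv_pCons field_simps del: power_Suc of_nat_Suc)
      ultimately show ?thesis by (simp only: pderiv_diff dP diff_self)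
    qed
    then obtain c where c: "?d = [:c:]" by (metis pderiv_eq_0_iff degree_0_id)
    \<comment> \<open>With N = \<open>Suc n\<close>: N times coefficient N of exp(-N t) is
      coefficient N of its image under \<open>theta\<close>, which is -N exp(-N t)
      \<open>theta t\<close>. Hence coefficient N of exp(-N t) (1 + theta t) vanishes.\<close>
    have "poly ?d (- of_nat (Suc n)) = 0"
    proof -
      let ?x = "- of_nat (Suc n) :: rat"
      have "of_nat (Suc n) * ex ?x $ Suc n = theta (ex ?x) $ Suc n" by simp
      also have "\<dots> = ?x * (ex ?x * theta t) $ Suc n" unfolding theta_ex by (simp only: mult.assoc fps_mult_left_const_nth)
      finally have "of_nat (Suc n) * (ex ?x * D) $ Suc n = 0"
        by (simp add: D_def distrib_left del: of_nat_Suc theta_nth)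
      hence "(ex ?x * D) $ Suc n = 0" by (simp only: mult_eq_0_iff of_nat_eq_0_iff) simp
      moreover have "poly (?p ^ Suc n) ?x = 0" by (simp add: poly_power del: of_nat_Suc)
      ultimately show ?thesis by (simp only: poly_diff poly_smult P)
    qed
    hence "c = 0" unfolding c by simp
    with c have "?d = 0" by (simp only: pCons_0_0)
    thus ?case by (simp only: right_minus_eq)
  qed
  show ?thesis
  proof (rule fps_ext)
    fix n
    \<comment> \<open>At x = 0 the polynomial gives D = 1 + theta t itself, from which t is read off
      coefficientwise.\<close>
    have "poly (P n) 0 = D $ n"
      unfolding P by (simp add: ex_def)
    hence D_nth: "D $ n = of_nat n ^ n / fact n" unfolding P_eq by simp
    show "t $ n = rooted_tree_egf $ n"
    proof (cases n)
      case (Suc m)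
      have "of_nat n * t $ n = of_nat n * (of_nat n ^ m / fact n)"
        using D_nth by (simp add: D_def Suc del: of_nat_Suc)
      hence "t $ n = of_nat n ^ m / fact n" using Suc by (simp only: mult_cancel_left of_nat_eq_0_iff) simp
      thus ?thesis by (simp add: Suc rooted_tree_egf_def)
    qed (simp add: t0 rooted_tree_egf_def)
  qed
qed

section \<open>The two equations at a fixed excess\<close>

context perturbed_graphs
begin

text \<open>As \<open>L' = w L(z / w, w)\<close>, the series \<open>W p\<close> collects the connected graphs of excess \<open>p - 1\<close>.\<close>

definition W :: "nat \<Rightarrow> rat fps" where "W p = wcoeff p L'"
definition y :: "nat \<Rightarrow> nat \<Rightarrow> rat fps" where "y m p = wcoeff p (Y' m)"
definition E :: "nat \<Rightarrow> rat fps" where "E p = wcoeff p E'"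

lemma Phi'_nth: "Phi' $ m $ i = (if m = 0 then 0 else Phi $ m $ (m - 1 + i))"
  by (simp add: Phi'_def scale_down_def add.commute)

text \<open>The bound 3 m \<le> 2 c + 3 with c = m - 1 + i covered pairs reads m \<le> 2 i + 1. So
  each power of w meets finitely many m, and \<open>substitute\<close> becomes a finite sum.\<close>

lemma Phi'_nth_eq_0: "2 * i + 1 < m \<Longrightarrow> Phi' $ m $ i = 0"
  by (auto simp: Phi'_nth intro!: Phi_nth)

lemma wop_Phi'_nth: "wop Phi' $ m $ i = (of_nat i + of_nat m - 1) * Phi' $ m $ i"
  by (cases i) (simp_all add: wop_def algebra_simps fps_of_nat[symmetric])

lemma wcoeff_substitute:
  assumes "\<And>m i. 2 * i + 1 < m \<Longrightarrow> A $ m $ i = 0"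
  shows "wcoeff p (substitute Y' A) = (\<Sum>i\<le>p. \<Sum>m\<le>2*i+1. fps_const (A $ m $ i) * y m (p - i))"
proof (rule fps_ext)
  fix n
  have "wcoeff p (substitute Y' A) $ n = (\<Sum>m\<le>n. \<Sum>i\<le>p. A $ m $ i * y m (p - i) $ n)"
    by (simp add: substitute_nth fps_sum_nth fps_mult_nth y_def atMost_atLeast0)
  also have "\<dots> = (\<Sum>i\<le>p. \<Sum>m\<le>n. A $ m $ i * y m (p - i) $ n)"
    by (rule sum.swap)
  also have "\<dots> = (\<Sum>i\<le>p. \<Sum>m\<le>2*i+1. A $ m $ i * y m (p - i) $ n)"
  proof (rule sum.cong[OF refl])
    fix i
    have z1: "A $ m $ i * y m (p - i) $ n = 0" if "2 * i + 1 < m" for m using assms that by simp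
    have z2: "A $ m $ i * y m (p - i) $ n = 0" if "n < m" for m using Y'_nth_eq_0 that by (simp add: y_def)
    have "(\<Sum>m\<le>n. A $ m $ i * y m (p - i) $ n) = (\<Sum>m\<le>max n (2*i+1). A $ m $ i * y m (p - i) $ n)"
      using z2 by (intro sum.mono_neutral_left) auto
    also have "\<dots> = (\<Sum>m\<le>2*i+1. A $ m $ i * y m (p - i) $ n)"
      using z1 by (intro sum.mono_neutral_right) auto
    finally show "(\<Sum>m\<le>n. A $ m $ i * y m (p - i) $ n) = (\<Sum>m\<le>2*i+1. A $ m $ i * y m (p - i) $ n)" .
  qed
  finally show "wcoeff p (substitute Y' A) $ n = (\<Sum>i\<le>p. \<Sum>m\<le>2*i+1. fps_const (A $ m $ i) * y m (p - i)) $ n"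
    by (simp add: fps_sum_nth)
qed

lemma E_eq: "E p = (\<Sum>r\<le>p. choose_op (Suc r) (W (p - r)))"
  by (rule fps_ext)
    (simp add: E_def W_def E'_def fps_mult_nth[of _ "L' $ _"] fps_sum_nth atMost_atLeast0)

lemma y_0: "y 0 p = (if p = 0 then 1 else 0)"
  by (simp add: y_def wcoeff_1)

lemma y_Suc: "y (Suc m) p = (\<Sum>i\<le>p. y 1 i * (\<Sum>r\<le>p - i. choose_op r (y m (p - i - r))))"
proof -
  have "Y' (Suc m) = Y' 1 * M (Y' m)" by (simp add: twist_1)
  thus ?thesis unfolding y_def by (simp only: wcoeff_mult wcoeff_twist)
qed

lemma Y'_1: "Y' 1 = fps_X * Q'" by (simp add: twist_1)

text \<open>Coefficients of \<open>Q'\<close> = exp E', extracted with d/dw because the induction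
  runs over the excess. The newest unknown \<open>E (Suc p)\<close> occurs only in the term i =
  0.\<close>

lemma y_1_rec: "of_nat (Suc p) * y 1 (Suc p) = (\<Sum>i\<le>p. y 1 i * (of_nat (Suc (p - i)) * E (Suc (p - i))))"
proof -
  have "wdiff Q' = Q' * wdiff E'" using theta_Q' Q'_0 E'_0 by (rule wdiff_of_theta)
  moreover have "wdiff (Y' 1) = fps_X * wdiff Q'"
    unfolding Y'_1 by (rule fps_ext) simp
  ultimately have "wdiff (Y' 1) = Y' 1 * wdiff E'" by (simp only: Y'_1 mult.assoc)
  hence "wcoeff p (wdiff (Y' 1)) = wcoeff p (Y' 1 * wdiff E')" by (rule arg_cong)
  thus ?thesis unfolding y_def E_def by (simp only: wcoeff_wdiff wcoeff_mult)
qed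

lemma theta_W: "theta (W p) = y 1 p +
  (\<Sum>i=1..p. \<Sum>m\<le>2*i+1. fps_const (of_nat m * Phi' $ m $ i) * y m (p - i))"
proof -
  have "theta (W p) = (\<Sum>i\<le>p. \<Sum>m\<le>2*i+1. fps_const (theta Phi' $ m $ i) * y m (p - i))"
    unfolding W_def wcoeff_theta[symmetric] theta_L'
    by (rule wcoeff_substitute) (simp add: Phi'_nth_eq_0 fps_of_nat[symmetric])
  also have "\<dots> = (\<Sum>i=0..p. \<Sum>m\<le>2*i+1. fps_const (of_nat m * Phi' $ m $ i) * y m (p - i))"
    by (simp add: fps_of_nat[symmetric] atMost_atLeast0)
  \<comment> \<open>For i = 0 only m \<le> 1 is left; there \<open>Phi' $ 0\<close> is 0 and
    \<open>Phi $ 1\<close> is 1, which leaves \<open>y 1 p\<close>.\<close>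
  also have "\<dots> = y 1 p + (\<Sum>i=1..p. \<Sum>m\<le>2*i+1. fps_const (of_nat m * Phi' $ m $ i) * y m (p - i))"
    using Phi1 by (simp add: sum.atLeast_Suc_atMost[of 0 p] Phi'_nth del: sum.cl_ivl_Suc)
  finally show ?thesis .
qed

text \<open>The contribution of the triples to the edge equation.\<close>

definition D :: "nat \<Rightarrow> rat fps" where "D p = wcoeff p (substitute Y' (wop Phi'))"

lemma D_eq: "D p = (\<Sum>i=1..p. \<Sum>m\<le>2*i+1. fps_const ((of_nat i + of_nat m - 1) * Phi' $ m $ i) * y m (p - i))"
proof -
  have "D p = (\<Sum>i\<le>p. \<Sum>m\<le>2*i+1. fps_const (wop Phi' $ m $ i) * y m (p - i))"
    unfolding D_def by (rule wcoeff_substitute) (simp add: Phi'_nth_eq_0 wop_Phi'_nth)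
  also have "\<dots> = (\<Sum>i=0..p. \<Sum>m\<le>2*i+1. fps_const ((of_nat i + of_nat m - 1) * Phi' $ m $ i) * y m (p - i))"
    by (simp only: wop_Phi'_nth atMost_atLeast0)
  \<comment> \<open>The term i = 0 drops out: at m = 1 the factor i + m - 1 is 0, and
    \<open>Phi' $ 0\<close> vanishes.\<close>
  also have "\<dots> = (\<Sum>i=1..p. \<Sum>m\<le>2*i+1. fps_const ((of_nat i + of_nat m - 1) * Phi' $ m $ i) * y m (p - i))"
    by (simp add: sum.atLeast_Suc_atMost[of 0 p] Phi'_nth del: sum.cl_ivl_Suc)
  finally show ?thesis .
qed

text \<open>A graph of excess p on n vertices has n + p edges, so p W + theta W at index
  \<open>Suc p\<close> marks an edge. The factor 1 + w in \<open>wop_L'\<close> makes two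
  consecutive indices appear.\<close>

lemma edge_equation_0: "2 * (theta (W 0) - W 0) = theta (W 0) * theta (W 0) + 2 * D 0"
  and edge_equation: "2 * (of_nat p * W (Suc p) + theta (W (Suc p))) + 2 * (of_nat p * W p + theta (W p) - W p)
   = theta (theta (W p)) + (\<Sum>i\<le>Suc p. theta (W i) * theta (W (Suc p - i))) - theta (W p)
     + 2 * D (Suc p) + 2 * D p"
proof -
  have two: "wcoeff p (2 * A) = 2 * wcoeff p A" for p A
    by (simp only: mult_2 wcoeff_add)
  have G: "wcoeff p (2 * fps_const (1 + fps_X) * A) = 2 * wcoeff p A + (if p = 0 then 0 else 2 * wcoeff (p - 1) A)" for p A
  proof -
    have "2 * fps_const (1 + fps_X) * A = 2 * (A + fps_const fps_X * A)"
      by (simp add: algebra_simps flip: fps_const_add)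
    thus ?thesis by (simp only: two wcoeff_add wcoeff_w_mult) simp
  qed
  have wop: "wcoeff p (wop L') = of_nat p * W p + theta (W p) - W p" for p
    by (cases p) (simp_all add: wop_def wcoeff_add wcoeff_diff wcoeff_w_mult wcoeff_wdiff wcoeff_theta W_def)
  note * = arg_cong[OF wop_L', of "wcoeff _", unfolded wcoeff_add wcoeff_diff G wcoeff_w_mult
      wcoeff_mult[of _ "theta L'"] wop
      wcoeff_theta D_def[symmetric] W_def[symmetric]]
  show "2 * (theta (W 0) - W 0) = theta (W 0) * theta (W 0) + 2 * D 0"
    using *[of 0] by simp
  show "2 * (of_nat p * W (Suc p) + theta (W (Suc p))) + 2 * (of_nat p * W p + theta (W p) - W p)
   = theta (theta (W p)) + (\<Sum>i\<le>Suc p. theta (W i) * theta (W (Suc p - i))) - theta (W p)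
     + 2 * D (Suc p) + 2 * D p"
    using *[of "Suc p"] by (simp add: algebra_simps del: sum.atMost_Suc)
qed

text \<open>At w = 0 the factor q of t = z q solves theta q = q theta t with constant term 1. So q =
  exp t, and t satisfies the equation of the tree function.\<close>

lemma theta_W_0: "theta (W 0) = rooted_tree_egf"
proof -
  let ?t = "theta (W 0)" and ?q = "wcoeff 0 Q'"
  have t: "?t = fps_X * ?q"
    using theta_W[of 0] unfolding y_def Y'_1 by (simp add: wcoeff_X_mult)
  have t0: "?t $ 0 = 0" by simp
  have "theta ?q = ?q * theta (E 0)"
    using arg_cong[OF theta_Q', of "wcoeff 0"] by (simp add: wcoeff_theta wcoeff_mult E_def)
  also have "E 0 = ?t" by (simp add: E_eq choose_op_1)
  finally have q: "theta ?q = ?q * theta ?t" .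
  have "theta (fps_exp 1 oo ?t) = (fps_exp 1 oo ?t) * theta ?t"
    by (subst theta_compose) simp_all
  with q have "theta (?q - (fps_exp 1 oo ?t)) = (?q - (fps_exp 1 oo ?t)) * theta ?t"
    by (simp add: theta_diff left_diff_distrib)
  hence "?q - (fps_exp 1 oo ?t) = 0" by (rule theta_ode_unique) (simp add: Q'_0)
  hence "?q = fps_exp 1 oo ?t" by simp
  with t have "?t = fps_X * (fps_exp 1 oo ?t)" by metis
  thus ?thesis by (rule rooted_tree_egf_unique)
qed

end

section \<open>Poles in the tree function\<close>

abbreviation T :: "rat fps" where "T \<equiv> rooted_tree_egf"
abbreviation U :: "rat fps" where "U \<equiv> inverse (1 - T)"

lemma T_0: "T $ 0 = 0" by (simp add: rooted_tree_egf_def)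
lemma T_neq_0: "T \<noteq> 0"
proof
  assume "T = 0"
  hence "T $ 1 = 0" by simp
  thus False by (simp add: rooted_tree_egf_def)
qed

lemma U_inverse: "(1 - T) * U = 1"
  by (rule inverse_mult_eq_1') (simp add: T_0)

lemma T_U: "T * U = U - 1"
  using U_inverse by (simp add: algebra_simps)

lemma U_power_cancel: "m \<le> n \<Longrightarrow> (1 - T) ^ m * U ^ n = U ^ (n - m)"
proof -
  assume "m \<le> n"
  hence "(1 - T) ^ m * U ^ n = ((1 - T) * U) ^ m * U ^ (n - m)"
    unfolding power_mult_distrib by (simp add: mult.assoc flip: power_add)
  thus ?thesis by (simp add: U_inverse)
qed

definition poly_T :: "rat poly \<Rightarrow> rat fps" where
  "poly_T p = fps_of_poly p oo T"

lemma poly_T_simps: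
  "poly_T (p + q) = poly_T p + poly_T q" "poly_T (p - q) = poly_T p - poly_T q"
  "poly_T (p * q) = poly_T p * poly_T q" "poly_T [:c:] = fps_const c" "poly_T [:0, 1:] = T"
  "poly_T [:1, -1:] = 1 - T" "poly_T (p ^ n) = poly_T p ^ n" "poly_T 1 = 1" "poly_T 0 = 0"
proof -
  show diff: "poly_T (p - q) = poly_T p - poly_T q" for p q
    using T_0 by (simp add: poly_T_def fps_of_poly_diff fps_compose_sub_distrib)
  show one: "poly_T 1 = 1" and X: "poly_T [:0, 1:] = T"
    using T_0 by (simp_all add: poly_T_def)
  have "[:1, -1:] = (1 - [:0, 1:] :: rat poly)" by (simp add: one_pCons)
  thus "poly_T [:1, -1:] = 1 - T" by (simp only: diff one X)
qed (use T_0 in \<open>simp_all add: poly_T_def fps_of_poly_add fps_of_poly_mult fps_of_poly_const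
    fps_of_poly_power fps_compose_add_distrib fps_compose_mult_distrib fps_compose_power\<close>)

text \<open>T is transcendental: composition with a nonzero series without constant term is
  injective. This makes pole expansions unique.\<close>

lemma poly_T_eq_0_iff: "poly_T p = 0 \<longleftrightarrow> p = 0"
proof -
  have "poly_T p = 0 \<longleftrightarrow> fps_of_poly p = 0"
    unfolding poly_T_def using T_0 T_neq_0 by (simp add: fps_compose_eq_0_iff)
  thus ?thesis using fps_of_poly_eq_iff[of p 0] by simp
qed

text \<open>Pole order at most d at T = 1. The numerator may have any degree, so the remainder may
  contain nonnegative powers of 1 - T; these are the nonpositive indices of the theorem.\<close>

definition poles :: "nat \<Rightarrow> rat fps set" where
  "poles d = {poly_T p * U ^ d | p. True}"

lemma polesI: "f = poly_T p * U ^ d \<Longrightarrow> f \<in> poles d"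
  by (auto simp: poles_def)

lemma polesE: assumes "f \<in> poles d" obtains p where "f = poly_T p * U ^ d"
  using assms by (auto simp: poles_def)

lemma poles_mult: "f \<in> poles a \<Longrightarrow> g \<in> poles b \<Longrightarrow> f * g \<in> poles (a + b)"
proof (elim polesE)
  fix p q assume "f = poly_T p * U ^ a" "g = poly_T q * U ^ b"
  hence "f * g = poly_T (p * q) * U ^ (a + b)" by (simp add: poly_T_simps power_add mult_ac)
  thus ?thesis by (rule polesI)
qed

lemma poles_mono: assumes "f \<in> poles a" "a \<le> b" shows "f \<in> poles b"
proof -
  obtain p where "f = poly_T p * U ^ a" using assms(1) by (rule polesE)
  also have "\<dots> = poly_T (p * [:1, -1:] ^ (b - a)) * U ^ b"
    using U_power_cancel[of "b - a" b] assms(2) by (simp add: poly_T_simps mult.assoc)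
  finally show ?thesis by (rule polesI)
qed

lemma poles_add: "f \<in> poles d \<Longrightarrow> g \<in> poles d \<Longrightarrow> f + g \<in> poles d"
proof (elim polesE)
  fix p q assume "f = poly_T p * U ^ d" "g = poly_T q * U ^ d"
  hence "f + g = poly_T (p + q) * U ^ d" by (simp add: poly_T_simps distrib_right)
  thus ?thesis by (rule polesI)
qed

lemma poles_diff: "f \<in> poles d \<Longrightarrow> g \<in> poles d \<Longrightarrow> f - g \<in> poles d"
proof (elim polesE)
  fix p q assume "f = poly_T p * U ^ d" "g = poly_T q * U ^ d"
  hence "f - g = poly_T (p - q) * U ^ d" by (simp add: poly_T_simps left_diff_distrib)
  thus ?thesis by (rule polesI)
qed

lemma poles_U_power: "U ^ d \<in> poles d"
  by (rule polesI[of _ 1]) (simp add: poly_T_simps)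

lemma poles_T: "T \<in> poles 0"
  by (rule polesI[of _ "[:0, 1:]"]) (simp add: poly_T_simps)

lemma poles_const: "fps_const c \<in> poles 0"
  by (rule polesI[of _ "[:c:]"]) (simp add: poly_T_simps)

lemma poles_const_mult: "f \<in> poles d \<Longrightarrow> fps_const c * f \<in> poles d"
  using poles_mult[OF poles_const] by simp

lemma poles_of_nat_mult: "f \<in> poles d \<Longrightarrow> of_nat c * f \<in> poles d"
  unfolding fps_of_nat[symmetric] by (rule poles_const_mult)

lemma poles_0: "0 \<in> poles d"
  by (rule polesI[of _ 0]) (simp add: poly_T_simps)

lemma poles_sum: "(\<And>i. i \<in> A \<Longrightarrow> f i \<in> poles d) \<Longrightarrow> sum f A \<in> poles d"
  by (induction A rule: infinite_finite_induct) (auto intro: poles_0 poles_add)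

lemma poles_T_mult: "f \<in> poles d \<Longrightarrow> T * f \<in> poles d"
  using poles_mult[OF poles_T] by simp

lemma poles_divide: "(1 - T) * f \<in> poles d \<Longrightarrow> f \<in> poles (Suc d)"
proof -
  assume "(1 - T) * f \<in> poles d"
  hence "((1 - T) * f) * U ^ 1 \<in> poles (d + 1)" by (rule poles_mult[OF _ poles_U_power])
  moreover have "((1 - T) * f) * U ^ 1 = (1 - T) * U * f" by (simp add: mult_ac)
  ultimately show ?thesis by (simp only: U_inverse) simp
qed

lemma poles_one_minus_T_mult: "f \<in> poles (Suc d) \<Longrightarrow> (1 - T) * f \<in> poles d"
proof (elim polesE)
  fix p assume "f = poly_T p * U ^ Suc d"
  hence "(1 - T) * f = poly_T p * U ^ d"
    using U_power_cancel[of 1 "Suc d"] by (simp add: mult_ac)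
  thus ?thesis by (rule polesI)
qed

lemma poles_of_nat_cancel:
  assumes "of_nat c * f \<in> poles d" "c > 0" shows "f \<in> poles d"
proof -
  have "fps_const (1 / of_nat c) * (of_nat c * f) = f"
    using assms(2) by (simp add: fps_of_nat[symmetric] mult.assoc[symmetric])
  thus ?thesis using poles_const_mult[OF assms(1), of "1 / of_nat c"] by (simp only:)
qed

text \<open>The coefficient is the value of the numerator at T = 1; what remains of the numerator is
  divisible by 1 - T.\<close>

lemma poles_lead:
  assumes "f \<in> poles (Suc d)" shows "\<exists>a. f - fps_const a * U ^ Suc d \<in> poles d"
proof -
  obtain p where f: "f = poly_T p * U ^ Suc d" using assms by (rule polesE)
  have "poly (p - [:poly p 1:]) 1 = 0" by simp
  hence "[:-1, 1:] dvd p - [:poly p 1:]" by (simp only: poly_eq_0_iff_dvd)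
  then obtain q where "p - [:poly p 1:] = [:-1, 1:] * q" by (elim dvdE)
  also have "\<dots> = [:1, -1:] * (- q)" by simp
  finally have "poly_T p - fps_const (poly p 1) = (1 - T) * poly_T (- q)"
    by (simp only: poly_T_simps flip: poly_T_simps(2,4))
  hence "f - fps_const (poly p 1) * U ^ Suc d = poly_T (- q) * ((1 - T) * U ^ Suc d)"
    unfolding f left_diff_distrib[symmetric] by (simp add: mult_ac)
  also have "(1 - T) * U ^ Suc d = U ^ d" using U_power_cancel[of 1 "Suc d"] by simp
  finally show ?thesis by (metis polesI)
qed

text \<open>Clearing denominators gives an identity of polynomials in T, which is evaluated at T =
  1.\<close>

lemma poles_lead_unique:
  assumes "fps_const a * U ^ Suc d \<in> poles d" shows "a = 0"
proof -
  obtain p where "fps_const a * U ^ Suc d = poly_T p * U ^ d" using assms by (rule polesE)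
  hence "(1 - T) ^ Suc d * (fps_const a * U ^ Suc d) = (1 - T) ^ Suc d * (poly_T p * U ^ d)" by simp
  also have "\<dots> = (1 - T) * poly_T p * ((1 - T) ^ d * U ^ d)" by (simp add: mult_ac)
  finally have "fps_const a = (1 - T) * poly_T p"
    using U_power_cancel[of d d] U_power_cancel[of "Suc d" "Suc d"] by (simp only: mult.left_commute[of _ "fps_const a"]) simp
  hence "poly_T ([:a:] - [:1, -1:] * p) = 0" by (simp only: poly_T_simps) simp
  hence "[:a:] - [:1, -1:] * p = 0" by (simp only: poly_T_eq_0_iff)
  hence "poly ([:a:] - [:1, -1:] * p) 1 = 0" by simp
  thus ?thesis by simp
qed

text \<open>The index \<open>d\<close> bounds the remainder; the pole order itself is \<open>d + 2\<close>.\<close>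

definition leading :: "nat \<Rightarrow> rat \<Rightarrow> rat \<Rightarrow> rat fps \<Rightarrow> bool" where
  "leading d a b f \<longleftrightarrow> f - (fps_const a * U ^ (d + 2) + fps_const b * U ^ (d + 1)) \<in> poles d"

lemma leading_exists: assumes "f \<in> poles (d + 2)" shows "\<exists>a b. leading d a b f"
proof -
  obtain a where "f - fps_const a * U ^ (d + 2) \<in> poles (Suc d)" using poles_lead[of f "Suc d"] assms by auto
  from poles_lead[OF this] show ?thesis by (auto simp: leading_def diff_diff_eq)
qed

lemma leading_0: "f \<in> poles d \<Longrightarrow> leading d 0 0 f" by (simp add: leading_def)

lemma leading_add: "leading d a b f \<Longrightarrow> leading d a' b' g \<Longrightarrow> leading d (a + a') (b + b') (f + g)"
  unfolding leading_def by (drule (1) poles_add) (simp add: algebra_simps flip: fps_const_add)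

lemma leading_diff: "leading d a b f \<Longrightarrow> leading d a' b' g \<Longrightarrow> leading d (a - a') (b - b') (f - g)"
  unfolding leading_def by (drule (1) poles_diff) (simp add: algebra_simps flip: fps_const_sub)

lemma leading_const_mult: "leading d a b f \<Longrightarrow> leading d (c * a) (c * b) (fps_const c * f)"
  unfolding leading_def by (drule poles_const_mult[of _ _ c]) (simp add: algebra_simps flip: fps_const_mult)

lemma leading_sum: "(\<And>i. i \<in> A \<Longrightarrow> leading d (a i) (b i) (f i)) \<Longrightarrow> leading d (sum a A) (sum b A) (sum f A)"
  by (induction A rule: infinite_finite_induct) (auto intro: leading_add simp: leading_0 poles_0)

lemma leading_unique: assumes "leading d a b f" "leading d a' b' f" shows "a = a' \<and> b = b'"
proof -
  have t: "leading d (a - a') (b - b') 0" using leading_diff[OF assms] by simp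
  hence *: "- (fps_const (a - a') * U ^ (d + 2) + fps_const (b - b') * U ^ (d + 1)) \<in> poles d"
    by (simp add: leading_def)
  have "fps_const (-(a - a')) * U ^ Suc (Suc d)
      = - (fps_const (a - a') * U ^ (d + 2) + fps_const (b - b') * U ^ (d + 1)) + fps_const (b - b') * U ^ Suc d"
    by (simp add: algebra_simps flip: fps_const_neg fps_const_sub)
  also have "\<dots> \<in> poles (Suc d)"
    using * by (intro poles_add poles_const_mult poles_U_power) (auto elim: poles_mono)
  finally have a: "a = a'" using poles_lead_unique by fastforce
  have "fps_const (- (b - b')) * U ^ Suc d = - (fps_const (a - a') * U ^ (d + 2) + fps_const (b - b') * U ^ (d + 1))"
    using a by (simp add: algebra_simps flip: fps_const_neg fps_const_sub)
  with * have "fps_const (- (b - b')) * U ^ Suc d \<in> poles d" by simp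
  hence "b = b'" using poles_lead_unique by fastforce
  with a show ?thesis by simp
qed

lemma leading_shift: "leading d a b f \<Longrightarrow> leading (Suc d) 0 a f"
proof -
  assume t: "leading d a b f"
  have "f - fps_const a * U ^ (d + 2) =
     (f - (fps_const a * U ^ (d + 2) + fps_const b * U ^ (d + 1))) + fps_const b * U ^ Suc d" by simp
  also have "\<dots> \<in> poles (Suc d)"
    using t unfolding leading_def by (intro poles_add poles_const_mult poles_U_power) (auto elim: poles_mono)
  finally show ?thesis by (simp add: leading_def)
qed

lemma leading_poles: "leading d a b f \<Longrightarrow> f \<in> poles (d + 2)"
proof -
  assume t: "leading d a b f"
  have "f = (f - (fps_const a * U ^ (d + 2) + fps_const b * U ^ (d + 1)))
      + (fps_const a * U ^ (d + 2) + fps_const b * U ^ (d + 1))" by simp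
  also have "\<dots> \<in> poles (d + 2)"
  proof (intro poles_add poles_const_mult poles_U_power)
    show "U ^ (d + 1) \<in> poles (d + 2)" by (rule poles_mono[OF poles_U_power]) simp
  qed (use t poles_mono in \<open>auto simp: leading_def\<close>)
  finally show ?thesis .
qed

lemma leading_mult:
  assumes "leading d a b f" "leading e a' b' g"
  shows "leading (d + e + 2) (a * a') (a * b' + b * a') (f * g)"
proof -
  define r where "r = f - (fps_const a * U ^ (d + 2) + fps_const b * U ^ (d + 1))"
  define s where "s = g - (fps_const a' * U ^ (e + 2) + fps_const b' * U ^ (e + 1))"
  have r: "r \<in> poles d" and s: "s \<in> poles e" using assms by (simp_all add: leading_def r_def s_def)
  have f: "f = (fps_const a * U ^ (d + 2) + fps_const b * U ^ (d + 1)) + r" by (simp add: r_def)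
  have g: "g = (fps_const a' * U ^ (e + 2) + fps_const b' * U ^ (e + 1)) + s" by (simp add: s_def)
  have "f * g - (fps_const (a * a') * U ^ (d + e + 4) + fps_const (a * b' + b * a') * U ^ (d + e + 3))
    = fps_const (b * b') * U ^ (d + e + 2) + r * g + (f - r) * s"
    unfolding f g by (simp add: algebra_simps power_add flip: fps_const_add fps_const_mult)
       (simp add: numeral_eq_Suc algebra_simps)
  also have "\<dots> \<in> poles (d + e + 2)"
  proof (intro poles_add)
    show "fps_const (b * b') * U ^ (d + e + 2) \<in> poles (d + e + 2)"
      by (intro poles_const_mult poles_U_power)
    show "r * g \<in> poles (d + e + 2)"
      using poles_mult[OF r leading_poles[OF assms(2)]] by (simp add: add_ac)
    have "f - r \<in> poles (d + 2)" using leading_poles[OF assms(1)] poles_mono[OF r] by (intro poles_diff) auto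
    from poles_mult[OF this s] show "(f - r) * s \<in> poles (d + e + 2)" by (simp add: add_ac)
  qed
  finally show ?thesis by (simp add: leading_def add_ac numeral_eq_Suc)
qed

lemma leading_one_minus_T_mult:
  assumes "leading (Suc d) a b f" shows "leading d a b ((1 - T) * f)"
proof -
  have "(1 - T) * (f - (fps_const a * U ^ (Suc d + 2) + fps_const b * U ^ (Suc d + 1))) \<in> poles d"
    using assms unfolding leading_def by (rule poles_one_minus_T_mult)
  also have "(1 - T) * (f - (fps_const a * U ^ (Suc d + 2) + fps_const b * U ^ (Suc d + 1)))
    = (1 - T) * f - (fps_const a * ((1 - T) ^ 1 * U ^ (Suc d + 2)) + fps_const b * ((1 - T) ^ 1 * U ^ (Suc d + 1)))"
    by (simp only: right_diff_distrib distrib_left power_one_right mult.left_commute)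
  also have "(1 - T) ^ 1 * U ^ (Suc d + 2) = U ^ (d + 2)"
    by (subst U_power_cancel; simp)
  also have "(1 - T) ^ 1 * U ^ (Suc d + 1) = U ^ (d + 1)"
    by (subst U_power_cancel; simp)
  finally show ?thesis by (simp only: leading_def)
qed

section \<open>Pole orders of the excess series\<close>

context perturbed_graphs
begin

text \<open>T = z q with q the exponential of T, hence theta T = T + T theta T.\<close>

lemma theta_T: "theta T = T * U"
proof -
  let ?q = "wcoeff 0 Q'"
  have T: "T = fps_X * ?q"
    using theta_W[of 0] unfolding y_def Y'_1 theta_W_0 by (simp add: wcoeff_X_mult)
  have "theta ?q = ?q * theta (E 0)"
    using arg_cong[OF theta_Q', of "wcoeff 0"] by (simp add: wcoeff_theta wcoeff_mult E_def)
  also have "E 0 = T" by (simp add: E_eq choose_op_1 theta_W_0)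
  finally have q: "theta ?q = ?q * theta T" .
  have "theta fps_X = (fps_X :: rat fps)" by (simp add: theta_altdef)
  hence "theta (fps_X * ?q) = fps_X * ?q + fps_X * ?q * theta T"
    by (simp add: theta_mult q mult.assoc)
  hence "(1 - T) * theta T = T" unfolding T[symmetric] by (simp add: algebra_simps)
  hence "U * ((1 - T) * theta T) = U * T" by simp
  moreover have "U * ((1 - T) * theta T) = (1 - T) * U * theta T" by (simp only: mult_ac)
  ultimately show ?thesis by (simp only: U_inverse) (simp add: mult.commute)
qed

lemma theta_U: "theta U = T * U ^ 3"
proof -
  have "theta ((1 - T) * U) = 0" unfolding U_inverse by (simp add: fps_eq_iff)
  moreover have "theta (1 - T) = - (T * U)"
    unfolding theta_diff theta_T by (simp add: theta_altdef)
  ultimately have "(1 - T) * theta U = T * U * U"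
    by (simp add: theta_mult add_eq_0_iff)
  hence "U * ((1 - T) * theta U) = U * (T * U * U)" by simp
  moreover have "U * ((1 - T) * theta U) = (1 - T) * U * theta U" by (simp only: mult_ac)
  ultimately show ?thesis by (simp only: U_inverse) (simp add: numeral_eq_Suc mult_ac)
qed

lemma theta_U_power: "theta (U ^ d) = of_nat d * T * U ^ (d + 2)"
proof (induction d)
  case (Suc d)
  thus ?case by (simp add: theta_mult theta_U algebra_simps numeral_eq_Suc)
qed (simp add: fps_eq_iff)

lemma theta_poly_T: "theta (poly_T p) = poly_T (pderiv p) * (T * U)"
  by (simp add: poly_T_def theta_compose T_0 fps_of_poly_pderiv theta_T)

lemma poles_theta: assumes "f \<in> poles d" shows "theta f \<in> poles (d + 2)"
proof -
  obtain p where f: "f = poly_T p * U ^ d" using assms by (rule polesE)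
  have "theta f = poly_T (pderiv p * [:0, 1:]) * U ^ Suc d + of_nat d * (poly_T (p * [:0, 1:]) * U ^ (d + 2))"
    unfolding f theta_mult theta_poly_T theta_U_power poly_T_simps(3,5) by (simp add: mult_ac)
  also have "\<dots> \<in> poles (d + 2)"
  proof (intro poles_add poles_of_nat_mult)
    show "poly_T (pderiv p * [:0, 1:]) * U ^ Suc d \<in> poles (d + 2)"
      by (rule poles_mono[OF polesI[OF refl]]) simp
  qed (rule polesI[OF refl])
  finally show ?thesis .
qed

lemma poles_choose_op:
  assumes "choose_op a f \<in> poles d" shows "choose_op (a + r) f \<in> poles (d + 2 * r)"
proof (induction r)
  case (Suc r)
  have "theta (choose_op (a + r) f) - of_nat (a + r) * choose_op (a + r) f \<in> poles (d + 2 * Suc r)"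
    using poles_theta[OF Suc] poles_of_nat_mult[OF poles_mono[OF Suc, of "d + 2 * Suc r"]]
    by (intro poles_diff) (simp_all del: of_nat_add)
  hence "of_nat (Suc (a + r)) * choose_op (Suc (a + r)) f \<in> poles (d + 2 * Suc r)"
    unfolding choose_op_Suc .
  from poles_of_nat_cancel[OF this] show ?case by simp
qed (use assms in simp)

text \<open>Two orders for each \<open>theta\<close> would give 2 r. One order is saved because
  \<open>theta T\<close> = T U has a simple pole only; \<open>E_poles\<close> relies on this at p =
  1. For r = 0 the truncated difference is 0, as it should be for T.\<close>

lemma choose_op_W_0: "choose_op (Suc r) (W 0) \<in> poles (2 * r - 1)"
proof (cases r)
  case 0
  thus ?thesis using poles_T by (simp add: choose_op_1 theta_W_0)
next
  case (Suc r')
  have "T * U - T \<in> poles 1"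
    using poles_U_power[of 1] by (intro poles_diff poles_T_mult poles_mono[OF poles_T]) simp_all
  hence "of_nat (Suc 1) * choose_op (Suc 1) (W 0) \<in> poles 1"
    unfolding choose_op_Suc by (simp add: choose_op_1 theta_W_0 theta_T)
  hence "choose_op 2 (W 0) \<in> poles 1"
    using poles_of_nat_cancel[of "Suc 1"] by (simp add: numeral_2_eq_2)
  from poles_choose_op[OF this, of r'] show ?thesis by (simp add: Suc)
qed

text \<open>Lowering the excess by r costs 3 r orders while r further applications of
  \<open>theta\<close> regain only 2 r, so all terms with r \<ge> 1 lie below the top order.\<close>

lemma E_poles:
  assumes "\<And>j. 1 \<le> j \<Longrightarrow> j < p \<Longrightarrow> theta (W j) \<in> poles (3 * j - 1)" "p \<ge> 1"
  shows "E p - theta (W p) \<in> poles (3 * p - 2)"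
proof -
  have "E p = (\<Sum>r=0..p. choose_op (Suc r) (W (p - r)))" by (simp add: E_eq atMost_atLeast0)
  hence "E p - theta (W p) = (\<Sum>r=1..p. choose_op (Suc r) (W (p - r)))"
    by (simp add: sum.atLeast_Suc_atMost[of 0 p] choose_op_1)
  also have "\<dots> \<in> poles (3 * p - 2)"
  proof (rule poles_sum)
    fix r assume r: "r \<in> {1..p}"
    show "choose_op (Suc r) (W (p - r)) \<in> poles (3 * p - 2)"
    proof (cases "r = p")
      case True
      thus ?thesis using choose_op_W_0[of p] assms(2) by (auto elim: poles_mono)
    next
      case False
      have "choose_op 1 (W (p - r)) \<in> poles (3 * (p - r) - 1)"
      proof -
        have "1 \<le> p - r" "p - r < p" using r False by auto
        thus ?thesis using assms(1) by (simp add: choose_op_1)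
      qed
      from poles_choose_op[OF this, of r] have "choose_op (Suc r) (W (p - r)) \<in> poles (3 * (p - r) - 1 + 2 * r)"
        by simp
      thus ?thesis by (rule poles_mono) (use r False in auto)
    qed
  qed
  finally show ?thesis .
qed

lemma y_1_0: "y 1 0 = T"
  using theta_W[of 0] by (simp add: theta_W_0)

lemma y_m_0: "y m 0 = T ^ m"
proof (induction m)
  case (Suc m)
  thus ?case unfolding y_Suc[of m] by (simp add: y_1_0 choose_op_0 del: One_nat_def)
qed (simp add: y_0)

text \<open>The bound for a vanishing index is that of a polynomial in \<open>T\<close>, as \<open>3 * 0 - 1 = 0\<close>.\<close>

lemma y_poles:
  assumes "\<And>j. 1 \<le> j \<Longrightarrow> j \<le> n \<Longrightarrow> theta (W j) \<in> poles (3 * j - 1)" "p \<le> n"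
  shows "y m p \<in> poles (3 * p - 1)"
proof -
  have E: "E s \<in> poles (3 * s - 1)" if "1 \<le> s" "s \<le> n" for s
  proof -
    have "E s - theta (W s) \<in> poles (3 * s - 2)"
      using that assms(1) by (intro E_poles) auto
    hence "E s - theta (W s) + theta (W s) \<in> poles (3 * s - 1)"
      using assms(1)[of s] that by (intro poles_add) (auto elim: poles_mono)
    thus ?thesis by simp
  qed
  have y1: "y 1 p \<in> poles (3 * p - 1)" if "p \<le> n" for p
    using that
  proof (induction p rule: less_induct)
    case (less p)
    show ?case
    proof (cases p)
      case 0
      thus ?thesis using poles_T by (simp add: y_1_0[simplified])
    next
      case (Suc q)
      have "of_nat (Suc q) * y 1 (Suc q) \<in> poles (3 * p - 1)"
        unfolding y_1_rec
      proof (rule poles_sum)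
        fix i assume i: "i \<in> {..q}"
        have "y 1 i * (of_nat (Suc (q - i)) * E (Suc (q - i))) \<in> poles ((3 * i - 1) + (3 * Suc (q - i) - 1))"
          using i less Suc by (intro poles_mult poles_of_nat_mult E) auto
        thus "y 1 i * (of_nat (Suc (q - i)) * E (Suc (q - i))) \<in> poles (3 * p - 1)"
          by (rule poles_mono) (use i Suc in auto)
      qed
      thus ?thesis using poles_of_nat_cancel[of "Suc q"] Suc by simp
    qed
  qed
  show ?thesis using assms(2)
  proof (induction m arbitrary: p)
    case 0
    show ?case using poles_const[of 1] by (auto simp: y_0 poles_0)
  next
    case (Suc m)
    show ?case unfolding y_Suc
    proof (rule poles_sum)
      fix i assume i: "i \<in> {..p}"
      have "(\<Sum>r\<le>p - i. choose_op r (y m (p - i - r))) \<in> poles (3 * (p - i) - 1)"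
      proof (rule poles_sum)
        fix r assume r: "r \<in> {..p - i}"
        have "choose_op 0 (y m (p - i - r)) \<in> poles (3 * (p - i - r) - 1)"
          using Suc by (simp add: choose_op_0)
        from poles_choose_op[OF this, of r]
        show "choose_op r (y m (p - i - r)) \<in> poles (3 * (p - i) - 1)"
          unfolding add_0_left by (rule poles_mono) (use r in auto)
      qed
      with y1[of i] have "y 1 i * (\<Sum>r\<le>p - i. choose_op r (y m (p - i - r))) \<in> poles ((3 * i - 1) + (3 * (p - i) - 1))"
        using i Suc.prems by (intro poles_mult) auto
      thus "y 1 i * (\<Sum>r\<le>p - i. choose_op r (y m (p - i - r))) \<in> poles (3 * p - 1)"
        by (rule poles_mono) (use i in auto)
    qed
  qed
qed

text \<open>In the vertex equation the unknown \<open>theta (W p)\<close> occurs on the right only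
  as T \<open>theta (W p)\<close>, inside \<open>y 1 p\<close>. Moved to the left it gives (1 - T)
  \<open>theta (W p)\<close>, all other terms have order at most 3 p - 2, and dividing by 1 - T
  costs one more order.\<close>

lemma theta_W_poles: "p \<ge> 1 \<Longrightarrow> theta (W p) \<in> poles (3 * p - 1)"
proof (induction p rule: less_induct)
  case (less p)
  obtain n where p: "p = Suc n" using less.prems by (cases p) auto
  have y: "y m q \<in> poles (3 * q - 1)" if "q \<le> n" for m q
    using less.IH p that by (intro y_poles[of n]) auto
  have E: "E s \<in> poles (3 * s - 1)" if "1 \<le> s" "s \<le> n" for s
  proof -
    have "E s - theta (W s) \<in> poles (3 * s - 2)"
      using that less.IH p by (intro E_poles) auto
    hence "E s - theta (W s) + theta (W s) \<in> poles (3 * s - 1)"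
      using less.IH[of s] that p by (intro poles_add) (auto elim: poles_mono)
    thus ?thesis by simp
  qed
  \<comment> \<open>The term i = 0 of \<open>y_1_rec\<close> is T p \<open>E p\<close>, and
    \<open>E p\<close> agrees with \<open>theta (W p)\<close> up to lower order; the other terms
    involve smaller indices only.\<close>
  have lower: "y 1 p - T * theta (W p) \<in> poles (3 * p - 2)"
  proof -
    have "of_nat p * y 1 p = (\<Sum>i=0..n. y 1 i * (of_nat (Suc (n - i)) * E (Suc (n - i))))"
      unfolding p y_1_rec by (simp add: atMost_atLeast0)
    also have "\<dots> = T * (of_nat p * E p) + (\<Sum>i=1..n. y 1 i * (of_nat (Suc (n - i)) * E (Suc (n - i))))"
      by (subst sum.atLeast_Suc_atMost) (simp_all add: y_1_0[simplified] p)
    finally have "of_nat p * (y 1 p - T * theta (W p)) = T * (of_nat p * (E p - theta (W p)))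
        + (\<Sum>i=1..n. y 1 i * (of_nat (Suc (n - i)) * E (Suc (n - i))))"
      by (simp add: algebra_simps)
    also have "\<dots> \<in> poles (3 * p - 2)"
    proof (intro poles_add poles_T_mult poles_of_nat_mult poles_sum)
      show "E p - theta (W p) \<in> poles (3 * p - 2)" using less by (intro E_poles) auto
      fix i assume i: "i \<in> {1..n}"
      have "y 1 i * (of_nat (Suc (n - i)) * E (Suc (n - i))) \<in> poles ((3 * i - 1) + (3 * Suc (n - i) - 1))"
        using i by (intro poles_mult poles_of_nat_mult E y) auto
      thus "y 1 i * (of_nat (Suc (n - i)) * E (Suc (n - i))) \<in> poles (3 * p - 2)"
        by (rule poles_mono) (use i p in auto)
    qed
    finally show ?thesis by (rule poles_of_nat_cancel) (use p in simp)
  qed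
  have "(1 - T) * theta (W p) = (y 1 p - T * theta (W p)) +
      (\<Sum>i=1..p. \<Sum>m\<le>2*i+1. fps_const (of_nat m * Phi' $ m $ i) * y m (p - i))"
    using theta_W[of p] by (simp add: algebra_simps)
  also have "\<dots> \<in> poles (3 * p - 2)"
  proof (intro poles_add lower poles_sum poles_const_mult)
    fix i m assume i: "i \<in> {1..p}"
    have "y m (p - i) \<in> poles (3 * (p - i) - 1)" using i p by (intro y) auto
    thus "y m (p - i) \<in> poles (3 * p - 2)" by (rule poles_mono) (use i in auto)
  qed
  finally have "theta (W p) \<in> poles (Suc (3 * p - 2))" by (rule poles_divide)
  thus ?case using p by simp
qed

text \<open>The sum in \<open>D_eq\<close> starts at i = 1, so the triples reach only strictly
  smaller excess. This is why they do not disturb the leading terms of the edge equation from excess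
  1 on.\<close>

lemma D_poles: "D (Suc p) \<in> poles (3 * p - 1)"
  unfolding D_eq
proof (intro poles_sum poles_const_mult)
  fix i m assume i: "i \<in> {1..Suc p}"
  have "y m (Suc p - i) \<in> poles (3 * (Suc p - i) - 1)" using theta_W_poles by (intro y_poles) auto
  thus "y m (Suc p - i) \<in> poles (3 * p - 1)" by (rule poles_mono) (use i in auto)
qed

lemma D_0: "D 0 = 0" by (simp add: D_eq)

text \<open>Only the single triangle, with i = 1 and m = 3, survives: (1 + 3 - 1) times
  -1/6.\<close>

lemma D_1: "D 1 = fps_const (- 1 / 2) * T ^ 3"
proof -
  have "{..3::nat} = {0, 1, 2, 3}" by auto
  moreover have "Phi' $ 1 $ 1 = 0" "Phi' $ 2 $ 1 = 0" "Phi' $ 3 $ 1 = - 1 / 6"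
    using Phi1 Phi2 Phi3 by (simp_all add: Phi'_nth eval_nat_numeral)
  ultimately show ?thesis by (simp add: D_eq Phi'_nth[of 0] y_m_0)
qed

lemma W_0: "2 * W 0 = 2 * T - T * T"
  using edge_equation_0 by (simp add: theta_W_0 D_0 algebra_simps)

end

section \<open>The two leading coefficients\<close>

lemma T_U_power: "T * U ^ Suc n = U ^ Suc n - U ^ n"
proof -
  have "T * U ^ Suc n = T * U * U ^ n" by (simp only: power_Suc mult.assoc)
  thus ?thesis unfolding T_U by (simp add: left_diff_distrib)
qed

lemma leading_of_nat_mult: "leading d a b f \<Longrightarrow> leading d (of_nat c * a) (of_nat c * b) (of_nat c * f)"
  unfolding fps_of_nat[symmetric] by (rule leading_const_mult)

lemma leading_two_mult: "leading d a b f \<Longrightarrow> leading d (2 * a) (2 * b) (2 * f)"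
  using leading_of_nat_mult[of d a b f 2] by simp

lemma sum_reflect:
  fixes f :: "nat \<Rightarrow> 'a :: comm_monoid_add"
  shows "(\<Sum>t=1..k-1. f (k - t)) = (\<Sum>t=1..k-1. f t)"
  by (rule sum.reindex_bij_witness[of _ "\<lambda>t. k - t" "\<lambda>t. k - t"]) auto

text \<open>The edge equation yields a recurrence for c' alone, whereas c' is defined through c.
  Subtracting Wright's recurrence leaves a linear one for d = c' - c, to be checked for d_{k+1} =
  (3/2) k b_k and d_1 = 1/4; it reduces to the recurrence for b.\<close>

lemma wright_c'_minus_c_rec:
  assumes "k \<ge> 1"
  shows "2 * (3 * of_nat k + 2) * (wright_c' (k + 1) - wright_c (k + 1)) =
    3 * of_nat k * wright_b k + (3 * of_nat k + 2) * (3 * of_nat k - 1) * (wright_c' k - wright_c k)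
    + 6 * (\<Sum>t=1..k-1. of_nat t * (3 * of_nat k - 3 * of_nat t - 1) * wright_b t * (wright_c' (k - t) - wright_c (k - t)))"
proof (cases "k = 1")
  case True
  have "wright_c' (1 + 1) - wright_c (1 + 1) = 3 / 2 * wright_b 1"
    using wright_c'_rec[of 1] by simp
  thus ?thesis unfolding True by simp
next
  case False
  then obtain n where k: "k = Suc n" "n \<ge> 1" using assms by (cases k) auto
  define b where "b = wright_b"
  define d where "d j = wright_c' j - wright_c j" for j
  have d1: "d 1 = 1 / 4" by (simp add: d_def)
  have dS: "d (Suc j) = 3 / 2 * of_nat j * b j" if "j \<ge> 1" for j
    using wright_c'_rec[OF that] by (simp add: d_def b_def)
  define S where "S = (\<Sum>t=1..n-1. of_nat t * of_nat (n - t) * b t * b (n - t))"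
  define R where "R = (\<Sum>t=1..n-1. (3 * of_nat (n - t) + 2) * (of_nat t * of_nat (n - t) * b t * b (n - t)))"
  have brec: "2 * (of_nat n + 1) * b k = 3 * of_nat n * (of_nat n + 1) * b n + 3 * S"
    using wright_b_rec[OF k(2)] by (simp add: k b_def S_def)
  \<comment> \<open>The term t = k - 1 is split off because it contains d 1 = 1/4, which does not
    follow the pattern of \<open>dS\<close>.\<close>
  have "(\<Sum>t=1..k-1. of_nat t * (3 * of_nat k - 3 * of_nat t - 1) * b t * d (k - t))
      = of_nat n * 2 * b n * d 1
        + (\<Sum>t=1..n-1. of_nat t * (3 * of_nat k - 3 * of_nat t - 1) * b t * d (k - t))"
    using k by (cases n) (simp_all add: Suc_diff_le)
  also have "(\<Sum>t=1..n-1. of_nat t * (3 * of_nat k - 3 * of_nat t - 1) * b t * d (k - t)) = 3 / 2 * R"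
    unfolding R_def sum_distrib_left
  proof (rule sum.cong[OF refl])
    fix t assume t: "t \<in> {1..n-1}"
    have "k - t = Suc (n - t)" using t k by auto
    hence "d (k - t) = 3 / 2 * of_nat (n - t) * b (n - t)" using dS[of "n - t"] t by auto
    moreover have "k = t + (n - t) + 1" using t k by auto
    hence "(of_nat k :: rat) = of_nat t + of_nat (n - t) + 1" by (metis of_nat_add of_nat_1)
    ultimately show "of_nat t * (3 * of_nat k - 3 * of_nat t - 1) * b t * d (k - t)
      = 3 / 2 * ((3 * of_nat (n - t) + 2) * (of_nat t * of_nat (n - t) * b t * b (n - t)))"
      by (simp add: algebra_simps)
  qed
  finally have sum: "(\<Sum>t=1..k-1. of_nat t * (3 * of_nat k - 3 * of_nat t - 1) * b t * d (k - t))
      = of_nat n * b n / 2 + 3 / 2 * R" unfolding d1 by simp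
  have "R = (\<Sum>t=1..n-1. (3 * of_nat t + 2) * (of_nat t * of_nat (n - t) * b t * b (n - t)))" (is "_ = ?R'")
  proof -
    have "?R' = (\<Sum>t=1..n-1. (3 * of_nat (n - t) + 2) * (of_nat (n - t) * of_nat (n - (n - t)) * b (n - t) * b (n - (n - t))))"
      by (rule sum_reflect[symmetric])
    also have "\<dots> = R" unfolding R_def by (rule sum.cong) (auto simp: mult_ac)
    finally show ?thesis ..
  qed
  \<comment> \<open>Averaging with the reflected sum replaces the weight 3 (n - t) + 2 by the
    constant (3 n + 4) / 2, so the sum becomes the convolution S in the recurrence for b.\<close>
  hence "2 * R = R + ?R'" by simp
  also have "\<dots> = (\<Sum>t=1..n-1. (3 * of_nat n + 4) * (of_nat t * of_nat (n - t) * b t * b (n - t)))"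
    unfolding R_def sum.distrib[symmetric]
  proof (rule sum.cong[OF refl])
    fix t assume t: "t \<in> {1..n-1}"
    have "n = t + (n - t)" using t by auto
    hence "(of_nat n :: rat) = of_nat t + of_nat (n - t)" by (metis of_nat_add)
    hence "(3 * of_nat (n - t) + 2) + (3 * of_nat t + 2) = (3 * of_nat n + 4 :: rat)" by linarith
    thus "(3 * of_nat (n - t) + 2) * (of_nat t * of_nat (n - t) * b t * b (n - t)) +
         (3 * of_nat t + 2) * (of_nat t * of_nat (n - t) * b t * b (n - t)) =
         (3 * of_nat n + 4) * (of_nat t * of_nat (n - t) * b t * b (n - t))"
      by (simp only: distrib_right[symmetric])
  qed
  also have "\<dots> = (3 * of_nat n + 4) * S" by (simp only: S_def sum_distrib_left)
  finally have R: "R = (3 * of_nat n + 4) * S / 2" by simp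
  have S: "S = (2 * (of_nat n + 1) * b k - 3 * of_nat n * (of_nat n + 1) * b n) / 3" using brec by simp
  have dk: "d k = 3 / 2 * of_nat n * b n" and dk1: "d (k + 1) = 3 / 2 * of_nat k * b k"
    using dS[of n] dS[of k] k by simp_all
  have "2 * (3 * of_nat k + 2) * d (k + 1) = 3 * of_nat k * b k + (3 * of_nat k + 2) * (3 * of_nat k - 1) * d k
    + 6 * (of_nat n * b n / 2 + 3 / 2 * R)"
    unfolding dk dk1 R S unfolding k(1) by (simp add: field_simps)
  thus ?thesis unfolding sum[symmetric] by (simp only: d_def b_def)
qed

text \<open>The form in which the edge equation delivers the constants: Wright's recurrence with 6 k
  b_k in place of 3 k b_k.\<close>

lemma wright_c'_full_rec:
  assumes "k \<ge> 1"
  shows "2 * (3 * of_nat k + 2) * wright_c' (k + 1) =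
    8 * (of_nat k + 1) * wright_b (k + 1) + 6 * of_nat k * wright_b k
    + (3 * of_nat k + 2) * (3 * of_nat k - 1) * wright_c' k
    + 6 * (\<Sum>t=1..k-1. of_nat t * (3 * of_nat k - 3 * of_nat t - 1) * wright_b t * wright_c' (k - t))"
proof -
  have "(\<Sum>t=1..k-1. of_nat t * (3 * of_nat k - 3 * of_nat t - 1) * wright_b t * wright_c' (k - t))
    = (\<Sum>t=1..k-1. of_nat t * (3 * of_nat k - 3 * of_nat t - 1) * wright_b t * (wright_c' (k - t) - wright_c (k - t)))
    + (\<Sum>t=1..k-1. of_nat t * (3 * of_nat k - 3 * of_nat t - 1) * wright_b t * wright_c (k - t))"
    unfolding sum.distrib[symmetric] by (rule sum.cong) (simp_all add: right_diff_distrib)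
  thus ?thesis using wright_c'_minus_c_rec[OF assms] wright_c_rec[OF assms]
    by (simp only: right_diff_distrib distrib_left)
qed

context perturbed_graphs
begin

text \<open>As T = 1 - (1 - T), theta U^m = m (U^(m + 2) - U^(m + 1)). The second part of the top
  term accounts for -(d + 2) a.\<close>

lemma leading_theta:
  assumes "leading d a b f"
  shows "leading (d + 2) ((of_nat d + 2) * a) ((of_nat d + 1) * b - (of_nat d + 2) * a) (theta f)"
proof -
  define r where "r = f - (fps_const a * U ^ (d + 2) + fps_const b * U ^ (d + 1))"
  have r: "r \<in> poles d" using assms by (simp add: leading_def r_def)
  have f: "f = (fps_const a * U ^ (d + 2) + fps_const b * U ^ (d + 1)) + r" by (simp add: r_def)
  have "theta f = fps_const a * (of_nat (d + 2) * (T * U ^ Suc (d + 3))) + fps_const b * (of_nat (d + 1) * (T * U ^ Suc (d + 2))) + theta r"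
    unfolding f theta_add theta_const_mult theta_U_power by (simp add: mult.assoc numeral_eq_Suc)
  also have "\<dots> = fps_const ((of_nat d + 2) * a) * U ^ (d + 4) + fps_const ((of_nat d + 1) * b - (of_nat d + 2) * a) * U ^ (d + 3)
      + (theta r - fps_const ((of_nat d + 1) * b) * U ^ (d + 2))"
    unfolding T_U_power by (simp add: algebra_simps flip: fps_const_add fps_const_mult fps_const_sub fps_of_nat numeral_fps_const)
      (simp add: numeral_eq_Suc fps_const_mult[symmetric] algebra_simps)
  finally have "theta f - (fps_const ((of_nat d + 2) * a) * U ^ (d + 2 + 2)
      + fps_const ((of_nat d + 1) * b - (of_nat d + 2) * a) * U ^ (d + 2 + 1))
    = theta r - fps_const ((of_nat d + 1) * b) * U ^ (d + 2)"
    by (simp add: numeral_eq_Suc)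
  also have "\<dots> \<in> poles (d + 2)"
    using poles_theta[OF r] by (intro poles_diff poles_const_mult poles_U_power)
  finally show ?thesis by (simp only: leading_def)
qed

text \<open>Each of the two end terms of the convolution is T \<open>theta (W (Suc p))\<close>;
  moved to the left they produce the factor 1 - T.\<close>

lemma edge_equation':
  "2 * (of_nat p * W (Suc p)) + 2 * ((1 - T) * theta (W (Suc p))) =
    theta (theta (W p)) + (\<Sum>i=1..p. theta (W i) * theta (W (Suc p - i))) - 2 * theta (W p) - theta (W p)
    - 2 * (of_nat p * W p - W p) + 2 * D (Suc p) + 2 * D p"
proof -
  have "(\<Sum>i\<le>Suc p. theta (W i) * theta (W (Suc p - i)))
     = 2 * (T * theta (W (Suc p))) + (\<Sum>i=1..p. theta (W i) * theta (W (Suc p - i)))"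
    unfolding atMost_atLeast0
    by (simp add: sum.atLeast_Suc_atMost[of 0 p] theta_W_0)
  with edge_equation[of p] show ?thesis by (simp add: algebra_simps del: sum.cl_ivl_Suc)
qed

text \<open>With \<open>theta (W (Suc k))\<close> already bounded, the edge equation is solved for
  \<open>W (Suc k)\<close> by dividing by 2 k. This gives order 3 k + 1, one too many.\<close>

lemma W_poles: "k \<ge> 1 \<Longrightarrow> W (Suc k) \<in> poles (3 * k)"
proof (induction k rule: less_induct)
  case (less k)
  \<comment> \<open>P is (k - 1) \<open>W k\<close>. For k = 1 it vanishes, so that
    \<open>W 1\<close>, the series of excess 0 with its logarithm, never has to be bounded.\<close>
  define P where "P = of_nat k * W k - W k"
  have P: "P \<in> poles (3 * k + 1)"
  proof (cases "k = 1")
    case False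
    then obtain j where j: "k = Suc j" "j \<ge> 1" using less.prems by (cases k) auto
    have "W k \<in> poles (3 * j)" using less.IH[of j] j by simp
    hence "W k \<in> poles (3 * k + 1)" by (rule poles_mono) (use j in auto)
    thus ?thesis unfolding P_def by (intro poles_diff poles_of_nat_mult)
  qed (simp add: P_def poles_0)
  have th: "theta (W p) \<in> poles (3 * p - 1)" if "p \<ge> 1" for p using theta_W_poles that .
  have two: "f \<in> poles d \<Longrightarrow> 2 * f \<in> poles d" for f d
    using poles_of_nat_mult[of f d 2] by simp
  have "(1 - T) * theta (W (Suc k)) \<in> poles (3 * k + 1)"
    using th[of "Suc k"] by (intro poles_one_minus_T_mult) simp
  moreover have "2 * (of_nat k * W (Suc k)) + 2 * ((1 - T) * theta (W (Suc k))) \<in> poles (3 * k + 1)"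
    unfolding edge_equation' P_def[symmetric]
  proof (intro poles_add poles_diff two poles_sum P)
    show "theta (theta (W k)) \<in> poles (3 * k + 1)"
      by (rule poles_mono[OF poles_theta[OF th]]) (use less.prems in auto)
    show "theta (W k) \<in> poles (3 * k + 1)" "theta (W k) \<in> poles (3 * k + 1)"
      by (rule poles_mono[OF th]; use less.prems in simp)+
    fix i assume i: "i \<in> {1..k}"
    show "theta (W i) * theta (W (Suc k - i)) \<in> poles (3 * k + 1)"
      by (rule poles_mono[OF poles_mult[OF th th]]) (use i in auto)
  next
    show "D (Suc k) \<in> poles (3 * k + 1)" by (rule poles_mono[OF D_poles]) simp
    show "D k \<in> poles (3 * k + 1)"
      using less.prems by (cases k) (auto intro: poles_mono[OF D_poles])
  qed
  ultimately have "(2 * (of_nat k * W (Suc k)) + 2 * ((1 - T) * theta (W (Suc k)))) - 2 * ((1 - T) * theta (W (Suc k))) \<in> poles (3 * k + 1)"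
    by (intro poles_diff two)
  hence "of_nat (2 * k) * W (Suc k) \<in> poles (3 * k + 1)" by (simp add: mult.assoc)
  hence W: "W (Suc k) \<in> poles (Suc (3 * k))"
    using poles_of_nat_cancel[of "2 * k"] less.prems by simp
  from poles_lead[OF W] obtain a where a: "W (Suc k) - fps_const a * U ^ Suc (3 * k) \<in> poles (3 * k)" by auto
  \<comment> \<open>A term a U^(3 k + 1) would give \<open>theta (W (Suc k))\<close> a pole of order
    3 k + 3, but its order is at most 3 k + 2; hence a = 0.\<close>
  have "fps_const (a * of_nat (3 * k + 1)) * U ^ Suc (3 * k + 2)
     = theta (W (Suc k)) - theta (W (Suc k) - fps_const a * U ^ Suc (3 * k)) + fps_const (a * of_nat (3 * k + 1)) * U ^ (3 * k + 2)"
  proof -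
    have "theta (fps_const a * U ^ Suc (3 * k)) = fps_const (a * of_nat (3 * k + 1)) * (T * U ^ Suc (3 * k + 2))"
      unfolding theta_const_mult theta_U_power
      by (simp add: mult_ac flip: fps_const_mult fps_of_nat)
    also have "T * U ^ Suc (3 * k + 2) = U ^ Suc (3 * k + 2) - U ^ (3 * k + 2)" by (rule T_U_power)
    finally show ?thesis by (simp add: theta_diff algebra_simps)
  qed
  also have "\<dots> \<in> poles (3 * k + 2)"
    using th[of "Suc k"] poles_theta[OF a] by (intro poles_add poles_diff poles_const_mult poles_U_power) simp_all
  finally have "a * of_nat (3 * k + 1) = 0" by (rule poles_lead_unique)
  hence "a = 0" by (simp only: mult_eq_0_iff of_nat_eq_0_iff) simp
  with a show ?case by simp
qed

end

section \<open>Leading coefficients from the edge equation\<close>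

context perturbed_graphs
begin

text \<open>The edge equation at index 0 gives 2 (1 - T) \<open>theta (W 1)\<close> = T U - T - T^2
  - T^3, where T^3 stems from \<open>D 1\<close>. Without it the second coefficient would be
  -3/2.\<close>

lemma theta_W_1_leading: "leading 0 (1 / 2) (- 2) (theta (W 1))"
proof -
  have "2 * ((1 - T) * theta (W 1)) = theta T - T - T * T + 2 * D 1"
  proof -
    have "2 * ((1 - T) * theta (W 1)) = theta T - 3 * T + 2 * W 0 + 2 * D 1"
      using edge_equation'[of 0] by (simp add: theta_W_0 D_0)
    thus ?thesis unfolding W_0 by (simp add: algebra_simps)
  qed
  also have "\<dots> = T * U - T - T * T - T ^ 3"
    unfolding D_1 theta_T by (simp add: numeral_fps_const mult.assoc[symmetric] flip: fps_const_neg)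
  finally have "U * (2 * ((1 - T) * theta (W 1))) = U * (T * U - T - T * T - T ^ 3)" by simp
  moreover have "U * (2 * ((1 - T) * theta (W 1))) = (1 - T) * U * (2 * theta (W 1))" by (simp only: mult_ac)
  ultimately have "2 * theta (W 1) = T * U * U - (T * U) * (1 + T + T * T)"
    by (simp only: U_inverse) (simp add: algebra_simps numeral_eq_Suc)
  also have "\<dots> = U ^ 2 - U - (U - 1) * (1 + T + T * T)"
    unfolding T_U by (simp add: algebra_simps power2_eq_square)
  also have "\<dots> = U ^ 2 - 2 * U - T * U - (T * U) * T + 1 + T + T * T"
    by (simp add: algebra_simps)
  also have "\<dots> = U ^ 2 - 3 * U + 2 + T - (T * U) * T + T * T"
    unfolding T_U by (simp add: algebra_simps)
  also have "(T * U) * T = T * U - T"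
  proof -
    have "(T * U) * T = (U - 1) * T" by (simp only: T_U)
    thus ?thesis by (simp add: algebra_simps)
  qed
  also have "U ^ 2 - 3 * U + 2 + T - (T * U - T) + T * T = U ^ 2 - 3 * U + 2 + T - T * U + T + T * T"
    by simp
  also have "\<dots> = U ^ 2 - 4 * U + (3 + 2 * T + T * T)"
    unfolding T_U by (simp add: algebra_simps)
  finally have "fps_const (1 / 2) * (2 * theta (W 1)) = fps_const (1 / 2) * (U ^ 2 - 4 * U + (3 + 2 * T + T * T))" by simp
  hence eq: "theta (W 1) = fps_const (1 / 2) * U ^ 2 + fps_const (- 2) * U + fps_const (1 / 2) * (3 + 2 * T + T * T)"
    by (simp add: distrib_left right_diff_distrib numeral_fps_const mult.assoc[symmetric] flip: fps_const_neg del: One_nat_def)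
  have "3 + 2 * T + T * T = poly_T ([:3:] + [:2:] * [:0, 1:] + [:0, 1:] * [:0, 1:]) * U ^ 0"
    by (simp only: poly_T_simps numeral_fps_const power_0 mult_1_right)
  hence "3 + 2 * T + T * T \<in> poles 0" by (rule polesI)
  hence "fps_const (1 / 2) * (3 + 2 * T + T * T) \<in> poles 0" by (rule poles_const_mult)
  thus ?thesis unfolding leading_def eq by (simp add: numeral_2_eq_2)
qed

text \<open>The factor 1 - T lowers the order of \<open>theta (W (Suc N))\<close> to 3 N + 1.
  \<open>W (Suc N)\<close> itself has order 3 N and enters only the second coefficient.\<close>

lemma leading_lhs:
  assumes "N \<ge> 1" "leading (3 * N - 2) a b (W (Suc N))"
  shows "leading (3 * N - 1) (6 * of_nat N * a)
    (2 * of_nat N * a + 2 * ((3 * of_nat N - 1) * b - 3 * of_nat N * a))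
    (2 * (of_nat N * W (Suc N)) + 2 * ((1 - T) * theta (W (Suc N))))"
proof -
  obtain M where N: "N = Suc M" using assms(1) by (cases N) auto
  have d: "3 * N - 2 = 3 * M + 1" "3 * N - 1 = Suc (3 * M + 1)" using N by auto
  have W: "leading (3 * M + 1) a b (W (Suc N))" using assms(2) d by simp
  have "leading (Suc (3 * M + 2)) (3 * of_nat N * a) ((3 * of_nat N - 1) * b - 3 * of_nat N * a) (theta (W (Suc N)))"
    using leading_theta[OF W] by (simp add: N algebra_simps numeral_eq_Suc)
  from leading_two_mult[OF leading_one_minus_T_mult[OF this]]
    leading_two_mult[OF leading_of_nat_mult[OF leading_shift[OF W], of N]]
  show ?thesis unfolding d by (auto dest: leading_add simp: mult.assoc numeral_eq_Suc algebra_simps)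
qed

text \<open>Only the second power of \<open>theta\<close> and the convolution exceed order 3 N - 1;
  the remaining terms of the edge equation go into the remainder.\<close>

lemma leading_rhs:
  assumes "N \<ge> 1"
    and "leading (3 * N - 1) a b (theta (theta (W N)))"
    and "leading (3 * N - 1) a' b' (\<Sum>i=1..N. theta (W i) * theta (W (Suc N - i)))"
  shows "leading (3 * N - 1) (a + a') (b + b')
    (2 * (of_nat N * W (Suc N)) + 2 * ((1 - T) * theta (W (Suc N))))"
proof -
  have th: "leading (3 * N - 1) 0 0 (theta (W N))"
    using theta_W_poles[OF assms(1)] by (rule leading_0)
  define P where "P = of_nat N * W N - W N"
  have "P \<in> poles (3 * N - 1)"
  proof (cases "N = 1")
    case False
    then obtain j where j: "N = Suc j" "j \<ge> 1" using assms(1) by (cases N) auto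
    have "W N \<in> poles (3 * N - 1)" using W_poles[OF j(2)] unfolding j(1) by (rule poles_mono) simp
    thus ?thesis unfolding P_def by (intro poles_diff poles_of_nat_mult)
  qed (simp add: P_def poles_0)
  hence P: "leading (3 * N - 1) 0 0 P" by (rule leading_0)
  have D1: "leading (3 * N - 1) 0 0 (D (Suc N))" by (rule leading_0[OF D_poles])
  have "D N \<in> poles (3 * N - 1)"
    using assms(1) by (cases N) (auto intro: poles_mono[OF D_poles])
  hence D0: "leading (3 * N - 1) 0 0 (D N)" by (rule leading_0)
  show ?thesis
    unfolding edge_equation' P_def[symmetric]
    using leading_add[OF leading_add[OF leading_diff[OF leading_diff[OF leading_diff[OF leading_add[OF assms(2,3)]
          leading_two_mult[OF th]] th] leading_two_mult[OF P]] leading_two_mult[OF D1]] leading_two_mult[OF D0]]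
    by simp
qed

text \<open>The base case stands apart because \<open>W 1\<close> has no pole expansion;
  \<open>theta (W 1)\<close> takes its place. The comparison reads 6 a = 5/4 and 4 b - 4 a =
  -5.\<close>

lemma W_2_leading: "leading 1 (5 / 24) (- 25 / 24) (W 2)"
proof -
  have "W 2 \<in> poles (1 + 2)" using W_poles[of 1] by (simp add: eval_nat_numeral)
  then obtain a b where W: "leading 1 a b (W 2)" using leading_exists by blast
  have L: "leading 2 (6 * a) (2 * a + 2 * (2 * b - 3 * a))
      (2 * (of_nat 1 * W (Suc 1)) + 2 * ((1 - T) * theta (W (Suc 1))))"
    using leading_lhs[of 1 a b] W by (simp add: numeral_2_eq_2)
  have "leading 2 1 (- 3) (theta (theta (W 1)))"
    using leading_theta[OF theta_W_1_leading] by (simp add: numeral_2_eq_2)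
  moreover have "leading 2 (1 / 4) (- 2) (\<Sum>i=1..1. theta (W i) * theta (W (Suc 1 - i)))"
    using leading_mult[OF theta_W_1_leading theta_W_1_leading] by (simp add: numeral_2_eq_2)
  ultimately have "leading 2 (1 + 1 / 4) (- 3 + - 2)
      (2 * (of_nat 1 * W (Suc 1)) + 2 * ((1 - T) * theta (W (Suc 1))))"
    using leading_rhs[of 1 1 "- 3" "1 / 4" "- 2"] by simp
  with L have "6 * a = 1 + 1 / 4 \<and> 2 * a + 2 * (2 * b - 3 * a) = - 3 + - 2"
    by (rule leading_unique)
  hence "a = 5 / 24" "b = - 25 / 24" by simp_all
  with W show ?thesis by simp
qed

theorem W_leading:
  "k \<ge> 1 \<Longrightarrow> leading (3 * k - 2) (wright_b k) (- wright_c' k) (W (Suc k))"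
proof (induction k rule: less_induct)
  case (less N)
  show ?case
  proof (cases "N = 1")
    case True
    thus ?thesis using W_2_leading by (simp add: numeral_2_eq_2)
  next
    case False
    then obtain k where N: "N = Suc k" "k \<ge> 1" using less.prems by (cases N) auto
    have d: "3 * N - 1 = 3 * k + 2" "3 * N - 2 = 3 * k + 1" using N by auto
    have "3 * N - 2 + 2 = 3 * N" using N by auto
    hence "W (Suc N) \<in> poles (3 * N - 2 + 2)" using W_poles[OF less.prems] by (simp only:)
    then obtain a b where W: "leading (3 * N - 2) a b (W (Suc N))" using leading_exists by blast
    \<comment> \<open>A t and B t are the two leading coefficients of
      \<open>theta (W (Suc t))\<close>, by \<open>leading_theta\<close> and the induction
      hypothesis.\<close>
    define A where "A t = 3 * of_nat t * wright_b t" for t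
    define B where "B t = - ((3 * of_nat t - 1) * wright_c' t) - 3 * of_nat t * wright_b t" for t
    have th: "leading (3 * t) (A t) (B t) (theta (W (Suc t)))" if "1 \<le> t" "t \<le> k" for t
    proof -
      obtain j where t: "t = Suc j" using \<open>1 \<le> t\<close> by (cases t) auto
      have "leading (3 * t - 2) (wright_b t) (- wright_c' t) (W (Suc t))"
        using that N by (intro less.IH) auto
      from leading_theta[OF this] show ?thesis
        unfolding A_def B_def by (simp add: t algebra_simps numeral_eq_Suc del: wright_b.simps wright_c'.simps)
    qed
    have t1: "leading (3 * k + 2) ((of_nat (3 * k) + 2) * A k) ((of_nat (3 * k) + 1) * B k - (of_nat (3 * k) + 2) * A k)
        (theta (theta (W N)))"
      using leading_theta[OF th[of k]] N by simp
    have edge: "leading (3 * k + 2) (A k / 2) (B k / 2 - 2 * A k) (theta (W 1) * theta (W N))"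
      using leading_mult[OF theta_W_1_leading th[of k]] N by (simp add: algebra_simps)
    have mid: "leading (3 * k + 2) (\<Sum>t=1..k-1. A t * A (k - t)) (\<Sum>t=1..k-1. A t * B (k - t) + B t * A (k - t))
        (\<Sum>t=1..k-1. theta (W (Suc t)) * theta (W (Suc (k - t))))"
    proof (rule leading_sum)
      fix t assume t: "t \<in> {1..k-1}"
      have "3 * t + 3 * (k - t) + 2 = 3 * k + 2" using t by auto
      thus "leading (3 * k + 2) (A t * A (k - t)) (A t * B (k - t) + B t * A (k - t))
          (theta (W (Suc t)) * theta (W (Suc (k - t))))"
        using leading_mult[OF th[of t] th[of "k - t"]] t by auto
    qed
    \<comment> \<open>The two end terms contain \<open>theta (W 1)\<close>, whose coefficients 1/2
      and -2 do not come from the induction; the middle terms are all covered by it.\<close>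
    have split: "(\<Sum>i=1..N. theta (W i) * theta (W (Suc N - i)))
      = theta (W 1) * theta (W N) + theta (W 1) * theta (W N) + (\<Sum>t=1..k-1. theta (W (Suc t)) * theta (W (Suc (k - t))))"
    proof -
      have "(\<Sum>i=1..N. theta (W i) * theta (W (Suc N - i)))
         = theta (W 1) * theta (W N) + (\<Sum>i=Suc 1..N. theta (W i) * theta (W (Suc N - i)))"
        using less.prems by (subst sum.atLeast_Suc_atMost) simp_all
      also have "(\<Sum>i=Suc 1..N. theta (W i) * theta (W (Suc N - i)))
         = (\<Sum>t=1..k. theta (W (Suc t)) * theta (W (Suc k - t)))"
        unfolding N(1) sum.shift_bounds_cl_Suc_ivl by simp
      also have "\<dots> = (\<Sum>t=1..k-1. theta (W (Suc t)) * theta (W (Suc k - t))) + theta (W N) * theta (W 1)"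
        using N by (cases k) simp_all
      also have "(\<Sum>t=1..k-1. theta (W (Suc t)) * theta (W (Suc k - t)))
          = (\<Sum>t=1..k-1. theta (W (Suc t)) * theta (W (Suc (k - t))))"
        by (rule sum.cong) (auto simp: Suc_diff_le)
      finally show ?thesis by (simp add: add_ac mult.commute)
    qed
    define S where "S = (\<Sum>t=1..k-1. of_nat t * of_nat (k - t) * wright_b t * wright_b (k - t))"
    define R where "R = (\<Sum>t=1..k-1. of_nat t * (3 * of_nat k - 3 * of_nat t - 1) * wright_b t * wright_c' (k - t))"
    have AA: "(\<Sum>t=1..k-1. A t * A (k - t)) = 9 * S"
      unfolding S_def sum_distrib_left by (rule sum.cong) (simp_all add: A_def)
    \<comment> \<open>Reflection makes the two mixed convolutions equal. The part of B with c' gives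
      R, the part with b gives S.\<close>
    have AB: "(\<Sum>t=1..k-1. A t * B (k - t) + B t * A (k - t)) = - 6 * R - 18 * S"
    proof -
      have "(\<Sum>t=1..k-1. B t * A (k - t)) = (\<Sum>t=1..k-1. B (k - t) * A (k - (k - t)))"
        by (rule sum_reflect[symmetric])
      also have "\<dots> = (\<Sum>t=1..k-1. A t * B (k - t))" by (rule sum.cong) (auto simp: mult.commute)
      finally have "(\<Sum>t=1..k-1. A t * B (k - t) + B t * A (k - t)) = (\<Sum>t=1..k-1. 2 * (A t * B (k - t)))"
        by (simp add: sum.distrib sum_distrib_left[symmetric])
      also have "\<dots> = (\<Sum>t=1..k-1. - 6 * (of_nat t * (3 * of_nat k - 3 * of_nat t - 1) * wright_b t * wright_c' (k - t))
          - 18 * (of_nat t * of_nat (k - t) * wright_b t * wright_b (k - t)))"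
      proof (rule sum.cong[OF refl])
        fix t assume t: "t \<in> {1..k-1}"
        have "k = t + (k - t)" using t by auto
        hence "(of_nat k :: rat) = of_nat t + of_nat (k - t)" by (metis of_nat_add)
        hence e: "3 * of_nat k - 3 * of_nat t - 1 = (3 * of_nat (k - t) - 1 :: rat)" by linarith
        show "2 * (A t * B (k - t)) = - 6 * (of_nat t * (3 * of_nat k - 3 * of_nat t - 1) * wright_b t * wright_c' (k - t))
          - 18 * (of_nat t * of_nat (k - t) * wright_b t * wright_b (k - t))"
          unfolding e A_def B_def by (simp add: algebra_simps)
      qed
      finally show ?thesis by (simp add: sum_subtractf sum_distrib_left R_def S_def)
    qed
    have "leading (3 * N - 1) (6 * of_nat N * a) (2 * of_nat N * a + 2 * ((3 * of_nat N - 1) * b - 3 * of_nat N * a))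
       (2 * (of_nat N * W (Suc N)) + 2 * ((1 - T) * theta (W (Suc N))))"
      using less.prems W by (rule leading_lhs)
    moreover have "leading (3 * N - 1) ((of_nat (3 * k) + 2) * A k + (A k / 2 + A k / 2 + 9 * S))
       (((of_nat (3 * k) + 1) * B k - (of_nat (3 * k) + 2) * A k) + ((B k / 2 - 2 * A k) + (B k / 2 - 2 * A k) + (- 6 * R - 18 * S)))
       (2 * (of_nat N * W (Suc N)) + 2 * ((1 - T) * theta (W (Suc N))))"
      using t1 leading_add[OF leading_add[OF edge edge] mid] less.prems
      by (intro leading_rhs) (simp_all only: split d AA AB)
    ultimately have eq: "6 * of_nat N * a = (of_nat (3 * k) + 2) * A k + (A k / 2 + A k / 2 + 9 * S)"
      "2 * of_nat N * a + 2 * ((3 * of_nat N - 1) * b - 3 * of_nat N * a)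
        = ((of_nat (3 * k) + 1) * B k - (of_nat (3 * k) + 2) * A k) + ((B k / 2 - 2 * A k) + (B k / 2 - 2 * A k) + (- 6 * R - 18 * S))"
      by (auto dest: leading_unique)
    have b_rec: "2 * (of_nat k + 1) * wright_b N = 3 * of_nat k * (of_nat k + 1) * wright_b k + 3 * S"
      using wright_b_rec[OF N(2)] by (simp add: N S_def)
    have c_rec: "2 * (3 * of_nat k + 2) * wright_c' N = 8 * (of_nat k + 1) * wright_b N + 6 * of_nat k * wright_b k
      + (3 * of_nat k + 2) * (3 * of_nat k - 1) * wright_c' k + 6 * R"
      using wright_c'_full_rec[OF N(2)] by (simp add: N R_def)
    have "(6 * of_nat k + 6) * a = (6 * of_nat k + 6) * wright_b N"
      using eq(1) b_rec unfolding A_def N(1) by (simp add: algebra_simps)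
    moreover have "(6 * of_nat k + 6 :: rat) > 0" by (simp add: add_nonneg_pos)
    ultimately have a: "a = wright_b N" by (metis mult_cancel_left less_irrefl)
    \<comment> \<open>S is eliminated through \<open>b_rec\<close>; this turns the term 4 (k + 1)
      b_N from the left side into -8 (k + 1) b_N, as \<open>c_rec\<close> demands.\<close>
    have "(6 * of_nat k + 4) * b = (6 * of_nat k + 4) * (- wright_c' N)"
      using eq(2) b_rec c_rec unfolding a unfolding A_def B_def N(1) by (simp add: algebra_simps)
    moreover have "(6 * of_nat k + 4 :: rat) > 0" by (simp add: add_nonneg_pos)
    ultimately have "b = - wright_c' N" by (metis mult_cancel_left less_irrefl)
    with W a show ?thesis by simp
  qed
qed

end

section \<open>The triangle-free case and the explicit expansion\<close>

interpretation triangle_free: perturbed_graphs "series_of graphs.total" "series_of graphs.conn"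
  "series_of triples.total" "series_of triples.conn"
proof
  show "series_of graphs.total $ 0 = 1" "series_of graphs.conn $ 0 = 0"
    "series_of triples.total $ 0 = 1" "series_of triples.conn $ 0 = 0"
    by (simp_all add: series_of_nth total_empty triples_conn_0)
  show "theta (series_of graphs.total) = series_of graphs.total * theta (series_of graphs.conn)"
    by (rule theta_series_of) (rule graphs.hypergraph_weight_axioms)
  show "theta (series_of triples.total) = series_of triples.total * theta (series_of triples.conn)"
    by (rule theta_series_of) (rule triples.hypergraph_weight_axioms)
  show "series_of graphs.total = choose_twist (series_of triples.total)"
    by (rule fps_ext) (simp add: series_of_nth total_graphs_eq mult_ac)
  show "series_of graphs.conn $ n $ i = 0" if "i + 1 < n" for n i
    using graphs_conn_nth_eq_0[OF that] by (simp add: series_of_nth)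
  show "series_of triples.conn $ n $ i = 0" if "2 * i + 3 < 3 * n" for n i
    using triples_conn_nth_eq_0[OF that] by (simp add: series_of_nth)
  show "series_of triples.conn $ 1 = 1" "series_of triples.conn $ 2 $ 2 = 0"
    by (simp_all only: series_of_nth triples_conn_1 triples_conn_2) simp_all
  show "series_of triples.conn $ 3 $ 3 = - 1 / 6"
    using triples_conn_3 by (simp add: series_of_nth fact_numeral)
qed

lemma W_eq_triangle_free_egf: "triangle_free.W (Suc k) = triangle_free_egf k"
proof (rule fps_ext)
  fix n
  show "triangle_free.W (Suc k) $ n = triangle_free_egf k $ n"
  proof (cases "n = 0")
    case True
    show ?thesis
      by (simp add: True triangle_free.W_def triangle_free.L'_0 triangle_free_egf_def
          triangle_free_count_def connected_graph_def)
  next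
    case False
    hence "triangle_free.W (Suc k) $ n = series_of graphs.conn $ n $ (n + k)"
      by (simp add: triangle_free.W_def triangle_free.L'_def scale_down_def add.commute)
    thus ?thesis
      using graphs_conn_nth[of n k] by (simp add: series_of_nth triangle_free_egf_def)
  qed
qed

text \<open>Re-expanding the numerator at T = 1 writes it in powers of 1 - T. The i-th power over (1
  - T)^d has index d - i, which is negative once i exceeds d; hence integer exponents.\<close>

lemma poles_powi:
  assumes "f \<in> poles d"
  shows "\<exists>(I :: int set) \<omega>. finite I \<and> I \<subseteq> {..int d} \<and>
    f = (\<Sum>i\<in>I. fps_const (\<omega> i) / (1 - T) powi i)"
proof -
  obtain p where f: "f = poly_T p * U ^ d" using assms by (rule polesE)
  define q where "q = pcompose p [:1, -1:]"
  have p: "poly p x = poly q (1 - x)" for x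
    by (simp add: q_def poly_pcompose)
  have "poly_T p = (\<Sum>i\<le>degree q. fps_const (coeff q i) * (1 - T) ^ i)"
  proof -
    have "p = (\<Sum>i\<le>degree q. [:coeff q i:] * [:1, -1:] ^ i)"
      by (simp add: poly_eq_poly_eq_iff[symmetric] fun_eq_iff p poly_sum poly_altdef[of q])
    moreover have "poly_T (sum g A) = (\<Sum>i\<in>A. poly_T (g i))" for g and A :: "nat set"
      by (induction A rule: infinite_finite_induct) (simp_all add: poly_T_simps)
    ultimately show ?thesis by (simp only: poly_T_simps)
  qed
  define I where "I = (\<lambda>i. int d - int i) ` {..degree q}"
  define w where "w j = coeff q (nat (int d - j))" for j
  have unit: "(1 - T) $ 0 = 1" by (simp add: T_0)
  have powi: "c / (1 - T) powi (int d - int i) = c * ((1 - T) ^ i * U ^ d)" for c i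
  proof (cases "i \<le> d")
    case True
    have "c / (1 - T) powi (int d - int i) = c * inverse ((1 - T) ^ (d - i))"
      using True unit by (subst fps_divide_unit) (simp_all add: power_int_def nat_diff_distrib fps_power_zeroth)
    also have "inverse ((1 - T) ^ (d - i)) = (1 - T) ^ i * U ^ d"
      using U_power_cancel[OF True] by (simp add: fps_inverse_power)
    finally show ?thesis .
  next
    case False
    have "(1 - T) powi (int d - int i) = U ^ (i - d)"
      using False by (simp add: power_int_def nat_diff_distrib)
    hence "c / (1 - T) powi (int d - int i) = c * inverse (U ^ (i - d))"
      using unit by (simp add: fps_divide_unit fps_power_zeroth)
    also have "inverse (U ^ (i - d)) = (1 - T) ^ (i - d)"
      using unit by (simp add: fps_inverse_power)
    also have "\<dots> = (1 - T) ^ i * U ^ d"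
    proof -
      have "(1 - T) ^ i * U ^ d = (1 - T) ^ (i - d) * ((1 - T) ^ d * U ^ d)"
        using False by (simp add: mult.assoc[symmetric] flip: power_add)
      thus ?thesis using U_power_cancel[of d d] by simp
    qed
    finally show ?thesis .
  qed
  have "(\<Sum>j\<in>I. fps_const (w j) / (1 - T) powi j)
      = (\<Sum>i\<le>degree q. fps_const (coeff q i) * ((1 - T) ^ i * U ^ d))"
    unfolding I_def by (subst sum.reindex) (auto simp: inj_on_def w_def powi)
  also have "\<dots> = f" unfolding f \<open>poly_T p = _\<close> by (simp add: sum_distrib_right mult.assoc)
  finally have "f = (\<Sum>j\<in>I. fps_const (w j) / (1 - T) powi j)" ..
  moreover have "finite I" "I \<subseteq> {..int d}" by (auto simp: I_def)
  ultimately show ?thesis by blast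
qed

theorem theorem14:
  fixes k :: nat
  assumes "k \<ge> 2"
  shows "\<exists>(I :: int set) (\<omega> :: int \<Rightarrow> rat). finite I \<and> I \<subseteq> {..3 * int k - 2} \<and>
    triangle_free_egf k =
      fps_const (wright_b k) / (1 - rooted_tree_egf) ^ (3 * k)
      - fps_const (wright_c' k) / (1 - rooted_tree_egf) ^ (3 * k - 1)
      + (\<Sum>i\<in>I. fps_const (\<omega> i) / (1 - rooted_tree_egf) powi i)"
proof -
  \<comment> \<open>\<open>leading\<close> is indexed two below the pole order, and for this k the
    truncated subtractions are exact.\<close>
  have exponents: "3 * k - 2 + 2 = 3 * k" "3 * k - 2 + 1 = 3 * k - 1" using assms by auto
  define r where "r = triangle_free_egf k
      - (fps_const (wright_b k) * U ^ (3 * k) + fps_const (- wright_c' k) * U ^ (3 * k - 1))"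
  have "leading (3 * k - 2) (wright_b k) (- wright_c' k) (triangle_free_egf k)"
    using triangle_free.W_leading[of k] assms by (simp add: W_eq_triangle_free_egf)
  hence "r \<in> poles (3 * k - 2)" by (simp only: leading_def r_def exponents)
  from poles_powi[OF this] obtain I \<omega> where I: "finite I" "I \<subseteq> {..int (3 * k - 2)}"
    and r: "r = (\<Sum>i\<in>I. fps_const (\<omega> i) / (1 - T) powi i)" by auto
  have "c / (1 - T) ^ n = c * U ^ n" for c n
    using T_0 by (simp add: fps_divide_unit fps_power_zeroth fps_inverse_power)
  hence "triangle_free_egf k = fps_const (wright_b k) / (1 - T) ^ (3 * k)
      - fps_const (wright_c' k) / (1 - T) ^ (3 * k - 1) + r"
    by (simp add: r_def flip: fps_const_neg)
  thus ?thesis using I assms unfolding r by (intro exI[of _ I] exI[of _ \<omega>]) auto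
qed

end
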